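(* Let $\mathbf{g}$ be a hyperbolic Darboux integrable Lorentzian metric with a spacelike Killing field on $M$. Then, up to local coordinate transformations on $M$ and multiplication of the metric by a positive constant, $\mathbf{g}$ is locally equivalent to $$\mathbf{g}=\cos^4u\,(du)^2-\sin^2u\,(dv)^2,\quad\text{with } K=-\sec^4u.$$
   Context: $M$ is a Lorentzian surface with orthonormal frame bundle $\mathcal{F}_M$, canonical dual forms $\eta^1,\eta^2$ (so $\mathbf{g}=(\eta^1)^2-(\eta^2)^2$) and connection form $\eta^1_2=\eta^2_1$ satisfying $$d\eta^1=-\eta^1_2\wedge\eta^2,\quad d\eta^2=-\eta^2_1\wedge\eta^1,\quad d\eta^1_2=-K\,\eta^1\wedge\eta^2,$$ which fixes the sign convention for the Gauss curvature $K$. The metric is elliptic if $K>0$ and hyperbolic if $K<0$. A vector $X$ is spacelike if $\langle X,X\rangle<0$ and timelike if $\langle X,X\rangle>0$. The Killing field meant is $V=q_1e_2-q_2e_1$, where $q=|K|^{-3/4}$, $dq=q_1\eta^1+q_2\eta^2$ and $(e_1,e_2)$ is the orthonormal framing dual to $(\eta^1,\eta^2)$ ($V$ is a Killing field whenever $\mathbf{g}$ is Darboux integrable). $\mathbb{R}^{1,2}$ is $\mathbb{R}^3$ with inner product of signature $(1,2)$. $\mathcal{F}_{\mathbb{R}^{1,2}}$ is the bundle of orthonormal frames $(e_1,e_2,e_3)$ with $\langle e_1,e_1\rangle=1$, $\langle e_2,e_2\rangle=\langle e_3,e_3\rangle=-1$, $\langle e_a,e_b\rangle=0$ for $a\ne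 b$; with basepoint map $\rho$, its canonical and connection forms are defined by $d\rho=e_i\omega^i$, $de_i=e_j\omega^j_i$. The isometric embedding system $\mathcal{I}$ is the Pfaffian exterior differential system on $\mathcal{F}_M\times\mathcal{F}_{\mathbb{R}^{1,2}}$ generated by $\theta_0=\omega^3$, $\theta_1=\omega^1-\eta^1$, $\theta_2=\omega^2-\eta^2$, $\theta_3=\omega^1_2-\eta^1_2$. Put $k=\sqrt{|K|}$. If $K<0$, its singular systems are $V_\pm=\operatorname{span}\{\theta_0,\theta_1,\theta_2,\theta_3,\omega^3_1\mp k\eta^2,\omega^3_2\pm k\eta^1\}$; if $K>0$, they are $W=\operatorname{span}_{\mathbb{C}}\{\theta_0,\theta_1,\theta_2,\theta_3,\omega^3_1-\mathrm{i}k\eta^2,\omega^3_2+\mathrm{i}k\eta^1\}$ in the complexified cotangent bundle and its conjugate $\overline{W}$. The metric $\mathbf{g}$ is Darboux integrable if, locally, each of the two singular systems contains a (real, respectively complex) Frobenius subbundle of rank at least $2$ that intersects the span of $\theta_0,\theta_1,\theta_2,\theta_3$ only in $0$. *)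

theory Defs
  imports "HOL-Analysis.Analysis"
begin

section \<open>Smooth maps and differential forms\<close>

primrec times_diff_on ::
  "nat \<Rightarrow> 'a::real_normed_vector set \<Rightarrow> ('a \<Rightarrow> 'b::real_normed_vector) \<Rightarrow> bool" where
  "times_diff_on 0 S f \<longleftrightarrow> continuous_on S f"
| "times_diff_on (Suc n) S f \<longleftrightarrow>
     (\<forall>x\<in>S. f differentiable (at x)) \<and>
     (\<forall>v. times_diff_on n S (\<lambda>x. frechet_derivative f (at x) v))"

text \<open>Only meaningful for open \<open>S\<close>.\<close>

definition smooth_on ::
  "'a::real_normed_vector set \<Rightarrow> ('a \<Rightarrow> 'b::real_normed_vector) \<Rightarrow> bool" where
  "smooth_on S f \<longleftrightarrow> (\<forall>n. times_diff_on n S f)"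

text \<open>
  A 1-form assigns to a point a real-linear functional with values in \<open>'k\<close>; the scalars \<open>'k\<close> are
  \<open>real\<close> for ordinary forms and \<open>complex\<close> for sections of the complexified cotangent bundle.
  A form on a submanifold \<open>N\<close> of a Euclidean space is represented by a form on an open
  set of the ambient space, of which only the restriction to the tangent spaces of \<open>N\<close> is used.
  Restriction commutes with the exterior derivative, so the latter may be computed in the
  ambient space.
\<close>

type_synonym ('a, 'k) form1 = "'a \<Rightarrow> 'a \<Rightarrow> 'k"

definition smooth_form_on ::
  "'a::real_normed_vector set \<Rightarrow> ('a, 'k::real_normed_field) form1 \<Rightarrow> bool" where
  "smooth_form_on S \<omega> \<longleftrightarrow>
     (\<forall>z\<in>S. linear (\<omega> z)) \<and> (\<forall>v. smooth_on S (\<lambda>z. \<omega> z v))"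

definition ext_d ::
  "('a::real_normed_vector, 'k::real_normed_field) form1 \<Rightarrow> 'a \<Rightarrow> 'a \<Rightarrow> 'a \<Rightarrow> 'k" where
  "ext_d \<omega> z v w =
     frechet_derivative (\<lambda>y. \<omega> y w) (at z) v - frechet_derivative (\<lambda>y. \<omega> y v) (at z) w"

definition wedge :: "('a \<Rightarrow> 'k::real_normed_field) \<Rightarrow> ('a \<Rightarrow> 'k) \<Rightarrow> 'a \<Rightarrow> 'a \<Rightarrow> 'k" where
  "wedge \<alpha> \<beta> v w = \<alpha> v * \<beta> w - \<alpha> w * \<beta> v"

text \<open>
  Velocities of curves in \<open>N\<close>. For an embedded submanifold this is the usual tangent space; it
  makes no difference there whether the curves are smooth or merely differentiable at \<open>0\<close>.
\<close>

definition tangent_space :: "'a::real_normed_vector set \<Rightarrow> 'a \<Rightarrow> 'a set" where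
  "tangent_space N z =
     {v. \<exists>\<gamma>::real \<Rightarrow> 'a. \<gamma> 0 = z \<and> (\<forall>t. \<gamma> t \<in> N) \<and> (\<gamma> has_vector_derivative v) (at 0)}"


section \<open>Lorentzian metrics in coordinates and their frame bundle\<close>

type_synonym metric = "real^2 \<Rightarrow> real^2 \<Rightarrow> real^2 \<Rightarrow> real"
type_synonym frame2 = "(real^2) \<times> (real^2) \<times> (real^2)"

definition orthonormal2 :: "metric \<Rightarrow> real^2 \<Rightarrow> real^2 \<Rightarrow> real^2 \<Rightarrow> bool" where
  "orthonormal2 g x e1 e2 \<longleftrightarrow> g x e1 e1 = 1 \<and> g x e2 e2 = -1 \<and> g x e1 e2 = 0"

definition lorentzian_metric_on :: "(real^2) set \<Rightarrow> metric \<Rightarrow> bool" where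
  "lorentzian_metric_on D g \<longleftrightarrow>
     (\<forall>x\<in>D. bilinear (g x) \<and> (\<forall>v w. g x v w = g x w v) \<and> (\<exists>e1 e2. orthonormal2 g x e1 e2)) \<and>
     (\<forall>v w. smooth_on D (\<lambda>x. g x v w))"

definition frame_bundle :: "(real^2) set \<Rightarrow> metric \<Rightarrow> frame2 set" where
  "frame_bundle D g = {(x, e1, e2). x \<in> D \<and> orthonormal2 g x e1 e2}"

text \<open>
  The canonical forms \<open>\<eta>\<^sup>1, \<eta>\<^sup>2\<close>: if \<open>dx\<close> is the velocity of the base point, then
  \<open>dx = e1 \<eta>\<^sup>1 + e2 \<eta>\<^sup>2\<close>, and the components are read off with the metric.
\<close>

fun eta1 :: "metric \<Rightarrow> (frame2, real) form1" where
  "eta1 g (x, e1, e2) (dx, de1, de2) = g x dx e1"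

fun eta2 :: "metric \<Rightarrow> (frame2, real) form1" where
  "eta2 g (x, e1, e2) (dx, de1, de2) = - g x dx e2"

text \<open>
  On the frame bundle these equations determine the connection form
  \<open>\<kappa> = \<eta>\<^sup>1\<^sub>2 = \<eta>\<^sup>2\<^sub>1\<close> and the Gauss curvature \<open>K\<close> uniquely.
\<close>

definition structure_equations ::
  "(real^2) set \<Rightarrow> metric \<Rightarrow> (frame2, real) form1 \<Rightarrow> (real^2 \<Rightarrow> real) \<Rightarrow> bool" where
  "structure_equations D g \<kappa> K \<longleftrightarrow>
     smooth_form_on (D \<times> UNIV) \<kappa> \<and>
     (\<forall>z\<in>frame_bundle D g.
        \<forall>v\<in>tangent_space (frame_bundle D g) z. \<forall>w\<in>tangent_space (frame_bundle D g) z.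
          ext_d (eta1 g) z v w = - wedge (\<kappa> z) (eta2 g z) v w \<and>
          ext_d (eta2 g) z v w = - wedge (\<kappa> z) (eta1 g z) v w \<and>
          ext_d \<kappa> z v w = - K (fst z) * wedge (eta1 g z) (eta2 g z) v w)"

definition has_gauss_curvature :: "(real^2) set \<Rightarrow> metric \<Rightarrow> (real^2 \<Rightarrow> real) \<Rightarrow> bool" where
  "has_gauss_curvature D g K \<longleftrightarrow> (\<exists>\<kappa>. structure_equations D g \<kappa> K)"


section \<open>Orthonormal frames of three-dimensional Minkowski space\<close>

type_synonym frame3 = "(real^3) \<times> (real^3) \<times> (real^3) \<times> (real^3)"

definition mink :: "real^3 \<Rightarrow> real^3 \<Rightarrow> real" where
  "mink v w = v $ 1 * w $ 1 - v $ 2 * w $ 2 - v $ 3 * w $ 3"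

definition mink_frames :: "frame3 set" where
  "mink_frames = {(y, e1, e2, e3).
     mink e1 e1 = 1 \<and> mink e2 e2 = -1 \<and> mink e3 e3 = -1 \<and>
     mink e1 e2 = 0 \<and> mink e1 e3 = 0 \<and> mink e2 e3 = 0}"

text \<open>
  Components of \<open>dy = e\<^sub>i \<omega>\<^sup>i\<close> and \<open>de\<^sub>i = e\<^sub>j \<omega>\<^sup>j\<^sub>i\<close>, obtained by pairing with the frame vectors.
  In \<open>om12\<close>, \<open>om31\<close>, \<open>om32\<close> the first index is the upper one.
\<close>

fun om1 :: "(frame3, real) form1" where
  "om1 (y, e1, e2, e3) (dy, de1, de2, de3) = mink dy e1"

fun om2 :: "(frame3, real) form1" where
  "om2 (y, e1, e2, e3) (dy, de1, de2, de3) = - mink dy e2"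

fun om3 :: "(frame3, real) form1" where
  "om3 (y, e1, e2, e3) (dy, de1, de2, de3) = - mink dy e3"

fun om12 :: "(frame3, real) form1" where
  "om12 (y, e1, e2, e3) (dy, de1, de2, de3) = mink de2 e1"

fun om31 :: "(frame3, real) form1" where
  "om31 (y, e1, e2, e3) (dy, de1, de2, de3) = - mink de1 e3"

fun om32 :: "(frame3, real) form1" where
  "om32 (y, e1, e2, e3) (dy, de1, de2, de3) = - mink de2 e3"


section \<open>The isometric embedding system and Darboux integrability\<close>

type_synonym embpt = "frame2 \<times> frame3"

text \<open>The generators \<open>\<theta>\<^sub>0, \<dots>, \<theta>\<^sub>3\<close>.\<close>

definition embedding_system ::
  "metric \<Rightarrow> (frame2, real) form1 \<Rightarrow> (embpt, 'k::real_normed_field) form1 list" where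
  "embedding_system g \<kappa> =
     [\<lambda>z v. of_real (om3 (snd z) (snd v)),
      \<lambda>z v. of_real (om1 (snd z) (snd v) - eta1 g (fst z) (fst v)),
      \<lambda>z v. of_real (om2 (snd z) (snd v) - eta2 g (fst z) (fst v)),
      \<lambda>z v. of_real (om12 (snd z) (snd v) - \<kappa> (fst z) (fst v))]"

text \<open>
  The singular systems are all of the form
  \<open>span {\<theta>\<^sub>0, \<theta>\<^sub>1, \<theta>\<^sub>2, \<theta>\<^sub>3, \<omega>\<^sup>3\<^sub>1 - s k \<eta>\<^sup>2, \<omega>\<^sup>3\<^sub>2 + s k \<eta>\<^sup>1}\<close> with \<open>k = sqrt \<bar>K\<bar>\<close>:
  \<open>s = 1\<close> and \<open>s = -1\<close> give \<open>V\<^sub>+\<close> and \<open>V\<^sub>-\<close>; \<open>s = \<i>\<close> and \<open>s = -\<i>\<close> give \<open>W\<close> and its conjugate.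
\<close>

definition singular_system ::
  "'k \<Rightarrow> metric \<Rightarrow> (frame2, real) form1 \<Rightarrow> (real^2 \<Rightarrow> real)
     \<Rightarrow> (embpt, 'k::real_normed_field) form1 list" where
  "singular_system s g \<kappa> K = embedding_system g \<kappa> @
     [\<lambda>z v. of_real (om31 (snd z) (snd v))
        - s * of_real (sqrt \<bar>K (fst (fst z))\<bar> * eta2 g (fst z) (fst v)),
      \<lambda>z v. of_real (om32 (snd z) (snd v))
        + s * of_real (sqrt \<bar>K (fst (fst z))\<bar> * eta1 g (fst z) (fst v))]"

text \<open>
  Near \<open>z0\<close>, the span of \<open>\<sigma>s\<close> in the (complexified) cotangent bundle of \<open>N\<close> contains a subbundle of
  rank \<open>r \<ge> 2\<close>, with local frame \<open>\<alpha> 0, \<dots>, \<alpha> (r - 1)\<close>, that is Frobenius, i.e.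
  \<open>d (\<alpha> i)\<close> vanishes modulo the \<open>\<alpha> j\<close>, and that meets the span of \<open>\<theta>s\<close> only in \<open>0\<close>.
\<close>

definition has_frobenius_subbundle_near ::
  "'a::real_normed_vector set \<Rightarrow> ('a, 'k::real_normed_field) form1 list
     \<Rightarrow> ('a, 'k) form1 list \<Rightarrow> 'a \<Rightarrow> bool" where
  "has_frobenius_subbundle_near N \<sigma>s \<theta>s z0 \<longleftrightarrow>
     (\<exists>\<Omega> r (\<alpha> :: nat \<Rightarrow> ('a, 'k) form1).
        open \<Omega> \<and> z0 \<in> \<Omega> \<and> 2 \<le> r \<and> (\<forall>i<r. smooth_form_on \<Omega> (\<alpha> i)) \<and>
        (\<forall>z\<in>\<Omega> \<inter> N.
           (\<forall>i<r. \<exists>c. \<forall>v\<in>tangent_space N z.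
              \<alpha> i z v = (\<Sum>j<length \<sigma>s. c j * (\<sigma>s ! j) z v)) \<and>
           (\<forall>a. (\<forall>v\<in>tangent_space N z. (\<Sum>i<r. a i * \<alpha> i z v) = 0) \<longrightarrow> (\<forall>i<r. a i = 0)) \<and>
           (\<forall>a c. (\<forall>v\<in>tangent_space N z.
                      (\<Sum>i<r. a i * \<alpha> i z v) = (\<Sum>j<length \<theta>s. c j * (\<theta>s ! j) z v)) \<longrightarrow>
                  (\<forall>v\<in>tangent_space N z. (\<Sum>i<r. a i * \<alpha> i z v) = 0)) \<and>
           (\<forall>i<r. \<exists>\<beta>. (\<forall>j<r. linear (\<beta> j)) \<and>
              (\<forall>v\<in>tangent_space N z. \<forall>w\<in>tangent_space N z.
                 ext_d (\<alpha> i) z v w = (\<Sum>j<r. wedge (\<beta> j) (\<alpha> j z) v w)))))"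

definition singular_system_integrable_near ::
  "'k::real_normed_field \<Rightarrow> (real^2) set \<Rightarrow> metric \<Rightarrow> (frame2, real) form1
     \<Rightarrow> (real^2 \<Rightarrow> real) \<Rightarrow> embpt \<Rightarrow> bool" where
  "singular_system_integrable_near s D g \<kappa> K z \<longleftrightarrow>
     has_frobenius_subbundle_near (frame_bundle D g \<times> mink_frames)
       (singular_system s g \<kappa> K) (embedding_system g \<kappa>) z"

definition darboux_integrable_on ::
  "(real^2) set \<Rightarrow> metric \<Rightarrow> (frame2, real) form1 \<Rightarrow> (real^2 \<Rightarrow> real) \<Rightarrow> bool" where
  "darboux_integrable_on D g \<kappa> K \<longleftrightarrow>
     (\<forall>z \<in> frame_bundle D g \<times> mink_frames.
        (K (fst (fst z)) < 0 \<and>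
           singular_system_integrable_near (1::real) D g \<kappa> K z \<and>
           singular_system_integrable_near (-1::real) D g \<kappa> K z) \<or>
        (K (fst (fst z)) > 0 \<and>
           singular_system_integrable_near \<i> D g \<kappa> K z \<and>
           singular_system_integrable_near (-\<i>) D g \<kappa> K z))"


section \<open>The Killing field\<close>

text \<open>The condition is the vanishing of the Lie derivative of \<open>g\<close> along \<open>V\<close>.\<close>

definition killing_field_on :: "(real^2) set \<Rightarrow> metric \<Rightarrow> (real^2 \<Rightarrow> real^2) \<Rightarrow> bool" where
  "killing_field_on D g V \<longleftrightarrow>
     smooth_on D V \<and>
     (\<forall>x\<in>D. \<forall>a b.
        frechet_derivative (\<lambda>y. g y a b) (at x) (V x)
        + g x (frechet_derivative V (at x) a) b
        + g x a (frechet_derivative V (at x) b) = 0)"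

definition spacelike_on :: "(real^2) set \<Rightarrow> metric \<Rightarrow> (real^2 \<Rightarrow> real^2) \<Rightarrow> bool" where
  "spacelike_on D g V \<longleftrightarrow> (\<forall>x\<in>D. g x (V x) (V x) < 0)"

definition orthonormal_framing_on ::
  "(real^2) set \<Rightarrow> metric \<Rightarrow> (real^2 \<Rightarrow> real^2) \<Rightarrow> (real^2 \<Rightarrow> real^2) \<Rightarrow> bool" where
  "orthonormal_framing_on D g E1 E2 \<longleftrightarrow>
     smooth_on D E1 \<and> smooth_on D E2 \<and> (\<forall>x\<in>D. orthonormal2 g x (E1 x) (E2 x))"

definition q_of :: "(real^2 \<Rightarrow> real) \<Rightarrow> real^2 \<Rightarrow> real" where
  "q_of K x = \<bar>K x\<bar> powr (- 3 / 4)"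

text \<open>\<open>V = q\<^sub>1 e\<^sub>2 - q\<^sub>2 e\<^sub>1\<close>, where \<open>q\<^sub>i = dq (e\<^sub>i)\<close>.\<close>

definition V_field ::
  "(real^2 \<Rightarrow> real) \<Rightarrow> (real^2 \<Rightarrow> real^2) \<Rightarrow> (real^2 \<Rightarrow> real^2) \<Rightarrow> real^2 \<Rightarrow> real^2" where
  "V_field K E1 E2 x =
     frechet_derivative (q_of K) (at x) (E1 x) *\<^sub>R E2 x
     - frechet_derivative (q_of K) (at x) (E2 x) *\<^sub>R E1 x"

text \<open>
  \<open>V_field\<close> depends on the framing only up to sign, and a framing need not exist on all of \<open>D\<close>;
  hence the condition is imposed for every local framing.
\<close>

definition spacelike_killing_on :: "(real^2) set \<Rightarrow> metric \<Rightarrow> (real^2 \<Rightarrow> real) \<Rightarrow> bool" where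
  "spacelike_killing_on D g K \<longleftrightarrow>
     (\<forall>S E1 E2. open S \<and> S \<subseteq> D \<and> orthonormal_framing_on S g E1 E2 \<longrightarrow>
        killing_field_on S g (V_field K E1 E2) \<and> spacelike_on S g (V_field K E1 E2))"


section \<open>Lorentzian surfaces\<close>

type_synonym 'm chart = "'m set \<times> ('m \<Rightarrow> real^2)"

definition chart_image :: "'m chart \<Rightarrow> (real^2) set" where
  "chart_image c = snd c ` fst c"

definition chart_inv :: "'m chart \<Rightarrow> real^2 \<Rightarrow> 'm" where
  "chart_inv c = inv_into (fst c) (snd c)"

definition is_chart :: "('m::topological_space) chart \<Rightarrow> bool" where
  "is_chart c \<longleftrightarrow> open (fst c) \<and> open (chart_image c) \<and>
     homeomorphism (fst c) (chart_image c) (snd c) (chart_inv c)"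

definition transition :: "'m chart \<Rightarrow> 'm chart \<Rightarrow> real^2 \<Rightarrow> real^2" where
  "transition c d = snd d \<circ> chart_inv c"

definition compatible :: "'m chart \<Rightarrow> 'm chart \<Rightarrow> bool" where
  "compatible c d \<longleftrightarrow>
     smooth_on (snd c ` (fst c \<inter> fst d)) (transition c d) \<and>
     smooth_on (snd d ` (fst c \<inter> fst d)) (transition d c)"

definition carrier_of :: "'m chart set \<Rightarrow> 'm set" where
  "carrier_of A = (\<Union>c\<in>A. fst c)"

definition smooth_surface :: "('m::{t2_space, second_countable_topology}) chart set \<Rightarrow> bool" where
  "smooth_surface A \<longleftrightarrow> (\<forall>c\<in>A. is_chart c) \<and> (\<forall>c\<in>A. \<forall>d\<in>A. compatible c d)"

text \<open>Charts of the surface in the sense of the maximal atlas, i.e. local coordinate systems.\<close>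

definition is_chart_of :: "('m::topological_space) chart set \<Rightarrow> 'm chart \<Rightarrow> bool" where
  "is_chart_of A c \<longleftrightarrow> is_chart c \<and> fst c \<subseteq> carrier_of A \<and> (\<forall>d\<in>A. compatible c d)"

text \<open>The transition map from \<open>c\<close> to \<open>d\<close> pulls \<open>h\<close> back to \<open>g\<close>.\<close>

definition same_metric :: "'m chart \<Rightarrow> metric \<Rightarrow> 'm chart \<Rightarrow> metric \<Rightarrow> bool" where
  "same_metric c g d h \<longleftrightarrow>
     (\<forall>p\<in>fst c \<inter> fst d. \<forall>v w.
        g (snd c p) v w =
        h (snd d p) (frechet_derivative (transition c d) (at (snd c p)) v)
                    (frechet_derivative (transition c d) (at (snd c p)) w))"

text \<open>A metric on a surface is given by its coordinate expressions in the charts of an atlas.\<close>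

definition lorentzian_surface ::
  "('m::{t2_space, second_countable_topology}) chart set \<Rightarrow> ('m chart \<Rightarrow> metric) \<Rightarrow> bool" where
  "lorentzian_surface A g \<longleftrightarrow> smooth_surface A \<and>
     (\<forall>c\<in>A. lorentzian_metric_on (chart_image c) (g c)) \<and>
     (\<forall>c\<in>A. \<forall>d\<in>A. same_metric c (g c) d (g d))"

definition connection_and_curvature ::
  "'m chart set \<Rightarrow> ('m chart \<Rightarrow> metric) \<Rightarrow> ('m chart \<Rightarrow> (frame2, real) form1) \<Rightarrow> ('m \<Rightarrow> real) \<Rightarrow> bool"
  where
  "connection_and_curvature A g \<kappa> K \<longleftrightarrow>
     (\<forall>c\<in>A. structure_equations (chart_image c) (g c) (\<kappa> c) (K \<circ> chart_inv c))"

definition hyperbolic :: "'m chart set \<Rightarrow> ('m \<Rightarrow> real) \<Rightarrow> bool" where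
  "hyperbolic A K \<longleftrightarrow> (\<forall>p\<in>carrier_of A. K p < 0)"

text \<open>
  Darboux integrability is a local condition, and \<open>chart_image c\<close> together with \<open>g c\<close> is isometric to
  the domain of \<open>c\<close>; so it may be tested chart by chart.
\<close>

definition darboux_integrable ::
  "'m chart set \<Rightarrow> ('m chart \<Rightarrow> metric) \<Rightarrow> ('m chart \<Rightarrow> (frame2, real) form1) \<Rightarrow> ('m \<Rightarrow> real) \<Rightarrow> bool"
  where
  "darboux_integrable A g \<kappa> K \<longleftrightarrow>
     (\<forall>c\<in>A. darboux_integrable_on (chart_image c) (g c) (\<kappa> c) (K \<circ> chart_inv c))"

definition has_spacelike_killing_field ::
  "'m chart set \<Rightarrow> ('m chart \<Rightarrow> metric) \<Rightarrow> ('m \<Rightarrow> real) \<Rightarrow> bool" where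
  "has_spacelike_killing_field A g K \<longleftrightarrow>
     (\<forall>c\<in>A. spacelike_killing_on (chart_image c) (g c) (K \<circ> chart_inv c))"

definition scale_metric :: "real \<Rightarrow> metric \<Rightarrow> metric" where
  "scale_metric r g = (\<lambda>x v w. r * g x v w)"

text \<open>\<open>cos\<^sup>4 u (du)\<^sup>2 - sin\<^sup>2 u (dv)\<^sup>2\<close> in the coordinates \<open>(u, v)\<close>.\<close>

definition normal_metric :: metric where
  "normal_metric x a b = cos (x $ 1) ^ 4 * (a $ 1 * b $ 1) - sin (x $ 1) ^ 2 * (a $ 2 * b $ 2)"

end

theory Submission
  imports Defs
begin

text \<open>
  Write \<open>K = -k\<^sup>2\<close> and let \<open>q = k\<^bsup>-3/2\<^esup>\<close>. Choose a local framing for which both components of \<open>dq\<close>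
  are nonzero. A Frobenius subbundle of \<open>V\<^sub>+\<close> as in the definition of Darboux integrability is spanned
  by forms \<open>\<omega>\<^sup>3\<^sub>1 - k \<eta>\<^sup>2 + \<Sum> a\<^sub>i \<theta>\<^sub>i\<close> and \<open>\<omega>\<^sup>3\<^sub>2 + k \<eta>\<^sup>1 + \<Sum> b\<^sub>i \<theta>\<^sub>i\<close>. Closing the annihilated distribution
  under Lie brackets expresses the logarithmic derivatives of \<open>k\<close> and all \<open>a\<^sub>i, b\<^sub>i\<close> through \<open>a\<^sub>3, b\<^sub>3\<close> and functions on
  the surface; brackets of fields tangent to the fibres then determine \<open>a\<^sub>3\<close> and \<open>b\<^sub>3\<close>. The Killing equation says
  that the Hessian of \<open>q\<close> is a multiple of the metric, and computing the derivative of \<open>a\<^sub>3\<close> in two ways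
  identifies the multiple as \<open>-3 q\<^bsup>-1/3\<^esup>\<close>.

  Consequently \<open>\<langle>dq, dq\<rangle> + 9 q\<^bsup>2/3\<^esup>\<close> is locally a constant \<open>9 c\<^sup>2\<close>, the form \<open>*dq / \<langle>dq, dq\<rangle>\<close> is closed, and
  \<open>u = arccos (q\<^bsup>1/3\<^esup> / c)\<close> together with a multiple of a primitive of this form are the required coordinates.
\<close>


section \<open>Calculus of smooth maps\<close>

text \<open>The conditions constrain forms only on tangent vectors of a product of frame bundles,
  which is not open in its ambient space. So the frame bundle of the surface is replaced by the
  section given by a framing, vector fields are encoded by their components, and identities valid
  over \<open>mink_frames\<close> are differentiated along tangential fields only.

  With w = q^(1/3) and d log w = -(f eta^1 + h eta^2), the brackets of fibre fields give h (k a_3 +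
  f) = 0 and f (k b_3 + h) = 0; this is why both components of dq have to be nonzero. The Killing
  equation reads Hess q = -3 q G g, and the outcome G = k^2 turns the factor into -3 q^(-1/3).

  Given Hess q = m g with m a function of q, d<dq,dq> = 2 m dq, and integrating 2 m = -6 q^(-1/3)
  yields the first integral. Finally cos u = w / c and K = -w^(-4) give -sec^4 u = c^4 K, so the
  metric must be multiplied by c^(-4).\<close>

abbreviation dd :: "('a::real_normed_vector \<Rightarrow> 'b::real_normed_vector) \<Rightarrow> 'a \<Rightarrow> 'a \<Rightarrow> 'b" where
  "dd f x \<equiv> frechet_derivative f (at x)"

lemma derivative_cong:
  assumes "open S" "x \<in> S" "\<And>y. y \<in> S \<Longrightarrow> f y = g y"
  shows "(f has_derivative D) (at x) \<longleftrightarrow> (g has_derivative D) (at x)"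
  using has_derivative_transform_within_open[of f D x UNIV S g]
    has_derivative_transform_within_open[of g D x UNIV S f] assms by auto

lemma differentiable_cong:
  assumes "open S" "x \<in> S" "\<And>y. y \<in> S \<Longrightarrow> f y = g y"
  shows "f differentiable (at x) \<longleftrightarrow> g differentiable (at x)"
  using derivative_cong[OF assms] by (simp add: differentiable_def)

lemma dd_cong_open:
  assumes "open S" "x \<in> S" "\<And>y. y \<in> S \<Longrightarrow> f y = g y"
  shows "dd f x = dd g x"
  using derivative_cong[OF assms] by (simp add: frechet_derivative_def)

lemma has_derivative_frechet:
  "f differentiable (at x) \<Longrightarrow> (f has_derivative dd f x) (at x)"
  by (simp add: frechet_derivative_works[symmetric])

lemma frechet_eq: "(f has_derivative D) (at x) \<Longrightarrow> dd f x = D"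
  by (metis frechet_derivative_at)

lemma times_diff_on_cong:
  assumes "open S" "\<And>x. x \<in> S \<Longrightarrow> f x = g x"
  shows "times_diff_on n S f \<longleftrightarrow> times_diff_on n S g"
  using assms(2)
proof (induction n arbitrary: f g)
  case 0
  then show ?case by (simp cong: continuous_on_cong)
next
  case (Suc n)
  have "times_diff_on n S (\<lambda>x. dd f x v) \<longleftrightarrow>
        times_diff_on n S (\<lambda>x. dd g x v)" for v
    using dd_cong_open[OF \<open>open S\<close> _ Suc.prems] by (intro Suc.IH) auto
  then show ?case
    using differentiable_cong[OF \<open>open S\<close> _ Suc.prems] by simp
qed

lemma smooth_on_cong:
  assumes "open S" "\<And>x. x \<in> S \<Longrightarrow> f x = g x"
  shows "smooth_on S f \<longleftrightarrow> smooth_on S g"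
  using times_diff_on_cong[OF assms] by (simp add: smooth_on_def)

text \<open>By uniqueness of derivatives, any derivative exhibited on an open set may replace the
  one chosen by \<open>frechet_derivative\<close>; without this no closure property could be proved
  by induction on the order.\<close>

lemma times_diff_on_SucI:
  assumes "open S" "\<And>x. x \<in> S \<Longrightarrow> (f has_derivative f' x) (at x)"
    and "\<And>v. times_diff_on n S (\<lambda>x. f' x v)"
  shows "times_diff_on (Suc n) S f"
proof -
  have "times_diff_on n S (\<lambda>x. dd f x v)" for v
    using assms(3)[of v] times_diff_on_cong[OF assms(1), of "\<lambda>x. dd f x v"]
      frechet_eq[OF assms(2)] by simp
  then show ?thesis using assms(2) by (auto simp: differentiable_def)
qed

lemma times_diff_on_SucD: "times_diff_on (Suc n) S f \<Longrightarrow> times_diff_on n S f"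
proof (induction n arbitrary: f)
  case 0
  then show ?case
    by (auto intro!: continuous_at_imp_continuous_on differentiable_imp_continuous_within)
next
  case (Suc n)
  then show ?case by (metis times_diff_on.simps(2))
qed

lemma times_diff_on_subset: "times_diff_on n S f \<Longrightarrow> T \<subseteq> S \<Longrightarrow> times_diff_on n T f"
  by (induction n arbitrary: f) (auto intro: continuous_on_subset)

lemma times_diff_on_const: "times_diff_on n S (\<lambda>x. c)"
  by (induction n arbitrary: c) (simp_all add: frechet_derivative_const)

lemma times_diff_on_linear:
  assumes "bounded_linear L"
  shows "times_diff_on n S L"
proof (cases n)
  case 0
  then show ?thesis by (simp add: assms linear_continuous_on)
next
  case (Suc m)
  have "(L has_derivative L) (at x)" for x
    by (rule bounded_linear_imp_has_derivative[OF assms])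
  moreover from this have "dd L x = L" for x
    by (rule frechet_eq)
  ultimately show ?thesis
    using Suc times_diff_on_const by (auto simp: differentiable_def)
qed

lemma times_diff_on_add:
  assumes "open S" "times_diff_on n S f" "times_diff_on n S g"
  shows "times_diff_on n S (\<lambda>x. f x + g x)"
  using assms(2,3)
proof (induction n arbitrary: f g)
  case 0
  then show ?case by (auto intro: continuous_on_add)
next
  case (Suc n)
  show ?case
  proof (rule times_diff_on_SucI[OF \<open>open S\<close>])
    show "((\<lambda>x. f x + g x) has_derivative
        (\<lambda>v. dd f x v + dd g x v)) (at x)" if "x \<in> S" for x
      using Suc.prems that by (auto intro!: has_derivative_add has_derivative_frechet)
  qed (use Suc in auto)
qed

lemma times_diff_on_bilinear:
  assumes "open S" "bounded_bilinear h" "times_diff_on n S f" "times_diff_on n S g"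
  shows "times_diff_on n S (\<lambda>x. h (f x) (g x))"
  using assms(3,4)
proof (induction n arbitrary: f g)
  case 0
  then show ?case by (auto intro: bounded_bilinear.continuous_on[OF assms(2)])
next
  case (Suc n)
  show ?case
  proof (rule times_diff_on_SucI[OF \<open>open S\<close>])
    show "((\<lambda>x. h (f x) (g x)) has_derivative
        (\<lambda>v. h (f x) (dd g x v) + h (dd f x v) (g x))) (at x)"
      if "x \<in> S" for x
      using Suc.prems that
      by (auto intro!: bounded_bilinear.FDERIV[OF assms(2)] has_derivative_frechet)
    show "times_diff_on n S (\<lambda>x. h (f x) (dd g x v) +
              h (dd f x v) (g x))" for v
      using Suc.prems times_diff_on_SucD[OF Suc.prems(1)] times_diff_on_SucD[OF Suc.prems(2)]
      by (intro times_diff_on_add[OF \<open>open S\<close>] Suc.IH) auto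
  qed
qed

lemma times_diff_on_sum:
  assumes "open S" "\<And>i. i \<in> I \<Longrightarrow> times_diff_on n S (f i)"
  shows "times_diff_on n S (\<lambda>x. \<Sum>i\<in>I. f i x)"
  using assms(2)
  by (induction I rule: infinite_finite_induct)
     (auto simp: times_diff_on_const intro!: times_diff_on_add[OF \<open>open S\<close>])

lemma times_diff_on_compose:
  fixes f :: "'b::euclidean_space \<Rightarrow> 'c::real_normed_vector" and g :: "'a::real_normed_vector \<Rightarrow> 'b"
  assumes "open S" "open T" "g ` S \<subseteq> T" "times_diff_on n T f" "times_diff_on n S g"
  shows "times_diff_on n S (\<lambda>x. f (g x))"
  using assms(4,5)
proof (induction n arbitrary: f)
  case 0
  then show ?case using assms(3) by (auto intro: continuous_on_compose2)
next
  case (Suc n)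
  \<comment> \<open>The direction \<open>dd g x v\<close> moves with x, whereas the induction
    hypothesis speaks of derivatives along fixed vectors; expanding it in the basis separates the
    two.\<close>
  let ?D = "\<lambda>x v. \<Sum>b\<in>Basis. (dd g x v \<bullet> b) *\<^sub>R dd f (g x) b"
  show ?case
  proof (rule times_diff_on_SucI[OF \<open>open S\<close>])
    fix x assume "x \<in> S"
    then have f: "(f has_derivative dd f (g x)) (at (g x))"
      using Suc.prems(1) assms(3) by (auto intro!: has_derivative_frechet)
    have g: "(g has_derivative dd g x) (at x)"
      using Suc.prems \<open>x \<in> S\<close> by (auto intro!: has_derivative_frechet)
    have "dd f (g x) (dd g x v) = ?D x v" for v
      using has_derivative_linear[OF f]
      by (subst euclidean_representation[symmetric, of "dd g x v"])
         (simp add: linear_sum linear_cmul)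
    then show "((\<lambda>x. f (g x)) has_derivative ?D x) (at x)"
      using has_derivative_compose[OF g f] by simp
  next
    fix v
    show "times_diff_on n S (\<lambda>x. ?D x v)"
    proof (intro times_diff_on_sum \<open>open S\<close>
        times_diff_on_bilinear[OF \<open>open S\<close> bounded_bilinear_scaleR])
      fix b :: 'b
      show "times_diff_on n S (\<lambda>x. dd g x v \<bullet> b)"
        using Suc.prems(2)
        by (intro times_diff_on_bilinear[OF \<open>open S\<close> bounded_bilinear_inner] times_diff_on_const) auto
      show "times_diff_on n S (\<lambda>x. dd f (g x) b)"
        using Suc.prems times_diff_on_SucD[OF Suc.prems(2)] by (intro Suc.IH) auto
    qed
  qed
qed

section \<open>Closure properties of smooth maps\<close>

lemma smooth_on_differentiable: "smooth_on S f \<Longrightarrow> x \<in> S \<Longrightarrow> f differentiable (at x)"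
  unfolding smooth_on_def by (metis times_diff_on.simps(2))

lemma smooth_on_has_derivative:
  "smooth_on S f \<Longrightarrow> x \<in> S \<Longrightarrow> (f has_derivative dd f x) (at x)"
  by (intro has_derivative_frechet smooth_on_differentiable)

lemma smooth_on_frechet: "smooth_on S f \<Longrightarrow> smooth_on S (\<lambda>x. dd f x v)"
  unfolding smooth_on_def by (metis times_diff_on.simps(2))

lemma smooth_on_continuous: "smooth_on S f \<Longrightarrow> continuous_on S f"
  unfolding smooth_on_def by (metis times_diff_on.simps(1))

lemma smooth_onI:
  assumes "open S" "\<And>x. x \<in> S \<Longrightarrow> (f has_derivative f' x) (at x)"
    and "\<And>v. smooth_on S (\<lambda>x. f' x v)"
  shows "smooth_on S f"
  unfolding smooth_on_def
proof
  fix n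
  have "times_diff_on (Suc n) S f"
    using assms by (intro times_diff_on_SucI) (auto simp: smooth_on_def)
  then show "times_diff_on n S f" by (rule times_diff_on_SucD)
qed

lemma smooth_on_subset: "smooth_on S f \<Longrightarrow> T \<subseteq> S \<Longrightarrow> smooth_on T f"
  by (auto simp: smooth_on_def intro: times_diff_on_subset)

lemma smooth_on_const: "smooth_on S (\<lambda>x. c)"
  by (simp add: smooth_on_def times_diff_on_const)

lemma smooth_on_bounded_linear: "bounded_linear L \<Longrightarrow> smooth_on S L"
  by (simp add: smooth_on_def times_diff_on_linear)

lemma smooth_on_add:
  "open S \<Longrightarrow> smooth_on S f \<Longrightarrow> smooth_on S g \<Longrightarrow> smooth_on S (\<lambda>x. f x + g x)"
  by (simp add: smooth_on_def times_diff_on_add)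

lemma smooth_on_sum:
  "open S \<Longrightarrow> (\<And>i. i \<in> I \<Longrightarrow> smooth_on S (f i)) \<Longrightarrow> smooth_on S (\<lambda>x. \<Sum>i\<in>I. f i x)"
  by (simp add: smooth_on_def times_diff_on_sum)

lemma smooth_on_bilinear:
  "open S \<Longrightarrow> bounded_bilinear h \<Longrightarrow> smooth_on S f \<Longrightarrow> smooth_on S g \<Longrightarrow>
    smooth_on S (\<lambda>x. h (f x) (g x))"
  by (simp add: smooth_on_def times_diff_on_bilinear)

lemmas smooth_on_mult =
  smooth_on_bilinear[OF _ bounded_bilinear_mult[where ?'a = real]]
lemmas smooth_on_scaleR = smooth_on_bilinear[OF _ bounded_bilinear_scaleR]
lemmas smooth_on_inner = smooth_on_bilinear[OF _ bounded_bilinear_inner]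

lemma smooth_on_compose:
  fixes f :: "'b::euclidean_space \<Rightarrow> 'c::real_normed_vector" and g :: "'a::real_normed_vector \<Rightarrow> 'b"
  assumes "open S" "open T" "g ` S \<subseteq> T" "smooth_on T f" "smooth_on S g"
  shows "smooth_on S (\<lambda>x. f (g x))"
  unfolding smooth_on_def
proof
  fix n
  show "times_diff_on n S (\<lambda>x. f (g x))"
    by (rule times_diff_on_compose[OF assms(1-3)]) (use assms(4,5) in \<open>simp_all add: smooth_on_def\<close>)
qed

text \<open>Applying L is the bilinear operation \<open>c *\<^sub>R L y\<close> at the constant c =
  1. This way the intermediate space needs no basis, in contrast to
  \<open>smooth_on_compose\<close>.\<close>

lemma smooth_on_linear_compose:
  assumes "open S" "bounded_linear L" "smooth_on S f"
  shows "smooth_on S (\<lambda>x. L (f x))"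
proof -
  have "bounded_bilinear (\<lambda>(c::real) y. c *\<^sub>R L y)"
    using bounded_bilinear.comp[OF bounded_bilinear_scaleR bounded_linear_ident assms(2)] .
  from smooth_on_bilinear[OF assms(1) this smooth_on_const assms(3), of 1]
  show ?thesis by simp
qed

lemma smooth_on_minus: "open S \<Longrightarrow> smooth_on S f \<Longrightarrow> smooth_on S (\<lambda>x. - f x)"
  by (rule smooth_on_linear_compose) (auto intro: bounded_linear_minus bounded_linear_ident)

lemma smooth_on_diff:
  "open S \<Longrightarrow> smooth_on S f \<Longrightarrow> smooth_on S g \<Longrightarrow> smooth_on S (\<lambda>x. f x - g x)"
  using smooth_on_add[of S f "\<lambda>x. - g x"] smooth_on_minus[of S g] by simp

lemma smooth_on_Pair:
  assumes "open S" "smooth_on S f" "smooth_on S g"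
  shows "smooth_on S (\<lambda>x. (f x, g x))"
proof -
  have "bounded_linear (\<lambda>y. (y, 0))" "bounded_linear (\<lambda>y. (0, y))"
    by (intro bounded_linear_Pair bounded_linear_ident bounded_linear_zero)+
  then have "smooth_on S (\<lambda>x. (f x, 0) + (0, g x))"
    using assms by (intro smooth_on_add) (auto intro: smooth_on_linear_compose)
  then show ?thesis by simp
qed

lemma smooth_on_fst: "open S \<Longrightarrow> smooth_on S f \<Longrightarrow> smooth_on S (\<lambda>x. fst (f x))"
  by (rule smooth_on_linear_compose[OF _ bounded_linear_fst])

lemma smooth_on_snd: "open S \<Longrightarrow> smooth_on S f \<Longrightarrow> smooth_on S (\<lambda>x. snd (f x))"
  by (rule smooth_on_linear_compose[OF _ bounded_linear_snd])

lemma smooth_on_vec_nth: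
  "open S \<Longrightarrow> smooth_on S f \<Longrightarrow> smooth_on S (\<lambda>x. f x $ i)"
  by (rule smooth_on_linear_compose[OF _ bounded_linear_vec_nth])

lemma smooth_on_id: "smooth_on S (\<lambda>x. x)"
  by (rule smooth_on_bounded_linear[OF bounded_linear_ident])

lemma smooth_on_power:
  fixes f :: "'a::real_normed_vector \<Rightarrow> real"
  assumes "open S" "smooth_on S f"
  shows "smooth_on S (\<lambda>x. f x ^ n)"
  by (induction n) (auto intro: smooth_on_const smooth_on_mult assms)

text \<open>The derivative is a polynomial in the function itself, so the product rule feeds the
  induction. For powers the exponent has to vary in the induction, and sine and cosine have to be
  treated together.\<close>

lemma times_diff_on_inverse:
  "times_diff_on n (- {0::real}) inverse"
proof (induction n)
  case 0
  then show ?case by (auto intro!: continuous_intros)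
next
  case (Suc n)
  have o: "open (- {0::real})" by auto
  show ?case
  proof (rule times_diff_on_SucI[OF o])
    show "(inverse has_derivative (\<lambda>v. (inverse x * inverse x) * (- v))) (at x)"
      if "x \<in> - {0::real}" for x
      using has_derivative_inverse'[of x] that by (simp add: mult_ac)
    show "times_diff_on n (- {0}) (\<lambda>x. (inverse x * inverse x) * (- v))" for v :: real
      by (intro times_diff_on_bilinear[OF o bounded_bilinear_mult] Suc times_diff_on_const)
  qed
qed

lemma times_diff_on_powr: "times_diff_on n {0::real<..} (\<lambda>x. x powr a)"
proof (induction n arbitrary: a)
  case 0
  then show ?case by (auto intro!: continuous_intros)
next
  case (Suc n)
  have o: "open {0::real<..}" by auto
  show ?case
  proof (rule times_diff_on_SucI[OF o])
    show "((\<lambda>x. x powr a) has_derivative (\<lambda>v. x powr (a - 1) * (a * v))) (at x)"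
      if "x \<in> {0<..}" for x
      using that has_real_derivative_powr[of x a]
      
      by (simp add: has_field_derivative_def) (erule has_derivative_eq_rhs, auto simp: fun_eq_iff)
    show "times_diff_on n {0<..} (\<lambda>x. x powr (a - 1) * (a * v))" for v :: real
      by (intro times_diff_on_bilinear[OF o bounded_bilinear_mult] Suc times_diff_on_const)
  qed
qed

lemma times_diff_on_sin_cos: "times_diff_on n (UNIV::real set) sin \<and> times_diff_on n (UNIV::real set) cos"
proof (induction n)
  case 0
  then show ?case by (auto intro!: continuous_intros)
next
  case (Suc n)
  have D: "(sin has_derivative (\<lambda>v. cos x * v)) (at x)" "(cos has_derivative (\<lambda>v. sin x * (- v))) (at x)"
    for x :: real
    using DERIV_sin[of x] DERIV_cos[of x] 
    by (auto simp: has_field_derivative_def fun_eq_iff elim: has_derivative_eq_rhs)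
  have "times_diff_on (Suc n) (UNIV::real set) sin" "times_diff_on (Suc n) (UNIV::real set) cos"
    using Suc
    by (auto intro!: times_diff_on_SucI[OF open_UNIV D(1)] times_diff_on_SucI[OF open_UNIV D(2)]
        times_diff_on_bilinear[OF open_UNIV bounded_bilinear_mult] times_diff_on_const
        simp del: times_diff_on.simps)
  then show ?case ..
qed

lemma smooth_on_inverse:
  assumes "open S" "smooth_on S f" "\<And>x. x \<in> S \<Longrightarrow> f x \<noteq> (0::real)"
  shows "smooth_on S (\<lambda>x. inverse (f x))"
  by (rule smooth_on_compose[of S "- {0}" f inverse]) (use assms in \<open>auto simp: smooth_on_def times_diff_on_inverse\<close>)

lemma smooth_on_divide:
  assumes "open S" "smooth_on S f" "smooth_on S g" "\<And>x. x \<in> S \<Longrightarrow> g x \<noteq> (0::real)"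
  shows "smooth_on S (\<lambda>x. f x / g x)"
  using smooth_on_mult[OF assms(1,2) smooth_on_inverse[OF assms(1,3,4)]]
  by (simp add: divide_inverse)

lemma smooth_on_powr:
  assumes "open S" "smooth_on S f" "\<And>x. x \<in> S \<Longrightarrow> f x > (0::real)"
  shows "smooth_on S (\<lambda>x. f x powr a)"
  by (rule smooth_on_compose[of S "{0<..}" f "\<lambda>x. x powr a"])
     (use assms in \<open>auto simp: smooth_on_def times_diff_on_powr\<close>)

lemma smooth_on_sqrt:
  assumes "open S" "smooth_on S f" "\<And>x. x \<in> S \<Longrightarrow> f x > (0::real)"
  shows "smooth_on S (\<lambda>x. sqrt (f x))"
  using smooth_on_cong[OF assms(1), of "\<lambda>x. sqrt (f x)" "\<lambda>x. f x powr (1/2)"]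
    smooth_on_powr[OF assms, of "1/2"] assms(3) by (simp add: powr_half_sqrt less_imp_le)

lemma smooth_on_sin:
  "open S \<Longrightarrow> smooth_on S f \<Longrightarrow> smooth_on S (\<lambda>x. sin (f x :: real))"
  by (rule smooth_on_compose[of S UNIV f sin]) (auto simp: smooth_on_def times_diff_on_sin_cos)

lemma smooth_on_cos:
  "open S \<Longrightarrow> smooth_on S f \<Longrightarrow> smooth_on S (\<lambda>x. cos (f x :: real))"
  by (rule smooth_on_compose[of S UNIV f cos]) (auto simp: smooth_on_def times_diff_on_sin_cos)

lemma smooth_on_frechet_dir:
  fixes f :: "'a::euclidean_space \<Rightarrow> 'b::real_normed_vector"
  assumes "open S" "smooth_on S f" "smooth_on S X"
  shows "smooth_on S (\<lambda>x. dd f x (X x))"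
proof -
  have "dd f x (X x) = (\<Sum>b\<in>Basis. (X x \<bullet> b) *\<^sub>R dd f x b)"
    if "x \<in> S" for x
    using has_derivative_linear[OF smooth_on_has_derivative[OF assms(2) that]]
    by (subst euclidean_representation[symmetric, of "X x"]) (simp add: linear_sum linear_cmul)
  moreover have "smooth_on S (\<lambda>x. \<Sum>b\<in>Basis. (X x \<bullet> b) *\<^sub>R dd f x b)"
    by (intro smooth_on_sum smooth_on_scaleR smooth_on_inner smooth_on_const smooth_on_frechet assms)
  ultimately show ?thesis
    using smooth_on_cong[OF assms(1)] by (metis (no_types, lifting))
qed

lemmas smooth_intros = smooth_on_const smooth_on_id smooth_on_add smooth_on_minus smooth_on_diff
  smooth_on_mult smooth_on_scaleR smooth_on_Pair smooth_on_fst smooth_on_snd smooth_on_vec_nth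
  smooth_on_power smooth_on_sin smooth_on_cos smooth_on_divide smooth_on_sum

section \<open>Cartan formula for pullbacks\<close>

text \<open>The mean value theorem is applied along a to the increment in b, then along b to the
  derivative in a. The second difference on the left is symmetric in a and b, which later forces the
  two mixed derivatives to agree.\<close>

lemma mixed_difference_mvt:
  fixes f :: "'a::real_normed_vector \<Rightarrow> real"
  assumes "smooth_on S f" "0 < h"
    and S: "\<And>s t. 0 \<le> s \<Longrightarrow> s \<le> h \<Longrightarrow> 0 \<le> t \<Longrightarrow> t \<le> h \<Longrightarrow> x + s *\<^sub>R a + t *\<^sub>R b \<in> S"
  shows "\<exists>s t. 0 < s \<and> s < h \<and> 0 < t \<and> t < h \<and>
     f (x + h *\<^sub>R a + h *\<^sub>R b) - f (x + h *\<^sub>R a) - f (x + h *\<^sub>R b) + f x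
     = h * (h * dd (\<lambda>y. dd f y a) (x + s *\<^sub>R a + t *\<^sub>R b) b)"
proof -
  let ?G = "\<lambda>y. dd f y a"
  have 1: "((\<lambda>s. f (x + s *\<^sub>R a + t *\<^sub>R b)) has_real_derivative ?G (x + s *\<^sub>R a + t *\<^sub>R b)) (at s)"
    if "0 \<le> s" "s \<le> h" "0 \<le> t" "t \<le> h" for s t
  proof -
    have "((\<lambda>s. x + s *\<^sub>R a + t *\<^sub>R b) has_derivative (\<lambda>d. d *\<^sub>R a)) (at s)"
      by (auto intro!: derivative_eq_intros)
    from has_derivative_compose[OF this smooth_on_has_derivative[OF assms(1) S[OF that]]]
    show ?thesis
      unfolding has_field_derivative_def
      using linear_cmul[OF has_derivative_linear[OF smooth_on_has_derivative[OF assms(1) S[OF that]]]]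
      by - (erule has_derivative_eq_rhs, simp add: mult.commute fun_eq_iff)
  qed
  have 2: "((\<lambda>t. ?G (x + s *\<^sub>R a + t *\<^sub>R b)) has_real_derivative
       dd ?G (x + s *\<^sub>R a + t *\<^sub>R b) b) (at t)"
    if "0 \<le> s" "s \<le> h" "0 \<le> t" "t \<le> h" for s t
  proof -
    have D: "(?G has_derivative dd ?G (x + s *\<^sub>R a + t *\<^sub>R b))
      (at (x + s *\<^sub>R a + t *\<^sub>R b))"
      by (rule smooth_on_has_derivative[OF smooth_on_frechet[OF assms(1)] S[OF that]])
    have "((\<lambda>t. x + s *\<^sub>R a + t *\<^sub>R b) has_derivative (\<lambda>d. d *\<^sub>R b)) (at t)"
      by (auto intro!: derivative_eq_intros)
    from has_derivative_compose[OF this D]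
    show ?thesis
      unfolding has_field_derivative_def
      using linear_cmul[OF has_derivative_linear[OF D]]
      by - (erule has_derivative_eq_rhs, simp add: mult.commute fun_eq_iff)
  qed
  let ?\<phi> = "\<lambda>s. f (x + s *\<^sub>R a + h *\<^sub>R b) - f (x + s *\<^sub>R a + 0 *\<^sub>R b)"
  have "\<exists>s>0. s < h \<and> ?\<phi> h - ?\<phi> 0 =
      (h - 0) * (?G (x + s *\<^sub>R a + h *\<^sub>R b) - ?G (x + s *\<^sub>R a + 0 *\<^sub>R b))"
    by (rule MVT2[OF \<open>0 < h\<close>]) (use \<open>0 < h\<close> in \<open>intro DERIV_diff 1; simp\<close>)
  then obtain s where s: "0 < s" "s < h" "?\<phi> h - ?\<phi> 0 =
      h * (?G (x + s *\<^sub>R a + h *\<^sub>R b) - ?G (x + s *\<^sub>R a + 0 *\<^sub>R b))" by auto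
  have "\<exists>t>0. t < h \<and> ?G (x + s *\<^sub>R a + h *\<^sub>R b) - ?G (x + s *\<^sub>R a + 0 *\<^sub>R b) =
      (h - 0) * dd ?G (x + s *\<^sub>R a + t *\<^sub>R b) b"
    by (rule MVT2[OF \<open>0 < h\<close>]) (use s in \<open>intro 2; simp\<close>)
  then obtain t where t: "0 < t" "t < h"
    "?G (x + s *\<^sub>R a + h *\<^sub>R b) - ?G (x + s *\<^sub>R a + 0 *\<^sub>R b) =
      h * dd ?G (x + s *\<^sub>R a + t *\<^sub>R b) b" by auto
  have "f (x + h *\<^sub>R a + h *\<^sub>R b) - f (x + h *\<^sub>R a) - f (x + h *\<^sub>R b) + f x = ?\<phi> h - ?\<phi> 0"
    by simp
  also have "\<dots> = h * (h * dd ?G (x + s *\<^sub>R a + t *\<^sub>R b) b)"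
    unfolding s(3) t(3) ..
  finally show ?thesis using s(1,2) t(1,2) by blast
qed

lemma symmetric_second_derivative_real:
  fixes f :: "'a::real_normed_vector \<Rightarrow> real"
  assumes "open S" "x \<in> S" "smooth_on S f"
  shows "dd (\<lambda>y. dd f y a) x b =
         dd (\<lambda>y. dd f y b) x a"
proof (rule ccontr)
  let ?P = "\<lambda>z. dd (\<lambda>y. dd f y a) z b"
  let ?Q = "\<lambda>z. dd (\<lambda>y. dd f y b) z a"
  assume ne: "?P x \<noteq> ?Q x"
  define e where "e = \<bar>?P x - ?Q x\<bar> / 2"
  have "e > 0" using ne by (simp add: e_def)
  have "isCont ?P x" "isCont ?Q x"
    using smooth_on_continuous[OF smooth_on_frechet[OF smooth_on_frechet[OF assms(3)]]] assms(1,2)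
    by (auto simp: continuous_on_eq_continuous_at)
  then have "\<forall>e>0. \<exists>d>0. \<forall>z. dist z x < d \<longrightarrow> dist (?P z) (?P x) < e"
      "\<forall>e>0. \<exists>d>0. \<forall>z. dist z x < d \<longrightarrow> dist (?Q z) (?Q x) < e"
    unfolding continuous_at_eps_delta by (simp_all only: dist_norm)
  note ex = this[rule_format, OF \<open>e > 0\<close>]
  obtain d1 where "0 < d1" "\<forall>z. dist z x < d1 \<longrightarrow> dist (?P z) (?P x) < e" using ex(1) by (rule exE) (erule conjE)
  moreover obtain d2 where "0 < d2" "\<forall>z. dist z x < d2 \<longrightarrow> dist (?Q z) (?Q x) < e" using ex(2) by (rule exE) (erule conjE)
  ultimately have d: "0 < d1" "\<And>z. dist z x < d1 \<Longrightarrow> dist (?P z) (?P x) < e"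
      "0 < d2" "\<And>z. dist z x < d2 \<Longrightarrow> dist (?Q z) (?Q x) < e"
    by simp_all
  obtain d3 where d3: "0 < d3" "ball x d3 \<subseteq> S"
    using assms(1,2) openE by blast
  \<comment> \<open>With this h the parallelogram spanned by h a and h b stays inside both
    continuity radii and inside S; the summand 1 covers the case a = b = 0.\<close>
  define h where "h = min d1 (min d2 d3) / (2 * (norm a + norm b + 1))"
  have "0 < h" using d d3 by (auto simp: h_def intro!: divide_pos_pos add_nonneg_pos)
  have small: "dist (x + s *\<^sub>R u + t *\<^sub>R v) x < min d1 (min d2 d3)"
    if "0 \<le> s" "s \<le> h" "0 \<le> t" "t \<le> h" "{u, v} = {a, b}" for s t u v
  proof -
    have "dist (x + s *\<^sub>R u + t *\<^sub>R v) x \<le> norm (s *\<^sub>R u) + norm (t *\<^sub>R v)"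
      by (simp add: dist_norm) (metis norm_scaleR norm_triangle_ineq)
    also have "\<dots> \<le> h * norm u + h * norm v"
      using that by (auto intro!: add_mono mult_right_mono)
    also have "\<dots> \<le> h * (2 * (norm a + norm b))"
      using \<open>0 < h\<close> that(5) by (auto simp: doubleton_eq_iff algebra_simps)
    also have "\<dots> < h * (2 * (norm a + norm b + 1))" using \<open>0 < h\<close> by simp
    also have "\<dots> = min d1 (min d2 d3)"
      using norm_ge_zero[of a] norm_ge_zero[of b] unfolding h_def
      by (smt (verit) nonzero_eq_divide_eq)
    finally show ?thesis .
  qed
  have inS: "x + s *\<^sub>R u + t *\<^sub>R v \<in> S"
    if "0 \<le> s" "s \<le> h" "0 \<le> t" "t \<le> h" "{u, v} = {a, b}" for s t u v
    using small[OF that] d3(2) by (auto simp: dist_commute)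
  obtain s t where st: "0 < s" "s < h" "0 < t" "t < h"
     "f (x + h *\<^sub>R a + h *\<^sub>R b) - f (x + h *\<^sub>R a) - f (x + h *\<^sub>R b) + f x = h * (h * ?P (x + s *\<^sub>R a + t *\<^sub>R b))"
    using mixed_difference_mvt[OF assms(3) \<open>0 < h\<close> inS, of a b] by auto
  obtain s' t' where st': "0 < s'" "s' < h" "0 < t'" "t' < h"
     "f (x + h *\<^sub>R b + h *\<^sub>R a) - f (x + h *\<^sub>R b) - f (x + h *\<^sub>R a) + f x = h * (h * ?Q (x + s' *\<^sub>R b + t' *\<^sub>R a))"
    using mixed_difference_mvt[OF assms(3) \<open>0 < h\<close> inS, of b a] by auto
  have swap: "x + h *\<^sub>R b + h *\<^sub>R a = x + h *\<^sub>R a + h *\<^sub>R b" by simp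
  have "h * (h * ?P (x + s *\<^sub>R a + t *\<^sub>R b)) = h * (h * ?Q (x + s' *\<^sub>R b + t' *\<^sub>R a))"
    using st(5) st'(5)[unfolded swap] by linarith
  then have eq: "?P (x + s *\<^sub>R a + t *\<^sub>R b) = ?Q (x + s' *\<^sub>R b + t' *\<^sub>R a)"
    using \<open>0 < h\<close> by simp
  have "dist (?P (x + s *\<^sub>R a + t *\<^sub>R b)) (?P x) < e" "dist (?Q (x + s' *\<^sub>R b + t' *\<^sub>R a)) (?Q x) < e"
    using small[of s t a b] small[of s' t' b a] st st' by (auto intro!: d)
  then show False using eq e_def unfolding dist_real_def by argo
qed

lemma frechet_linear_compose:
  assumes "bounded_linear L" "f differentiable (at x)"
  shows "dd (\<lambda>y. L (f y)) x v = L (dd f x v)"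
  using frechet_eq[OF bounded_linear.has_derivative[OF assms(1) has_derivative_frechet[OF assms(2)]]]
  by simp

lemma symmetric_second_derivative:
  fixes f :: "'a::real_normed_vector \<Rightarrow> 'b::euclidean_space"
  assumes "open S" "x \<in> S" "smooth_on S f"
  shows "dd (\<lambda>y. dd f y a) x b =
         dd (\<lambda>y. dd f y b) x a"
proof (rule euclidean_eqI)
  fix e :: 'b
  have L: "bounded_linear (\<lambda>y. y \<bullet> e)" by (rule bounded_linear_inner_left)
  have D: "dd (\<lambda>y. dd f y u) x v \<bullet> e =
        dd (\<lambda>y. dd (\<lambda>y. f y \<bullet> e) y u) x v" for u v
  proof -
    have "dd (\<lambda>y. dd (\<lambda>y. f y \<bullet> e) y u) x =
      dd (\<lambda>y. dd f y u \<bullet> e) x"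
      by (rule dd_cong_open[OF assms(1,2)])
         (simp add: frechet_linear_compose[OF L smooth_on_differentiable[OF assms(3)]])
    then show ?thesis
      using frechet_linear_compose[OF L smooth_on_differentiable[OF smooth_on_frechet[OF assms(3)] assms(2)]]
      by simp
  qed
  show "dd (\<lambda>y. dd f y a) x b \<bullet> e =
         dd (\<lambda>y. dd f y b) x a \<bullet> e"
    unfolding D
    by (rule symmetric_second_derivative_real[OF assms(1,2)])
       (rule smooth_on_linear_compose[OF assms(1) L assms(3)])
qed

text \<open>Product rule for evaluating a moving linear map at a moving vector. Only the evaluations
  at fixed vectors are known to be differentiable, and a finite basis reduces the claim to
  them.\<close>

lemma has_derivative_linear_apply:
  fixes L :: "'p::real_normed_vector \<Rightarrow> 'a::euclidean_space \<Rightarrow> 'b::real_normed_vector"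
  assumes "open U" "x \<in> U" and lin: "\<And>y. y \<in> U \<Longrightarrow> linear (L y)"
    and L: "\<And>e. (\<lambda>y. L y e) differentiable (at x)"
    and w: "(w has_derivative w') (at x)"
  shows "((\<lambda>y. L y (w y)) has_derivative
     (\<lambda>v. dd (\<lambda>y. L y (w x)) x v + L x (w' v))) (at x)"
proof -
  have exp: "L y u = (\<Sum>e\<in>Basis. (u \<bullet> e) *\<^sub>R L y e)" if "y \<in> U" for y u
    using lin[OF that]
    by (subst euclidean_representation[symmetric, of u]) (simp add: linear_sum linear_cmul)
  have D: "((\<lambda>y. L y e) has_derivative dd (\<lambda>y. L y e) x) (at x)" for e
    by (rule has_derivative_frechet[OF L])
  have "((\<lambda>y. \<Sum>e\<in>Basis. (w x \<bullet> e) *\<^sub>R L y e) has_derivative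
     (\<lambda>v. \<Sum>e\<in>Basis. (w x \<bullet> e) *\<^sub>R dd (\<lambda>y. L y e) x v)) (at x)"
    by (auto intro!: derivative_eq_intros D)
  then have "((\<lambda>y. L y (w x)) has_derivative
     (\<lambda>v. \<Sum>e\<in>Basis. (w x \<bullet> e) *\<^sub>R dd (\<lambda>y. L y e) x v)) (at x)"
    using derivative_cong[OF assms(1,2) exp[where u = "w x"]] by simp
  then have 1: "dd (\<lambda>y. L y (w x)) x =
     (\<lambda>v. \<Sum>e\<in>Basis. (w x \<bullet> e) *\<^sub>R dd (\<lambda>y. L y e) x v)"
    by (rule frechet_eq)
  have "((\<lambda>y. \<Sum>e\<in>Basis. (w y \<bullet> e) *\<^sub>R L y e) has_derivative
     (\<lambda>v. \<Sum>e\<in>Basis. (w x \<bullet> e) *\<^sub>R dd (\<lambda>y. L y e) x v + (w' v \<bullet> e) *\<^sub>R L x e)) (at x)"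
    by (auto intro!: derivative_eq_intros D w)
  then have "((\<lambda>y. L y (w y)) has_derivative
     (\<lambda>v. \<Sum>e\<in>Basis. (w x \<bullet> e) *\<^sub>R dd (\<lambda>y. L y e) x v + (w' v \<bullet> e) *\<^sub>R L x e)) (at x)"
    using derivative_cong[OF assms(1,2) exp[where u = "w _"]] by simp
  then show ?thesis
    unfolding 1 exp[OF assms(2), of "w' _"] by (simp add: sum.distrib)
qed

text \<open>Cartan's formula \<open>d\<alpha>(X, Y) = X(\<alpha>(Y)) - Y(\<alpha>(X)) - \<alpha>([X, Y])\<close> for the pullback of
  \<open>\<alpha>\<close> along \<open>\<sigma>\<close>.\<close>

lemma ext_d_pullback:
  fixes \<alpha> :: "('a::euclidean_space, real) form1" and \<sigma> :: "'u::euclidean_space \<Rightarrow> 'a"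
  assumes "open U" "x \<in> U" and \<sigma>: "smooth_on U \<sigma>" "\<sigma> ` U \<subseteq> \<Omega>" and "open \<Omega>"
    and \<alpha>: "smooth_form_on \<Omega> \<alpha>"
    and a: "(a has_derivative a') (at x)" and b: "(b has_derivative b') (at x)"
  defines "d\<sigma> \<equiv> \<lambda>y. dd \<sigma> y"
  shows "ext_d \<alpha> (\<sigma> x) (d\<sigma> x (a x)) (d\<sigma> x (b x)) =
      dd (\<lambda>y. \<alpha> (\<sigma> y) (d\<sigma> y (b y))) x (a x)
      - dd (\<lambda>y. \<alpha> (\<sigma> y) (d\<sigma> y (a y))) x (b x)
      - \<alpha> (\<sigma> x) (d\<sigma> x (b' (a x) - a' (b x)))" (is ?t1)
    and "(\<lambda>y. \<alpha> (\<sigma> y) (d\<sigma> y (b y))) differentiable (at x)" (is ?t2)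
proof -
  have \<sigma>D: "(\<sigma> has_derivative d\<sigma> y) (at y)" if "y \<in> U" for y
    unfolding d\<sigma>_def by (rule smooth_on_has_derivative[OF \<sigma>(1) that])
  have d2: "(\<lambda>y. d\<sigma> y e) differentiable (at x)" for e
    unfolding d\<sigma>_def by (rule smooth_on_differentiable[OF smooth_on_frechet[OF \<sigma>(1)] assms(2)])
  have lin: "linear (\<alpha> (\<sigma> y))" if "y \<in> U" for y
    using that \<sigma>(2) \<alpha> by (auto simp: smooth_form_on_def)
  have \<alpha>D: "(\<lambda>z. \<alpha> z e) differentiable (at (\<sigma> x))" for e
    using \<alpha> \<sigma>(2) assms(2) by (auto simp: smooth_form_on_def intro!: smooth_on_differentiable)
  have chain: "((\<lambda>y. \<alpha> (\<sigma> y) e) has_derivative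
      (\<lambda>v. dd (\<lambda>z. \<alpha> z e) (\<sigma> x) (d\<sigma> x v))) (at x)" for e
    by (rule has_derivative_compose[OF \<sigma>D[OF assms(2)] has_derivative_frechet[OF \<alpha>D]])
  have key: "((\<lambda>y. \<alpha> (\<sigma> y) (d\<sigma> y (c y))) has_derivative
     (\<lambda>v. dd (\<lambda>z. \<alpha> z (d\<sigma> x (c x))) (\<sigma> x) (d\<sigma> x v) +
        \<alpha> (\<sigma> x) (dd (\<lambda>y. d\<sigma> y (c x)) x v + d\<sigma> x (c' v)))) (at x)"
    if c: "(c has_derivative c') (at x)" for c c'
  proof -
    have w: "((\<lambda>y. d\<sigma> y (c y)) has_derivative
       (\<lambda>v. dd (\<lambda>y. d\<sigma> y (c x)) x v + d\<sigma> x (c' v))) (at x)"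
      by (rule has_derivative_linear_apply[OF assms(1,2) _ d2 c])
         (rule has_derivative_linear[OF \<sigma>D])
    have "(\<lambda>y. \<alpha> (\<sigma> y) e) differentiable (at x)" for e
      using chain by (auto simp: differentiable_def)
    from has_derivative_linear_apply[OF assms(1,2) lin this w]
    show ?thesis unfolding frechet_eq[OF chain] by simp
  qed
  \<comment> \<open>The second derivatives of \<sigma> enter both terms of the antisymmetrised
    expression and cancel because they are symmetric.\<close>
  have sym: "dd (\<lambda>y. d\<sigma> y u) x v = dd (\<lambda>y. d\<sigma> y v) x u" for u v
    unfolding d\<sigma>_def by (rule symmetric_second_derivative[OF assms(1,2) \<sigma>(1)])
  note l1 = has_derivative_linear[OF \<sigma>D[OF assms(2)]]
  show ?t1
    unfolding ext_d_def frechet_eq[OF key[OF a]] frechet_eq[OF key[OF b]]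
    by (simp add: linear_add[OF lin[OF assms(2)]] linear_diff[OF lin[OF assms(2)]] linear_diff[OF l1]
          sym[of "a x" "b x"])
  show ?t2
    using key[OF b] by (auto simp: differentiable_def)
qed

section \<open>Moving frames\<close>

lemma smooth_on_metric:
  assumes "open S" "p ` S \<subseteq> D" "open D" and g: "lorentzian_metric_on D g"
    and "smooth_on S p" "smooth_on S X" "smooth_on S Y"
  shows "smooth_on S (\<lambda>x. g (p x) (X x) (Y x))"
proof -
  have "g (p x) (X x) (Y x) = (\<Sum>i\<in>Basis. \<Sum>j\<in>Basis. (X x \<bullet> i) * (Y x \<bullet> j) * g (p x) i j)"
    if "x \<in> S" for x
  proof -
    have b: "bilinear (g (p x))" using g assms(2) that by (auto simp: lorentzian_metric_on_def)
    have "g (p x) (X x) (Y x) = g (p x) (\<Sum>i\<in>Basis. (X x \<bullet> i) *\<^sub>R i) (\<Sum>j\<in>Basis. (Y x \<bullet> j) *\<^sub>R j)"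
      by (simp add: euclidean_representation)
    also have "\<dots> = (\<Sum>i\<in>Basis. \<Sum>j\<in>Basis. (X x \<bullet> i) * (Y x \<bullet> j) * g (p x) i j)"
      by (simp add: bilinear_sum[OF b] bilinear_lmul[OF b] bilinear_rmul[OF b] sum.cartesian_product
          split_def mult_ac)
    finally show ?thesis .
  qed
  moreover have "smooth_on S (\<lambda>x. \<Sum>i\<in>Basis. \<Sum>j\<in>Basis. (X x \<bullet> i) * (Y x \<bullet> j) * g (p x) i j)"
  proof (intro smooth_on_sum smooth_on_mult smooth_on_inner smooth_on_const assms)
    fix i j
    show "smooth_on S (\<lambda>x. g (p x) i j)"
      by (rule smooth_on_compose[OF assms(1,3,2) _ assms(5)]) (use g in \<open>simp add: lorentzian_metric_on_def\<close>)
  qed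
  ultimately show ?thesis
    using smooth_on_cong[OF assms(1)] by (metis (no_types, lifting))
qed

lemma eta_simps:
  "eta1 g z v = g (fst z) (fst v) (fst (snd z))"
  "eta2 g z v = - g (fst z) (fst v) (snd (snd z))"
  by (cases z; cases v; auto)+

lemma smooth_eta:
  assumes "open D" "lorentzian_metric_on D g"
  shows "smooth_form_on (D \<times> UNIV) (eta1 g)" "smooth_form_on (D \<times> UNIV) (eta2 g)"
proof -
  have o: "open (D \<times> (UNIV :: ((real^2) \<times> (real^2)) set))"
    using assms(1) by (simp add: open_Times)
  have l: "linear (\<lambda>v. g x (fst v) a)" if "x \<in> D" for x a and v :: frame2
  proof -
    have "bilinear (g x)" using assms(2) that by (auto simp: lorentzian_metric_on_def)
    then have "linear (\<lambda>v. g x v a)" by (simp add: bilinear_def)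
    from linear_compose[OF linear_fst this] show ?thesis by (simp add: o_def)
  qed
  have s: "smooth_on (D \<times> UNIV) (\<lambda>z::frame2. g (fst z) v (a z))"
    if "smooth_on (D \<times> UNIV) a" for a and v :: "real^2"
    by (rule smooth_on_metric[OF o _ assms]) (auto intro!: smooth_intros o that)
  show "smooth_form_on (D \<times> UNIV) (eta1 g)" "smooth_form_on (D \<times> UNIV) (eta2 g)"
    using l linear_compose_neg[OF l]
    by (auto simp: smooth_form_on_def eta_simps eta_simps[abs_def] intro!: s smooth_on_minus smooth_on_fst smooth_on_snd
        smooth_on_id o)
qed

text \<open>\<open>tangent_space\<close> asks for curves that lie in N at all times. A curve that
  does so only near 0 is replaced by the constant z elsewhere, which does not change its velocity at
  0.\<close>

lemma tangent_spaceI: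
  fixes \<gamma> :: "real \<Rightarrow> 'a::real_normed_vector"
  assumes "(\<gamma> has_vector_derivative v) (at 0)" "\<gamma> 0 = z" "z \<in> N"
    and "open T" "0 \<in> T" "\<And>t. t \<in> T \<Longrightarrow> \<gamma> t \<in> N"
  shows "v \<in> tangent_space N z"
  unfolding tangent_space_def mem_Collect_eq
proof (intro exI conjI allI)
  let ?\<gamma> = "\<lambda>t. if t \<in> T then \<gamma> t else z"
  show "?\<gamma> 0 = z" using assms by simp
  show "?\<gamma> t \<in> N" for t using assms by simp
  show "(?\<gamma> has_vector_derivative v) (at 0)"
    by (rule has_vector_derivative_transform_within_open[OF assms(1,4,5)]) simp
qed

lemma has_vector_derivative_compose:
  assumes "(\<gamma> has_vector_derivative v) (at t)" "(f has_derivative f') (at (\<gamma> t))"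
  shows "((\<lambda>t. f (\<gamma> t)) has_vector_derivative f' v) (at t)"
proof -
  have "((\<lambda>t. f (\<gamma> t)) has_derivative (\<lambda>d. f' (d *\<^sub>R v))) (at t)"
    using has_derivative_compose[OF assms(1)[unfolded has_vector_derivative_def] assms(2)] .
  then show ?thesis
    by (simp add: has_vector_derivative_def linear_cmul[OF has_derivative_linear[OF assms(2)]])
qed

lemma ext_d_linear_right:
  fixes \<alpha> :: "('a::real_normed_vector, real) form1"
  assumes "open S" "x \<in> S" "smooth_form_on S \<alpha>"
  shows "ext_d \<alpha> x v (a *\<^sub>R u + b *\<^sub>R w) = a * ext_d \<alpha> x v u + b * ext_d \<alpha> x v w"
proof -
  have D: "((\<lambda>y. \<alpha> y e) has_derivative dd (\<lambda>y. \<alpha> y e) x) (at x)" for e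
    using assms by (auto simp: smooth_form_on_def intro!: smooth_on_has_derivative)
  have "dd (\<lambda>y. \<alpha> y (a *\<^sub>R u + b *\<^sub>R w)) x =
    dd (\<lambda>y. a * \<alpha> y u + b * \<alpha> y w) x"
    by (rule dd_cong_open[OF assms(1,2)])
       (use assms(3) in \<open>simp add: smooth_form_on_def linear_add linear_cmul\<close>)
  also have "\<dots> = (\<lambda>v. a * dd (\<lambda>y. \<alpha> y u) x v + b * dd (\<lambda>y. \<alpha> y w) x v)"
    by (rule frechet_eq) (auto intro!: derivative_eq_intros D)
  finally show ?thesis
    using linear_add[OF has_derivative_linear[OF D]] linear_cmul[OF has_derivative_linear[OF D]]
    by (simp add: ext_d_def algebra_simps)
qed

lemma ext_d_antisym: "ext_d \<alpha> x v w = - ext_d \<alpha> x w v"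
  by (simp add: ext_d_def)

section \<open>Structure functions of an orthonormal framing\<close>

locale framed_surface =
  fixes D S :: "(real^2) set" and g :: metric and \<kappa> :: "(frame2, real) form1"
    and K :: "real^2 \<Rightarrow> real" and E1 E2 :: "real^2 \<Rightarrow> real^2"
  assumes open_D: "open D" and lor: "lorentzian_metric_on D g"
    and str: "structure_equations D g \<kappa> K" and neg: "\<And>x. x \<in> D \<Longrightarrow> K x < 0"
    and open_S: "open S" and S_D: "S \<subseteq> D" and fr: "orthonormal_framing_on S g E1 E2"
begin

text \<open>The framing is read as a section of the frame bundle. Pulling the connection form back
  along it gives \<open>lam\<close>, with frame components \<open>l1\<close> and \<open>l2\<close>,
  so that the fibre variable of the surface disappears.\<close>

definition sg :: "real^2 \<Rightarrow> frame2" where "sg x = (x, E1 x, E2 x)"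
definition lam :: "real^2 \<Rightarrow> real^2 \<Rightarrow> real" where "lam x v = \<kappa> (sg x) (dd sg x v)"
definition l1 :: "real^2 \<Rightarrow> real" where "l1 x = lam x (E1 x)"
definition l2 :: "real^2 \<Rightarrow> real" where "l2 x = lam x (E2 x)"

lemma smooth_E: "smooth_on S E1" "smooth_on S E2"
  using fr by (auto simp: orthonormal_framing_on_def)

lemma bil: "x \<in> S \<Longrightarrow> bilinear (g x)" and g_sym: "x \<in> S \<Longrightarrow> g x v w = g x w v"
  using lor S_D by (auto simp: lorentzian_metric_on_def)

lemma g_E: "x \<in> S \<Longrightarrow> g x (E1 x) (E1 x) = 1" "x \<in> S \<Longrightarrow> g x (E2 x) (E2 x) = -1"
    "x \<in> S \<Longrightarrow> g x (E1 x) (E2 x) = 0" "x \<in> S \<Longrightarrow> g x (E2 x) (E1 x) = 0"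
  using fr g_sym by (auto simp: orthonormal_framing_on_def orthonormal2_def)

text \<open>The Gram matrix of the frame is invertible, so the two vectors are independent and span
  the plane; the minus sign comes from <e_2, e_2> = -1.\<close>

lemma expand: assumes "x \<in> S"
  shows "v = g x v (E1 x) *\<^sub>R E1 x - g x v (E2 x) *\<^sub>R E2 x"
proof -
  note b = bil[OF assms]
  note [simp] = bilinear_ladd[OF b] bilinear_lsub[OF b] bilinear_lmul[OF b] g_E[OF assms]
  define dt where "dt = E1 x $ 1 * E2 x $ 2 - E1 x $ 2 * E2 x $ 1"
  have zero: "s = 0 \<and> t = 0" if "s *\<^sub>R E1 x + t *\<^sub>R E2 x = 0" for s t
  proof -
    have "g x (s *\<^sub>R E1 x + t *\<^sub>R E2 x) (E1 x) = g x 0 (E1 x)"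
      "g x (s *\<^sub>R E1 x + t *\<^sub>R E2 x) (E2 x) = g x 0 (E2 x)"
      by (simp_all only: that)
    then show ?thesis using bilinear_lzero[OF b] by simp
  qed
  have "dt \<noteq> 0"
  proof
    assume "dt = 0"
    then have "E2 x $ 2 *\<^sub>R E1 x + (- (E1 x $ 2)) *\<^sub>R E2 x = 0"
       "E2 x $ 1 *\<^sub>R E1 x + (- (E1 x $ 1)) *\<^sub>R E2 x = 0"
      by (auto simp: vec_eq_iff forall_2 dt_def mult.commute)
    from zero[OF this(1)] zero[OF this(2)] have "E1 x = 0"
      by (auto simp: vec_eq_iff forall_2)
    then show False using g_E(1)[OF assms] bilinear_lzero[OF b] by simp
  qed
  define s t where "s = (v $ 1 * E2 x $ 2 - v $ 2 * E2 x $ 1) / dt"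
    and "t = (E1 x $ 1 * v $ 2 - E1 x $ 2 * v $ 1) / dt"
  have v: "v = s *\<^sub>R E1 x + t *\<^sub>R E2 x"
    using \<open>dt \<noteq> 0\<close> unfolding vec_eq_iff forall_2 s_def t_def
    by (simp add: field_simps) (simp add: dt_def algebra_simps)
  have "g x v (E1 x) = s" "g x v (E2 x) = - t" unfolding v by simp_all
  then show ?thesis using v by simp
qed

lemma smooth_sg: "smooth_on S sg"
  unfolding sg_def[abs_def] by (intro smooth_intros smooth_E open_S)

lemma dd_sg: "x \<in> S \<Longrightarrow> dd sg x v = (v, dd E1 x v, dd E2 x v)"
  unfolding sg_def[abs_def]
  using frechet_eq[OF has_derivative_Pair[OF has_derivative_ident has_derivative_Pair[OF
    smooth_on_has_derivative[OF smooth_E(1)] smooth_on_has_derivative[OF smooth_E(2)]]], of x]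
  by simp

lemma sg_frame: "x \<in> S \<Longrightarrow> sg x \<in> frame_bundle D g"
  using fr S_D by (auto simp: sg_def frame_bundle_def orthonormal_framing_on_def)

lemma sg_tangent:
  assumes "x \<in> S" shows "dd sg x v \<in> tangent_space (frame_bundle D g) (sg x)"
proof (rule tangent_spaceI)
  have "((\<lambda>t. x + t *\<^sub>R v) has_vector_derivative v) (at 0)"
    by (auto intro!: derivative_eq_intros)
  from has_vector_derivative_compose[OF this, of sg "dd sg x"]
  show "((\<lambda>t. sg (x + t *\<^sub>R v)) has_vector_derivative dd sg x v) (at 0)"
    using smooth_on_has_derivative[OF smooth_sg assms] by simp
  show "open ((\<lambda>t. x + t *\<^sub>R v) -` S)"
    by (intro open_vimage open_S continuous_intros)
qed (use assms sg_frame in auto)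

lemma smooth_\<kappa>: "smooth_form_on (D \<times> UNIV) \<kappa>"
  using str by (simp add: structure_equations_def)

lemma lam_linear: "x \<in> S \<Longrightarrow> lam x (a *\<^sub>R u + b *\<^sub>R v) = a * lam x u + b * lam x v"
proof -
  assume "x \<in> S"
  then have "linear (\<kappa> (sg x))" using smooth_\<kappa> S_D by (auto simp: smooth_form_on_def sg_def)
  with linear_compose[OF has_derivative_linear[OF smooth_on_has_derivative[OF smooth_sg \<open>x \<in> S\<close>]]]
  have "linear (lam x)" by (simp add: lam_def[abs_def] o_def)
  then show ?thesis by (simp add: linear_add linear_cmul)
qed

lemma smooth_lam: assumes "smooth_on S X" shows "smooth_on S (\<lambda>x. lam x (X x))"
proof -
  have oD: "open (D \<times> (UNIV :: ((real^2) \<times> (real^2)) set))" using open_D by (simp add: open_Times)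
  have sub: "sg ` S \<subseteq> D \<times> UNIV" using S_D by (auto simp: sg_def)
  have "lam x (X x) = (\<Sum>b\<in>Basis. (dd sg x (X x) \<bullet> b) * \<kappa> (sg x) b)" if "x \<in> S" for x
  proof -
    have "linear (\<kappa> (sg x))" using smooth_\<kappa> S_D that by (auto simp: smooth_form_on_def sg_def)
    then show ?thesis unfolding lam_def
      by (subst euclidean_representation[symmetric, of "dd sg x (X x)"])
         (simp only: linear_sum linear_cmul real_scaleR_def)
  qed
  moreover have "smooth_on S (\<lambda>x. \<Sum>b\<in>Basis. (dd sg x (X x) \<bullet> b) * \<kappa> (sg x) b)"
  proof (intro smooth_on_sum smooth_on_mult smooth_on_inner smooth_on_const open_S
      smooth_on_frechet_dir smooth_sg assms)
    fix b show "smooth_on S (\<lambda>x. \<kappa> (sg x) b)"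
      by (rule smooth_on_compose[OF open_S oD sub _ smooth_sg])
         (use smooth_\<kappa> in \<open>unfold smooth_form_on_def, blast\<close>)
  qed
  ultimately show ?thesis
    using smooth_on_cong[OF open_S] by (metis (no_types, lifting))
qed

lemma smooth_l: "smooth_on S l1" "smooth_on S l2"
  using smooth_lam smooth_E by (simp_all add: l1_def[abs_def] l2_def[abs_def])

lemma E_diff: "x \<in> S \<Longrightarrow> (E1 has_derivative dd E1 x) (at x)" "x \<in> S \<Longrightarrow> (E2 has_derivative dd E2 x) (at x)"
  using smooth_on_has_derivative smooth_E by blast+

lemma dd_const: assumes "x \<in> S" "\<And>y. y \<in> S \<Longrightarrow> f y = c" shows "dd f x v = 0"
  using dd_cong_open[OF open_S assms(1), of f "\<lambda>_. c"] assms(2) by simp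

lemma pull:
  fixes \<alpha> :: "(frame2, real) form1"
  assumes "x \<in> S" "smooth_form_on (D \<times> UNIV) \<alpha>"
  shows "ext_d \<alpha> (sg x) (dd sg x (E1 x)) (dd sg x (E2 x)) =
      dd (\<lambda>y. \<alpha> (sg y) (dd sg y (E2 y))) x (E1 x) - dd (\<lambda>y. \<alpha> (sg y) (dd sg y (E1 y))) x (E2 x)
      - \<alpha> (sg x) (dd sg x (dd E2 x (E1 x) - dd E1 x (E2 x)))"
proof -
  have oD: "open (D \<times> (UNIV :: ((real^2) \<times> (real^2)) set))" using open_D by (simp add: open_Times)
  have sub: "sg ` S \<subseteq> D \<times> UNIV" using S_D by (auto simp: sg_def)
  show ?thesis
    by (rule ext_d_pullback(1)[OF open_S assms(1) smooth_sg sub oD assms(2) E_diff[OF assms(1)]])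
qed

lemma structure_at:
  assumes "x \<in> S"
  shows "ext_d (eta1 g) (sg x) (dd sg x (E1 x)) (dd sg x (E2 x)) = - l1 x" (is ?t1)
    "ext_d (eta2 g) (sg x) (dd sg x (E1 x)) (dd sg x (E2 x)) = l2 x" (is ?t2)
    "ext_d \<kappa> (sg x) (dd sg x (E1 x)) (dd sg x (E2 x)) = - K x" (is ?t3)
proof -
  have e: "eta1 g (sg x) (dd sg x (E1 x)) = 1" "eta1 g (sg x) (dd sg x (E2 x)) = 0"
     "eta2 g (sg x) (dd sg x (E1 x)) = 0" "eta2 g (sg x) (dd sg x (E2 x)) = 1"
    using g_E[OF assms] by (auto simp: eta_simps dd_sg[OF assms] sg_def)
  have "\<forall>v\<in>tangent_space (frame_bundle D g) (sg x). \<forall>w\<in>tangent_space (frame_bundle D g) (sg x).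
          ext_d (eta1 g) (sg x) v w = - wedge (\<kappa> (sg x)) (eta2 g (sg x)) v w \<and>
          ext_d (eta2 g) (sg x) v w = - wedge (\<kappa> (sg x)) (eta1 g (sg x)) v w \<and>
          ext_d \<kappa> (sg x) v w = - K (fst (sg x)) * wedge (eta1 g (sg x)) (eta2 g (sg x)) v w"
    using str sg_frame[OF assms] by (auto simp only: structure_equations_def)
  from this[rule_format, OF sg_tangent[OF assms] sg_tangent[OF assms], of "E1 x" "E2 x"]
  show ?t1
    ?t2
    ?t3
    by (simp_all add: wedge_def e l1_def l2_def lam_def) (simp add: sg_def)
qed

text \<open>The pulled back coframe is dual to the framing, so the derivative terms in Cartan's
  formula vanish and d eta^i(E1, E2) = -eta^i([E1, E2]); the left sides are known from the structure
  equations.\<close>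

lemma bracket: assumes "x \<in> S"
  shows "dd E2 x (E1 x) - dd E1 x (E2 x) = l1 x *\<^sub>R E1 x - l2 x *\<^sub>R E2 x"
proof -
  have 0: "dd (\<lambda>y. \<alpha> (sg y) (dd sg y (E y))) x v = 0"
    if "(\<alpha>, E) \<in> {(eta1 g, E1), (eta1 g, E2), (eta2 g, E1), (eta2 g, E2)}" for \<alpha> E v
  proof (rule dd_const[OF assms])
    show "\<alpha> (sg y) (dd sg y (E y)) = \<alpha> (sg x) (dd sg x (E x))" if "y \<in> S" for y
      using \<open>(\<alpha>, E) \<in> _\<close> g_E that assms by (auto simp: eta_simps dd_sg sg_def)
  qed
  let ?b = "dd E2 x (E1 x) - dd E1 x (E2 x)"
  have "g x ?b (E1 x) = l1 x" "g x ?b (E2 x) = l2 x"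
    using pull[OF assms smooth_eta(1)[OF open_D lor]] pull[OF assms smooth_eta(2)[OF open_D lor]]
    unfolding structure_at[OF assms]
    by (simp_all add: 0) (simp_all add: eta_simps dd_sg assms, simp_all add: sg_def)
  then show ?thesis using expand[OF assms, of ?b] by simp
qed

text \<open>Cartan's formula for the connection form, with the bracket of the framing inserted. It
  makes K smooth and is the Gauss equation used for the first bracket on the product space.\<close>

lemma curvature: assumes "x \<in> S"
  shows "dd l2 x (E1 x) - dd l1 x (E2 x) - (l1 x)\<^sup>2 + (l2 x)\<^sup>2 = - K x"
proof -
  have "- K x = dd l2 x (E1 x) - dd l1 x (E2 x) - lam x (l1 x *\<^sub>R E1 x - l2 x *\<^sub>R E2 x)"
    using pull[OF assms smooth_\<kappa>] unfolding structure_at[OF assms] bracket[OF assms]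
    by (simp add: l1_def[abs_def] l2_def[abs_def] lam_def[abs_def])
  then show ?thesis
    using lam_linear[OF assms, of "l1 x" "E1 x" "- l2 x" "E2 x"]
    by (simp add: l1_def[symmetric] l2_def[symmetric] power2_eq_square)
qed

end

section \<open>The Killing equations\<close>

lemmas square_simps = algebra_simps power2_eq_square

context framed_surface
begin

lemma smooth_dd: "smooth_on S F \<Longrightarrow> smooth_on S X \<Longrightarrow> smooth_on S (\<lambda>x. dd F x (X x))"
  by (rule smooth_on_frechet_dir[OF open_S])

text \<open>K is given as an arbitrary function satisfying the structure equations; its smoothness
  is read off from the curvature formula, whose other terms are smooth.\<close>

lemma smooth_K: "smooth_on S K"
proof -
  have "smooth_on S (\<lambda>x. - (dd l2 x (E1 x) - dd l1 x (E2 x) - (l1 x)\<^sup>2 + (l2 x)\<^sup>2))"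
    by (intro smooth_intros smooth_dd smooth_l smooth_E open_S)
  then show ?thesis using smooth_on_cong[OF open_S] curvature by (metis (no_types, lifting) minus_minus)
qed

text \<open>The cube root of q, equal to k^(-1/2). The functions \<open>ff\<close> and
  \<open>hh\<close> are the frame components of -d log w = (1/2) d log k, and all later formulas are
  rational in these three.\<close>

definition w :: "real^2 \<Rightarrow> real" where "w x = \<bar>K x\<bar> powr (- 1 / 4)"
definition ff :: "real^2 \<Rightarrow> real" where "ff x = - dd w x (E1 x) / w x"
definition hh :: "real^2 \<Rightarrow> real" where "hh x = - dd w x (E2 x) / w x"

lemma w_pos: "x \<in> S \<Longrightarrow> 0 < w x" and K_neg: "x \<in> S \<Longrightarrow> K x < 0"
  using neg[of x] S_D by (auto simp: w_def)

lemma smooth_w: "smooth_on S w"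
proof -
  have "smooth_on S (\<lambda>x. (- K x) powr (- 1 / 4))"
    by (intro smooth_on_powr smooth_on_minus smooth_K open_S) (use neg S_D in auto)
  then show ?thesis
    using smooth_on_cong[OF open_S, of w "\<lambda>x. (- K x) powr (- 1 / 4)"] neg S_D
    by (force simp: w_def)
qed

lemma smooth_fh: "smooth_on S ff" "smooth_on S hh"
  unfolding ff_def[abs_def] hh_def[abs_def]
  by (intro smooth_on_divide smooth_on_minus smooth_dd smooth_w smooth_E open_S; use w_pos in force)+

lemma w_E: "x \<in> S \<Longrightarrow> dd w x (E1 x) = - w x * ff x" "x \<in> S \<Longrightarrow> dd w x (E2 x) = - w x * hh x"
  using w_pos[of x] by (auto simp: ff_def hh_def)

lemma K_w: assumes "x \<in> S" shows "K x = - (1 / w x ^ 4)" "sqrt \<bar>K x\<bar> = 1 / (w x)\<^sup>2" "q_of K x = w x ^ 3"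
proof -
  have 1: "w x ^ n = \<bar>K x\<bar> powr (- real n / 4)" for n
    using K_neg[OF assms] by (simp add: w_def powr_powr powr_realpow[symmetric])
  show "K x = - (1 / w x ^ 4)" "sqrt \<bar>K x\<bar> = 1 / (w x)\<^sup>2" "q_of K x = w x ^ 3"
    using K_neg[OF assms] unfolding 1 q_of_def
    by (simp_all add: powr_minus field_simps powr_half_sqrt)
qed

lemma diff_at: "smooth_on S F \<Longrightarrow> x \<in> S \<Longrightarrow> (F has_derivative dd F x) (at x)"
  by (rule smooth_on_has_derivative)

lemma q_E: assumes "x \<in> S"
  shows "dd (q_of K) x (E1 x) = - 3 * w x ^ 3 * ff x" (is ?t1) "dd (q_of K) x (E2 x) = - 3 * w x ^ 3 * hh x" (is ?t2)
proof -
  have "dd (q_of K) x = dd (\<lambda>x. w x ^ 3) x"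
    by (rule dd_cong_open[OF open_S assms]) (simp add: K_w)
  also have "\<dots> = (\<lambda>v. 3 * (w x)\<^sup>2 * dd w x v)"
    by (rule frechet_eq)
       (auto intro!: derivative_eq_intros diff_at[OF smooth_w assms] simp: fun_eq_iff)
  finally show ?t1 ?t2
    by (simp_all add: w_E[OF assms] power2_eq_square power3_eq_cube)
qed

lemma metric_product_rule:
  assumes "x \<in> S" "(X has_derivative X') (at x)" "(Y has_derivative Y') (at x)"
  shows "((\<lambda>y. g y (X y) (Y y)) has_derivative
     (\<lambda>v. dd (\<lambda>y. g y (X x) (Y x)) x v + g x (X' v) (Y x) + g x (X x) (Y' v))) (at x)"
proof -
  have lin: "linear (\<lambda>u. g y u e)" "linear (\<lambda>u. g y e u)" if "y \<in> S" for y e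
    using bil[OF that] by (auto simp: bilinear_def)
  have "smooth_on S (\<lambda>y. g y a b)" for a b
    using lor smooth_on_subset[OF _ S_D] unfolding lorentzian_metric_on_def by blast
  then have d: "(\<lambda>y. g y a b) differentiable (at x)" for a b
    using assms(1) smooth_on_differentiable by blast
  have 1: "((\<lambda>y. g y (X y) e) has_derivative
     (\<lambda>v. dd (\<lambda>y. g y (X x) e) x v + g x (X' v) e)) (at x)" for e
    by (rule has_derivative_linear_apply[OF open_S assms(1) lin(1) d assms(2)])
  then have "(\<lambda>y. g y (X y) e) differentiable (at x)" for e
    by (auto simp: differentiable_def)
  from has_derivative_linear_apply[OF open_S assms(1) lin(2) this assms(3)]
  show ?thesis unfolding frechet_eq[OF 1] .
qed

end

section \<open>The Hessian of q in the framing\<close>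

locale killing_surface = framed_surface +
  assumes kil: "killing_field_on S g (V_field K E1 E2)" and spl: "spacelike_on S g (V_field K E1 E2)"
begin

definition q1 :: "real^2 \<Rightarrow> real" where "q1 x = - 3 * w x ^ 3 * ff x"
definition q2 :: "real^2 \<Rightarrow> real" where "q2 x = - 3 * w x ^ 3 * hh x"

lemma V_eq: "x \<in> S \<Longrightarrow> V_field K E1 E2 x = q1 x *\<^sub>R E2 x - q2 x *\<^sub>R E1 x"
  by (simp add: V_field_def q_E q1_def q2_def)

lemma spacelike: assumes "x \<in> S" shows "(hh x)\<^sup>2 < (ff x)\<^sup>2"
proof -
  note b = bil[OF assms]
  have "g x (V_field K E1 E2 x) (V_field K E1 E2 x) = (q2 x)\<^sup>2 - (q1 x)\<^sup>2"
    unfolding V_eq[OF assms]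
    by (simp add: bilinear_lsub[OF b] bilinear_rsub[OF b] bilinear_lmul[OF b] bilinear_rmul[OF b]
        g_E[OF assms] power2_eq_square)
  moreover have "(q2 x)\<^sup>2 - (q1 x)\<^sup>2 = (3 * w x ^ 3)\<^sup>2 * ((hh x)\<^sup>2 - (ff x)\<^sup>2)"
    by (simp add: q1_def q2_def power2_eq_square algebra_simps)
  ultimately have "(3 * w x ^ 3)\<^sup>2 * ((hh x)\<^sup>2 - (ff x)\<^sup>2) < 0"
    using spl assms by (auto simp: spacelike_on_def)
  then show ?thesis using w_pos[OF assms] by (simp add: mult_less_0_iff)
qed

text \<open>Inner products of frame fields are constant, so for them the Killing equation becomes
  <[X, V], Y> + <X, [Y, V]> = 0, and derivatives of the frame enter only through its bracket. The
  three equations say that the Hessian of q has no trace-free part.\<close>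

lemma killing_q: assumes "x \<in> S"
  shows "dd q2 x (E1 x) = l1 x * q1 x" "dd q1 x (E2 x) = l2 x * q2 x"
    "dd q1 x (E1 x) + dd q2 x (E2 x) = l2 x * q1 x + l1 x * q2 x" (is ?t1)
proof -
  have sq: "smooth_on S q1" "smooth_on S q2"
    unfolding q1_def[abs_def] q2_def[abs_def]
    by (intro smooth_intros smooth_w smooth_fh open_S)+
  note dq = diff_at[OF sq(1) assms] diff_at[OF sq(2) assms]
  note dE = E_diff[OF assms]
  note b = bil[OF assms]
  define V where "V = q1 x *\<^sub>R E2 x - q2 x *\<^sub>R E1 x"
  let ?DV = "\<lambda>v. q1 x *\<^sub>R dd E2 x v + dd q1 x v *\<^sub>R E2 x - (q2 x *\<^sub>R dd E1 x v + dd q2 x v *\<^sub>R E1 x)"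
  have "dd (V_field K E1 E2) x = dd (\<lambda>x. q1 x *\<^sub>R E2 x - q2 x *\<^sub>R E1 x) x"
    by (rule dd_cong_open[OF open_S assms]) (simp add: V_eq)
  also have "\<dots> = ?DV"
    by (rule frechet_eq) (intro has_derivative_diff has_derivative_scaleR dq dE)
  finally have DV: "dd (V_field K E1 E2) x = ?DV" .
  have K: "dd (\<lambda>y. g y u v) x V + g x (?DV u) v + g x u (?DV v) = 0" for u v
  proof -
    have "dd (\<lambda>y. g y u v) x (V_field K E1 E2 x) + g x (dd (V_field K E1 E2) x u) v
        + g x u (dd (V_field K E1 E2) x v) = 0"
      using kil assms unfolding killing_field_on_def by blast
    then show ?thesis unfolding DV V_eq[OF assms] V_def .
  qed
  have P: "g x (?DV (X x) - dd X x V) (Y x) + g x (X x) (?DV (Y x) - dd Y x V) = 0"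
    if XY: "(X, Y) \<in> {(E1, E1), (E1, E2), (E2, E2)}" for X Y
  proof -
    have X: "(X has_derivative dd X x) (at x)" and Y: "(Y has_derivative dd Y x) (at x)"
      using XY dE by auto
    have "dd (\<lambda>y. g y (X y) (Y y)) x V = 0"
      by (rule dd_const[OF assms, where c = "g x (X x) (Y x)"]) (use XY g_E assms in auto)
    then have "dd (\<lambda>y. g y (X x) (Y x)) x V + g x (dd X x V) (Y x) + g x (X x) (dd Y x V) = 0"
      unfolding frechet_eq[OF metric_product_rule[OF assms X Y]] .
    with K[of "X x" "Y x"] show ?thesis
      unfolding bilinear_lsub[OF b] bilinear_rsub[OF b] by linarith
  qed
  have lin: "linear (dd E1 x)" "linear (dd E2 x)" using dE has_derivative_linear by blast+
  have B: "dd E1 x V = q1 x *\<^sub>R dd E1 x (E2 x) - q2 x *\<^sub>R dd E1 x (E1 x)"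
    "dd E2 x V = q1 x *\<^sub>R dd E2 x (E2 x) - q2 x *\<^sub>R dd E2 x (E1 x)"
    by (simp_all add: V_def linear_diff lin linear_cmul)
  have br: "dd E2 x (E1 x) = dd E1 x (E2 x) + (l1 x *\<^sub>R E1 x - l2 x *\<^sub>R E2 x)"
    using bracket[OF assms] by (simp add: algebra_simps)
  have b1: "?DV (E1 x) - dd E1 x V =
      (q1 x * l1 x - dd q2 x (E1 x)) *\<^sub>R E1 x + (dd q1 x (E1 x) - q1 x * l2 x) *\<^sub>R E2 x"
    unfolding B br by (simp add: algebra_simps)
  have b2: "?DV (E2 x) - dd E2 x V =
      (q2 x * l1 x - dd q2 x (E2 x)) *\<^sub>R E1 x + (dd q1 x (E2 x) - q2 x * l2 x) *\<^sub>R E2 x"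
    unfolding B br by (simp add: algebra_simps)
  note s = bilinear_ladd[OF b] bilinear_radd[OF b] bilinear_lmul[OF b] bilinear_rmul[OF b] g_E[OF assms]
  show "dd q2 x (E1 x) = l1 x * q1 x" using P[of E1 E1] unfolding b1 b2 by (simp add: s) (simp add: algebra_simps)?
  show "dd q1 x (E2 x) = l2 x * q2 x" using P[of E2 E2] unfolding b1 b2 by (simp add: s) (simp add: algebra_simps)?
  show ?t1
    using P[of E1 E2] unfolding b1 b2 by (simp add: s) (simp add: algebra_simps)?
qed

text \<open>The unknown factor of the Hessian: Hess q = -3 q \<open>GG\<close> g, computed from its
  (E1, E1) component.\<close>

definition GG :: "real^2 \<Rightarrow> real" where "GG x = dd ff x (E1 x) - 3 * (ff x)\<^sup>2 - l1 x * hh x"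

text \<open>The Killing equations divided by -3 w^3. All first derivatives of f and h are now known
  except for the single function \<open>GG\<close>.\<close>

lemma fh_E: assumes "x \<in> S"
  shows "dd hh x (E1 x) = 3 * ff x * hh x + l1 x * ff x" (is ?t1)
    and "dd ff x (E2 x) = 3 * ff x * hh x + l2 x * hh x" (is ?t2)
    and "dd ff x (E1 x) = 3 * (ff x)\<^sup>2 + l1 x * hh x + GG x" (is ?t3)
    and "dd hh x (E2 x) = 3 * (hh x)\<^sup>2 + l2 x * ff x - GG x" (is ?t4)
proof -
  have q: "dd (\<lambda>x. - 3 * w x ^ 3 * F x) x = (\<lambda>v. - 9 * (w x)\<^sup>2 * dd w x v * F x - 3 * w x ^ 3 * dd F x v)"
    if "smooth_on S F" for F
    by (rule frechet_eq)
       (auto intro!: derivative_eq_intros diff_at[OF smooth_w assms] diff_at[OF that assms]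
         simp: fun_eq_iff algebra_simps)
  note Q = killing_q[OF assms]
  note Q' = Q[unfolded q1_def[abs_def] q2_def[abs_def] q[OF smooth_fh(1)] q[OF smooth_fh(2)] w_E[OF assms]]
  have w3: "w x ^ 3 \<noteq> 0" using w_pos[OF assms] by simp
  have "w x ^ 3 * dd hh x (E1 x) = w x ^ 3 * (3 * ff x * hh x + l1 x * ff x)"
    using Q'(1) by (simp add: square_simps power3_eq_cube)
  then show ?t1 using w3 by simp
  have "w x ^ 3 * dd ff x (E2 x) = w x ^ 3 * (3 * ff x * hh x + l2 x * hh x)"
    using Q'(2) by (simp add: square_simps power3_eq_cube)
  then show ?t2 using w3 by simp
  show ?t3 by (simp add: GG_def)
  have "w x ^ 3 * dd hh x (E2 x) = w x ^ 3 * (3 * (hh x)\<^sup>2 + l2 x * ff x - GG x)"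
    using Q'(3) by (simp add: GG_def square_simps power3_eq_cube)
  then show ?t4 using w3 by simp
qed

lemma smooth_GG: "smooth_on S GG"
  unfolding GG_def[abs_def] by (intro smooth_intros smooth_dd smooth_fh smooth_l smooth_E open_S)

end

section \<open>Frames of Minkowski space\<close>

text \<open>The vector field on the frame bundle of Minkowski space with components
  \<open>\<omega>\<^sup>1, \<omega>\<^sup>2, \<omega>\<^sup>3, \<omega>\<^sup>1\<^sub>2, \<omega>\<^sup>3\<^sub>1, \<omega>\<^sup>3\<^sub>2\<close> equal to \<open>c 3, \<dots>, c 8\<close>; it is linear in the frame.\<close>

definition frame_field :: "(nat \<Rightarrow> real) \<Rightarrow> frame3 \<Rightarrow> frame3" where
  "frame_field c p =
    (let e1 = fst (snd p); e2 = fst (snd (snd p)); e3 = snd (snd (snd p)) in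
     (c 3 *\<^sub>R e1 + c 4 *\<^sub>R e2 + c 5 *\<^sub>R e3,
      c 6 *\<^sub>R e2 + c 7 *\<^sub>R e3, c 6 *\<^sub>R e1 + c 8 *\<^sub>R e3, c 7 *\<^sub>R e1 - c 8 *\<^sub>R e2))"

lemma mink_simps:
  "mink (u + v) w = mink u w + mink v w" "mink w (u + v) = mink w u + mink w v"
  "mink (u - v) w = mink u w - mink v w" "mink w (u - v) = mink w u - mink w v"
  "mink (r *\<^sub>R u) w = r * mink u w" "mink w (r *\<^sub>R u) = r * mink w u"
  by (simp_all add: mink_def algebra_simps)

lemma mink_commute: "mink u v = mink v u"
  by (simp add: mink_def mult.commute)

lemma mink_frames_simps:
  assumes "(y, e1, e2, e3) \<in> mink_frames"
  shows "mink e1 e1 = 1" "mink e2 e2 = -1" "mink e3 e3 = -1" "mink e1 e2 = 0" "mink e1 e3 = 0"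
    "mink e2 e3 = 0" "mink e2 e1 = 0" "mink e3 e1 = 0" "mink e3 e2 = 0"
  using assms by (auto simp: mink_frames_def mink_commute)

lemma om_frame_field:
  assumes "p \<in> mink_frames"
  shows "om1 p (frame_field c p) = c 3" "om2 p (frame_field c p) = c 4" "om3 p (frame_field c p) = c 5"
    "om12 p (frame_field c p) = c 6" "om31 p (frame_field c p) = c 7" "om32 p (frame_field c p) = c 8"
proof -
  obtain y e1 e2 e3 where p: "p = (y, e1, e2, e3)" by (cases p)
  note [simp] = mink_frames_simps[OF assms[unfolded p]]
  show "om1 p (frame_field c p) = c 3" "om2 p (frame_field c p) = c 4" "om3 p (frame_field c p) = c 5"
    "om12 p (frame_field c p) = c 6" "om31 p (frame_field c p) = c 7" "om32 p (frame_field c p) = c 8"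
    by (simp_all add: p frame_field_def mink_simps)
qed

lemma mink_rotations:
  assumes p: "(y, e1, e2, e3) \<in> mink_frames"
  shows "(y', cosh t *\<^sub>R e1 + sinh t *\<^sub>R e2, sinh t *\<^sub>R e1 + cosh t *\<^sub>R e2, e3) \<in> mink_frames" (is ?t1)
    and "(y', cosh t *\<^sub>R e1 + sinh t *\<^sub>R e3, e2, sinh t *\<^sub>R e1 + cosh t *\<^sub>R e3) \<in> mink_frames" (is ?t2)
    and "(y', e1, cos t *\<^sub>R e2 + sin t *\<^sub>R e3, cos t *\<^sub>R e3 - sin t *\<^sub>R e2) \<in> mink_frames" (is ?t3)
proof -
  have c: "cosh t * cosh t = 1 + sinh t * sinh t" "cos t * cos t = 1 - sin t * sin t"
    using cosh_square_eq[of t] cos_squared_eq[of t] by (simp_all add: power2_eq_square)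
  show ?t1
    ?t2
    ?t3
    by (simp_all add: mink_frames_def mink_simps mink_frames_simps[OF p] c algebra_simps)
qed

text \<open>A translation is combined with a boost in the e_1, e_2 plane, a boost in the e_1, e_3
  plane and a rotation in the e_2, e_3 plane. At t = 0 the velocities of successive motions add, so
  the order of composition does not matter.\<close>

lemma frame_field_tangent:
  assumes "p \<in> mink_frames"
  shows "\<exists>\<gamma>. \<gamma> 0 = p \<and> (\<forall>t::real. \<gamma> t \<in> mink_frames) \<and> (\<gamma> has_vector_derivative frame_field c p) (at 0)"
proof -
  obtain y e1 e2 e3 where p: "p = (y, e1, e2, e3)" by (cases p)
  define a1 a2 where "a1 = (\<lambda>t. cosh (c 6 * t) *\<^sub>R e1 + sinh (c 6 * t) *\<^sub>R e2)"
    and "a2 = (\<lambda>t. sinh (c 6 * t) *\<^sub>R e1 + cosh (c 6 * t) *\<^sub>R e2)"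
  define b1 b3 where "b1 = (\<lambda>t. cosh (c 7 * t) *\<^sub>R a1 t + sinh (c 7 * t) *\<^sub>R e3)"
    and "b3 = (\<lambda>t. sinh (c 7 * t) *\<^sub>R a1 t + cosh (c 7 * t) *\<^sub>R e3)"
  define d2 d3 where "d2 = (\<lambda>t. cos (c 8 * t) *\<^sub>R a2 t + sin (c 8 * t) *\<^sub>R b3 t)"
    and "d3 = (\<lambda>t. cos (c 8 * t) *\<^sub>R b3 t - sin (c 8 * t) *\<^sub>R a2 t)"
  define y' where "y' = (\<lambda>t. y + t *\<^sub>R (c 3 *\<^sub>R e1 + c 4 *\<^sub>R e2 + c 5 *\<^sub>R e3))"
  have 1: "(y, a1 t, a2 t, e3) \<in> mink_frames" for t
    unfolding a1_def a2_def by (rule mink_rotations(1)[OF assms[unfolded p]])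
  have 2: "(y, b1 t, a2 t, b3 t) \<in> mink_frames" for t
    unfolding b1_def b3_def by (rule mink_rotations(2)[OF 1])
  have 3: "(y' t, b1 t, d2 t, d3 t) \<in> mink_frames" for t
    unfolding d2_def d3_def by (rule mink_rotations(3)[OF 2])
  have t: "((\<lambda>t. F (s * t)) has_real_derivative s * F') (at 0)"
    if "(F has_real_derivative F') (at (s * 0))" for F F' s
    using DERIV_chain2[where g="\<lambda>t. s * t" and x=0, OF that DERIV_cmult_Id[of s]]
    by (simp only: mult.commute)
  have tr: "((\<lambda>t. cosh (s * t)) has_real_derivative 0) (at 0)"
    "((\<lambda>t. sinh (s * t)) has_real_derivative s) (at 0)"
    "((\<lambda>t. cos (s * t)) has_real_derivative 0) (at 0)"
    "((\<lambda>t. sin (s * t)) has_real_derivative s) (at 0)" for s :: real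
    using t[of cosh 0 s] t[of sinh 1 s] t[of cos 0 s] t[of sin 1 s]
      DERIV_cos[of 0] DERIV_sin[of 0] has_field_derivative_cosh[of "\<lambda>x. x" 1 0 UNIV]
      has_field_derivative_sinh[of "\<lambda>x. x" 1 0 UNIV] by simp_all
  have da: "(a1 has_vector_derivative c 6 *\<^sub>R e2) (at 0)" "(a2 has_vector_derivative c 6 *\<^sub>R e1) (at 0)"
    unfolding a1_def a2_def by (auto intro!: derivative_eq_intros tr)
  have a0: "a1 0 = e1" "a2 0 = e2" by (simp_all add: a1_def a2_def)
  have db: "(b1 has_vector_derivative c 6 *\<^sub>R e2 + c 7 *\<^sub>R e3) (at 0)" "(b3 has_vector_derivative c 7 *\<^sub>R e1) (at 0)"
    unfolding b1_def b3_def by (auto intro!: derivative_eq_intros tr da simp: a0)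
  have b0: "b1 0 = e1" "b3 0 = e3" by (simp_all add: b1_def b3_def a0)
  have dd: "(d2 has_vector_derivative c 6 *\<^sub>R e1 + c 8 *\<^sub>R e3) (at 0)"
      "(d3 has_vector_derivative c 7 *\<^sub>R e1 - c 8 *\<^sub>R e2) (at 0)"
    unfolding d2_def d3_def by (auto intro!: derivative_eq_intros tr da db simp: a0 b0)
  have d0: "d2 0 = e2" "d3 0 = e3" by (simp_all add: d2_def d3_def a0 b0)
  have dy: "(y' has_vector_derivative c 3 *\<^sub>R e1 + c 4 *\<^sub>R e2 + c 5 *\<^sub>R e3) (at 0)"
    unfolding y'_def by (auto intro!: derivative_eq_intros)
  have "((\<lambda>t. (y' t, b1 t, d2 t, d3 t)) has_vector_derivative frame_field c p) (at 0)"
    using has_vector_derivative_Pair[OF dy has_vector_derivative_Pair[OF db(1)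
        has_vector_derivative_Pair[OF dd]]]
    by (simp add: p frame_field_def)
  moreover have "(y' 0, b1 0, d2 0, d3 0) = p" by (simp add: p b0 d0 y'_def)
  ultimately show ?thesis
    using 3 by (intro exI[of _ "\<lambda>t. (y' t, b1 t, d2 t, d3 t)"]) simp
qed

lemma frame_field_has_derivative:
  assumes "\<And>i. (c i has_derivative c' i) (at z)" "(P has_derivative P') (at z)"
  shows "((\<lambda>z. frame_field (\<lambda>i. c i z) (P z)) has_derivative
    (\<lambda>v. frame_field (\<lambda>i. c' i v) (P z) + frame_field (\<lambda>i. c i z) (P' v))) (at z)"
  unfolding frame_field_def Let_def
  by (auto intro!: derivative_eq_intros assms simp: algebra_simps fun_eq_iff)

text \<open>Structure constants of the isometry algebra of Minkowski space: slots 3 to 5 are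
  translations, slots 6 to 8 infinitesimal Lorentz transformations. The leading zeros only align the
  positions with these labels.\<close>

definition bracket_coeff :: "(nat \<Rightarrow> real) \<Rightarrow> (nat \<Rightarrow> real) \<Rightarrow> nat \<Rightarrow> real" where
  "bracket_coeff c d i =
    [0, 0, 0, c 6 * d 4 - c 4 * d 6 + c 7 * d 5 - c 5 * d 7,
     c 6 * d 3 - c 3 * d 6 - (c 8 * d 5 - c 5 * d 8),
     c 7 * d 3 - c 3 * d 7 + c 8 * d 4 - c 4 * d 8,
     c 7 * d 8 - c 8 * d 7, c 8 * d 6 - c 6 * d 8, c 7 * d 6 - c 6 * d 7] ! i"

text \<open>With constant coefficients the fields are linear maps of the frame, so their Lie bracket
  is a commutator of linear maps.\<close>

lemma frame_field_bracket:
  "frame_field d (frame_field c p) - frame_field c (frame_field d p) = frame_field (bracket_coeff c d) p"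
  by (simp add: frame_field_def bracket_coeff_def Let_def algebra_simps)

section \<open>The singular system along a framing\<close>

type_synonym pt = "(real^2) \<times> frame3"

abbreviation real_embedding_system :: "metric \<Rightarrow> (frame2, real) form1 \<Rightarrow> (embpt, real) form1 list" where
  "real_embedding_system \<equiv> embedding_system"

lemma singular_system_sum:
  fixes c :: "nat \<Rightarrow> real"
  shows "(\<Sum>j<length (singular_system (1::real) g \<kappa> K). c j * (singular_system (1::real) g \<kappa> K ! j) z v) =
    (\<Sum>j<length (real_embedding_system g \<kappa>). c j * (real_embedding_system g \<kappa> ! j) z v)
    + c 4 * (om31 (snd z) (snd v) - sqrt \<bar>K (fst (fst z))\<bar> * eta2 g (fst z) (fst v))
    + c 5 * (om32 (snd z) (snd v) + sqrt \<bar>K (fst (fst z))\<bar> * eta1 g (fst z) (fst v))"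
  by (simp add: singular_system_def embedding_system_def lessThan_Suc numeral_eq_Suc)

lemma embedding_system_sum:
  fixes c :: "nat \<Rightarrow> real"
  shows "(\<Sum>j<length (real_embedding_system g \<kappa>). c j * (real_embedding_system g \<kappa> ! j) z v) =
    c 0 * om3 (snd z) (snd v) + c 1 * (om1 (snd z) (snd v) - eta1 g (fst z) (fst v))
    + c 2 * (om2 (snd z) (snd v) - eta2 g (fst z) (fst v))
    + c 3 * (om12 (snd z) (snd v) - \<kappa> (fst z) (fst v))"
  by (simp add: embedding_system_def lessThan_Suc numeral_eq_Suc)

context framed_surface
begin

text \<open>A vector is described by its values on a global coframe of the slice: slots 1 and 2
  belong to eta^1 and eta^2, slots 3 to 8 to the forms on the frames of Minkowski space.\<close>

definition frm :: "(nat \<Rightarrow> real) \<Rightarrow> pt \<Rightarrow> pt" where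
  "frm c z = (c 1 *\<^sub>R E1 (fst z) + c 2 *\<^sub>R E2 (fst z), frame_field c (snd z))"

definition lift :: "pt \<Rightarrow> embpt" where "lift z = (sg (fst z), snd z)"

abbreviation dlift :: "pt \<Rightarrow> pt \<Rightarrow> embpt" where
  "dlift z \<equiv> dd lift z"

definition bracket_at :: "real^2 \<Rightarrow> (nat \<Rightarrow> real) \<Rightarrow> (nat \<Rightarrow> real) \<Rightarrow> nat \<Rightarrow> real" where
  "bracket_at x c d i = (if i = 1 then l1 x * (c 1 * d 2 - c 2 * d 1)
     else if i = 2 then - l2 x * (c 1 * d 2 - c 2 * d 1) else bracket_coeff c d i)"

text \<open>The slots of the bracket [X, Y] = DY(X) - DX(Y) of the fields with component functions c
  and d: derivatives of the components plus the structure functions of the framing and of the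
  isometry algebra.\<close>

definition lie :: "(nat \<Rightarrow> pt \<Rightarrow> real) \<Rightarrow> (nat \<Rightarrow> pt \<Rightarrow> real) \<Rightarrow> pt \<Rightarrow> nat \<Rightarrow> real" where
  "lie c d z i = dd (d i) z (frm (\<lambda>i. c i z) z)
     - dd (c i) z (frm (\<lambda>i. d i z) z)
     + bracket_at (fst z) (\<lambda>i. c i z) (\<lambda>i. d i z) i"

lemma open_SU: "open (S \<times> (UNIV :: frame3 set))"
  using open_S by (simp add: open_Times)

lemma smooth_lift: "smooth_on (S \<times> UNIV) lift"
proof -
  have "smooth_on (S \<times> UNIV) (\<lambda>z::pt. sg (fst z))"
    by (rule smooth_on_compose[OF open_SU open_S _ smooth_sg]) (auto intro!: smooth_intros open_SU)
  then show ?thesis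
    unfolding lift_def[abs_def] by (intro smooth_intros open_SU)
qed

lemma dlift: assumes "fst z \<in> S" shows "dlift z v = (dd sg (fst z) (fst v), snd v)"
proof -
  have "((\<lambda>z::pt. sg (fst z)) has_derivative (\<lambda>v. dd sg (fst z) (fst v))) (at z)"
    by (rule has_derivative_compose[OF bounded_linear_imp_has_derivative[OF bounded_linear_fst]
        smooth_on_has_derivative[OF smooth_sg assms]])
  then have "(lift has_derivative (\<lambda>v. (dd sg (fst z) (fst v), snd v))) (at z)"
    unfolding lift_def[abs_def] by (auto intro!: derivative_eq_intros)
  then show ?thesis by (simp add: frechet_eq)
qed

lemma frm_curve:
  assumes "snd z \<in> mink_frames"
  shows "\<exists>\<gamma> v. \<gamma> 0 = z \<and> (\<forall>t::real. snd (\<gamma> t) \<in> mink_frames \<and> fst (\<gamma> t) = fst z + t *\<^sub>R v) \<and>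
    (\<gamma> has_vector_derivative frm c z) (at 0)"
proof -
  obtain \<gamma> where \<gamma>: "\<gamma> 0 = snd z" "\<forall>t::real. \<gamma> t \<in> mink_frames"
    "(\<gamma> has_vector_derivative frame_field c (snd z)) (at 0)"
    using frame_field_tangent[OF assms] by blast
  define v where "v = c 1 *\<^sub>R E1 (fst z) + c 2 *\<^sub>R E2 (fst z)"
  have "((\<lambda>t. fst z + t *\<^sub>R v) has_vector_derivative v) (at 0)"
    by (auto intro!: derivative_eq_intros)
  from has_vector_derivative_Pair[OF this \<gamma>(3)]
  show ?thesis using \<gamma>(1,2)
    by (intro exI[of _ "\<lambda>t. (fst z + t *\<^sub>R v, \<gamma> t)"] exI[of _ v]) (simp add: frm_def v_def)
qed

lemma lift_tangent:
  assumes "fst z \<in> S" "snd z \<in> mink_frames"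
  shows "dlift z (frm c z) \<in> tangent_space (frame_bundle D g \<times> mink_frames) (lift z)"
proof -
  obtain \<gamma> v where \<gamma>: "\<gamma> 0 = z" "\<And>t::real. snd (\<gamma> t) \<in> mink_frames"
    "\<And>t. fst (\<gamma> t) = fst z + t *\<^sub>R v" "(\<gamma> has_vector_derivative frm c z) (at 0)"
    using frm_curve[OF assms(2)] by blast
  have "(lift has_derivative dlift z) (at (\<gamma> 0))"
    using smooth_on_has_derivative[OF smooth_lift, of z] assms \<gamma>(1) by (cases z) auto
  note d = has_vector_derivative_compose[OF \<gamma>(4) this]
  show ?thesis
  proof (rule tangent_spaceI[OF d])
    show "open ((\<lambda>t. fst z + t *\<^sub>R v) -` S)"
      by (intro open_vimage open_S continuous_intros)
    show "lift (\<gamma> t) \<in> frame_bundle D g \<times> mink_frames" if "t \<in> (\<lambda>t. fst z + t *\<^sub>R v) -` S" for t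
      using that \<gamma>(2,3)[of t] sg_frame by (simp add: lift_def)
  qed (use assms \<gamma>(1) sg_frame in \<open>auto simp: lift_def\<close>)
qed

text \<open>A function that vanishes over \<open>mink_frames\<close> may have a nonzero derivative
  in transversal directions of the ambient space. Along \<open>frm c z\<close> it is evaluated on a
  curve inside the zero set.\<close>

lemma tangential_zero:
  fixes \<phi> :: "pt \<Rightarrow> real"
  assumes "open U" "z \<in> U" "snd z \<in> mink_frames" "\<phi> differentiable (at z)"
    and zero: "\<And>z'. z' \<in> U \<Longrightarrow> snd z' \<in> mink_frames \<Longrightarrow> \<phi> z' = 0"
  shows "dd \<phi> z (frm c z) = 0"
proof -
  obtain \<gamma> v where \<gamma>: "\<gamma> 0 = z" "\<And>t::real. snd (\<gamma> t) \<in> mink_frames"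
    "\<And>t. fst (\<gamma> t) = fst z + t *\<^sub>R v" "(\<gamma> has_vector_derivative frm c z) (at 0)"
    using frm_curve[OF assms(3)] by blast
  have "(\<phi> has_derivative dd \<phi> z) (at (\<gamma> 0))"
    using has_derivative_frechet[OF assms(4)] \<gamma>(1) by simp
  note d = has_vector_derivative_compose[OF \<gamma>(4) this]
  have "isCont \<gamma> 0" using has_vector_derivative_continuous[OF \<gamma>(4)] .
  then have "\<forall>\<^sub>F t in at 0. \<gamma> t \<in> U"
    using assms(1,2) \<gamma>(1) by (auto simp: isCont_def dest: topological_tendstoD)
  then have "\<forall>\<^sub>F t in at 0. \<phi> (\<gamma> t) = 0"
    by eventually_elim (use zero \<gamma>(2) in auto)
  then have "((\<lambda>t. 0) has_vector_derivative dd \<phi> z (frm c z)) (at (0::real))"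
    using has_derivative_transform_eventually[OF d[unfolded has_vector_derivative_def], of "\<lambda>t. 0"]
      zero[OF assms(2,3)] \<gamma>(1) by (simp add: has_vector_derivative_def)
  from vector_derivative_unique_at[OF this has_vector_derivative_const] show ?thesis .
qed

lemma frm_has_derivative:
  assumes "\<And>i. c i differentiable (at z)" "fst z \<in> S"
  shows "((\<lambda>z. frm (\<lambda>i. c i z) z) has_derivative
    (\<lambda>v. frm (\<lambda>i. dd (c i) z v) z
      + (c 1 z *\<^sub>R dd E1 (fst z) (fst v) + c 2 z *\<^sub>R dd E2 (fst z) (fst v), frame_field (\<lambda>i. c i z) (snd v))))
    (at z)"
proof -
  have fst: "(fst has_derivative fst) (at z)" and snd: "(snd has_derivative snd) (at z)"
    by (auto intro!: derivative_eq_intros)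
  note E = has_derivative_compose[OF fst E_diff(1)[OF assms(2)]]
    has_derivative_compose[OF fst E_diff(2)[OF assms(2)]]
  note c = has_derivative_frechet[OF assms(1)]
  show ?thesis
    unfolding frm_def
    using has_derivative_Pair[OF has_derivative_add[OF has_derivative_scaleR[OF c E(1)]
        has_derivative_scaleR[OF c E(2)]] frame_field_has_derivative[OF c snd], of 1 2]
    by (rule has_derivative_eq_rhs) (simp add: fun_eq_iff algebra_simps)
qed

lemma frm_bracket:
  assumes "fst z \<in> S"
  defines "DF \<equiv> \<lambda>c v. frm (\<lambda>i. dd (c i) z v) z
      + (c 1 z *\<^sub>R dd E1 (fst z) (fst v) + c 2 z *\<^sub>R dd E2 (fst z) (fst v), frame_field (\<lambda>i. c i z) (snd v))"
  shows "DF d (frm (\<lambda>i. c i z) z) - DF c (frm (\<lambda>i. d i z) z) = frm (lie c d z) z"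
proof -
  note lin = has_derivative_linear[OF E_diff(1)[OF assms(1)]] has_derivative_linear[OF E_diff(2)[OF assms(1)]]
  have br: "dd E2 (fst z) (E1 (fst z)) = dd E1 (fst z) (E2 (fst z)) + (l1 (fst z) *\<^sub>R E1 (fst z) - l2 (fst z) *\<^sub>R E2 (fst z))"
    using bracket[OF assms(1)] by (simp add: algebra_simps)
  let ?c = "\<lambda>i. c i z" and ?d = "\<lambda>i. d i z"
  let ?Dc = "\<lambda>i. dd (c i) z (frm ?d z)"
  let ?Dd = "\<lambda>i. dd (d i) z (frm ?c z)"
  have 1: "frame_field (lie c d z) (snd z) =
     frame_field ?Dd (snd z) - frame_field ?Dc (snd z) + frame_field (bracket_coeff ?c ?d) (snd z)"
    by (simp add: frame_field_def Let_def lie_def bracket_at_def algebra_simps)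
  have "snd (DF d (frm ?c z)) - snd (DF c (frm ?d z)) = frame_field (lie c d z) (snd z)"
    unfolding 1 frame_field_bracket[symmetric] by (simp add: DF_def frm_def)
  moreover have "fst (DF d (frm ?c z)) - fst (DF c (frm ?d z)) =
      lie c d z 1 *\<^sub>R E1 (fst z) + lie c d z 2 *\<^sub>R E2 (fst z)"
    by (simp add: DF_def frm_def lie_def bracket_at_def linear_add[OF lin(1)] linear_add[OF lin(2)]
      linear_cmul[OF lin(1)] linear_cmul[OF lin(2)] br) (simp add: frm_def algebra_simps)
  ultimately show ?thesis by (simp add: frm_def prod_eq_iff)
qed

abbreviation unit_coeff :: "nat \<Rightarrow> nat \<Rightarrow> real" where
  "unit_coeff l \<equiv> \<lambda>i. if i = l then 1 else 0"

lemma frm_expand: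
  "frm c z = c 1 *\<^sub>R frm (unit_coeff 1) z + c 2 *\<^sub>R frm (unit_coeff 2) z + c 3 *\<^sub>R frm (unit_coeff 3) z
    + c 4 *\<^sub>R frm (unit_coeff 4) z + c 5 *\<^sub>R frm (unit_coeff 5) z + c 6 *\<^sub>R frm (unit_coeff 6) z
    + c 7 *\<^sub>R frm (unit_coeff 7) z + c 8 *\<^sub>R frm (unit_coeff 8) z"
  by (simp add: frm_def frame_field_def Let_def)

definition kk :: "real^2 \<Rightarrow> real" where "kk x = sqrt \<bar>K x\<bar>"

lemma form_components:
  assumes "fst z \<in> S" "snd z \<in> mink_frames"
  shows "om1 (snd (lift z)) (snd (dlift z (frm c z))) = c 3" (is ?t1)
    "om2 (snd (lift z)) (snd (dlift z (frm c z))) = c 4" (is ?t2)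
    "om3 (snd (lift z)) (snd (dlift z (frm c z))) = c 5" (is ?t3)
    "om12 (snd (lift z)) (snd (dlift z (frm c z))) = c 6" (is ?t4)
    "om31 (snd (lift z)) (snd (dlift z (frm c z))) = c 7" (is ?t5)
    "om32 (snd (lift z)) (snd (dlift z (frm c z))) = c 8" (is ?t6)
    "eta1 g (fst (lift z)) (fst (dlift z (frm c z))) = c 1" (is ?t7)
    "eta2 g (fst (lift z)) (fst (dlift z (frm c z))) = c 2" (is ?t8)
    "\<kappa> (fst (lift z)) (fst (dlift z (frm c z))) = c 1 * l1 (fst z) + c 2 * l2 (fst z)" (is ?t9)
    "fst (fst (lift z)) = fst z"
proof -
  note b = bil[OF assms(1)]
  show ?t1
    ?t2
    ?t3
    ?t4
    ?t5
    ?t6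
    unfolding dlift[OF assms(1)]
    by (simp_all add: lift_def frm_def om_frame_field[OF assms(2)])
  show ?t7
    ?t8
    unfolding dlift[OF assms(1)]
    by (simp_all add: lift_def frm_def eta_simps dd_sg[OF assms(1)])
       (simp_all add: sg_def bilinear_ladd[OF b] bilinear_lmul[OF b] g_E[OF assms(1)])
  show ?t9
    unfolding dlift[OF assms(1)] using lam_linear[OF assms(1)]
    by (simp add: lift_def frm_def lam_def[symmetric] l1_def l2_def)
  show "fst (fst (lift z)) = fst z" by (simp add: lift_def sg_def)
qed

end

section \<open>Normal form of a Frobenius subbundle\<close>

lemma sum_pair:
  fixes X :: "nat \<Rightarrow> real"
  assumes "2 \<le> r"
  shows "(\<Sum>i<r. (if i = 0 then s else if i = 1 then t else 0) * X i) = s * X 0 + t * X 1"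
proof -
  have "(\<Sum>i<r. (if i = 0 then s else if i = 1 then t else 0) * X i)
      = (\<Sum>i\<in>{0,1}. (if i = 0 then s else if i = 1 then t else 0) * X i)"
    by (rule sum.mono_neutral_right) (use assms in auto)
  then show ?thesis by simp
qed

lemma sum_triple:
  fixes X :: "nat \<Rightarrow> real"
  assumes "3 \<le> r"
  shows "(\<Sum>i<r. (if i = 0 then s else if i = 1 then t else if i = 2 then u else 0) * X i)
    = s * X 0 + t * X 1 + u * X 2"
proof -
  have "(\<Sum>i<r. (if i = 0 then s else if i = 1 then t else if i = 2 then u else 0) * X i)
      = (\<Sum>i\<in>{0,1,2}. (if i = 0 then s else if i = 1 then t else if i = 2 then u else 0) * X i)"
    by (rule sum.mono_neutral_right) (use assms in auto)
  then show ?thesis by (simp add: add.assoc)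
qed

lemma planar_independent:
  fixes X Y :: "nat \<Rightarrow> real"
  assumes "2 \<le> r"
    and ind: "\<And>a. (\<Sum>i<r. a i * X i) = 0 \<Longrightarrow> (\<Sum>i<r. a i * Y i) = 0 \<Longrightarrow> \<forall>i<r. a i = 0"
  shows "r = 2" "X 0 * Y 1 - X 1 * Y 0 \<noteq> 0"
proof -
  show D: "X 0 * Y 1 - X 1 * Y 0 \<noteq> 0"
  proof
    assume 0: "X 0 * Y 1 - X 1 * Y 0 = 0"
    have pair: "s = 0 \<and> t = 0" if "s * X 0 + t * X 1 = 0" "s * Y 0 + t * Y 1 = 0" for s t
      using ind[of "\<lambda>i. if i = 0 then s else if i = 1 then t else 0"] that assms(1)
      by (auto simp: sum_pair dest: spec[of _ 0] spec[of _ 1])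
    \<comment> \<open>If the minor vanishes, its cofactors are the coefficients of a linear
      relation, hence all four entries are zero; then the relation with coefficients 1, 1 is a
      contradiction.\<close>
    have "- X 1 = 0 \<and> X 0 = 0" by (rule pair) (use 0 in \<open>auto simp: algebra_simps\<close>)
    moreover have "- Y 1 = 0 \<and> Y 0 = 0" by (rule pair) (use 0 in \<open>auto simp: algebra_simps\<close>)
    ultimately show False using pair[of 1 1] by simp
  qed
  show "r = 2"
  proof (rule ccontr)
    assume "r \<noteq> 2"
    then have r: "3 \<le> r" using assms(1) by simp
    \<comment> \<open>The cross product of the rows (X 0, X 1, X 2) and (Y 0, Y 1, Y 2) is
      orthogonal to both, and its last entry is the minor already known to be nonzero.\<close>
    define s t u where "s = X 1 * Y 2 - X 2 * Y 1" "t = X 2 * Y 0 - X 0 * Y 2" "u = X 0 * Y 1 - X 1 * Y 0"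
    have "\<forall>i<r. (if i = 0 then s else if i = 1 then t else if i = 2 then u else 0) = 0"
      by (rule ind; simp only: sum_triple[OF r]; simp add: s_t_u_def algebra_simps)
    then have "u = 0" using r by (auto dest: spec[of _ 2])
    then show False using D s_t_u_def by simp
  qed
qed

context framed_surface
begin

text \<open>The value of the combination of \<theta> 0, ..., \<theta> 3 with coefficients a on a
  vector with slots e.\<close>

definition rho :: "(nat \<Rightarrow> pt \<Rightarrow> real) \<Rightarrow> pt \<Rightarrow> (nat \<Rightarrow> real) \<Rightarrow> real" where
  "rho a z e = a 0 z * e 5 + a 1 z * (e 3 - e 1) + a 2 z * (e 4 - e 2)
     + a 3 z * (e 6 - (e 1 * l1 (fst z) + e 2 * l2 (fst z)))"

text \<open>The kernel of \<open>\<omega>\<^sup>3\<^sub>1 - k \<eta>\<^sup>2 + \<Sum> a\<^sub>i \<theta>\<^sub>i\<close> and \<open>\<omega>\<^sup>3\<^sub>2 + k \<eta>\<^sup>1 + \<Sum> b\<^sub>i \<theta>\<^sub>i\<close>.\<close>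

definition horizontal :: "(nat \<Rightarrow> pt \<Rightarrow> real) \<Rightarrow> (nat \<Rightarrow> pt \<Rightarrow> real) \<Rightarrow> pt \<Rightarrow> (nat \<Rightarrow> real) \<Rightarrow> bool" where
  "horizontal a b z e \<longleftrightarrow> e 7 - kk (fst z) * e 2 + rho a z e = 0 \<and> e 8 + kk (fst z) * e 1 + rho b z e = 0"

text \<open>A section of the subbundle whose coefficients at the last two generators vanish lies in
  the span of the \<theta>s, hence is zero. So these coefficients embed the fibre in a plane: the
  rank is 2, and inverting a 2 by 2 matrix normalises them to the identity. The Frobenius condition
  then says that the common kernel is closed under brackets.\<close>

lemma frobenius_normal_form:
  assumes z0: "fst z0 \<in> S" "snd z0 \<in> mink_frames"
    and sing: "singular_system_integrable_near (1::real) D g \<kappa> K (lift z0)"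
  obtains U a b where "open U" "z0 \<in> U" "U \<subseteq> S \<times> UNIV"
    "\<And>i z. z \<in> U \<Longrightarrow> snd z \<in> mink_frames \<Longrightarrow> a i differentiable (at z) \<and> b i differentiable (at z)"
    "\<And>c d z. z \<in> U \<Longrightarrow> snd z \<in> mink_frames \<Longrightarrow>
      (\<And>i. c i differentiable (at z)) \<Longrightarrow> (\<And>i. d i differentiable (at z)) \<Longrightarrow>
      (\<And>z'. z' \<in> U \<Longrightarrow> snd z' \<in> mink_frames \<Longrightarrow> horizontal a b z' (\<lambda>i. c i z')) \<Longrightarrow>
      (\<And>z'. z' \<in> U \<Longrightarrow> snd z' \<in> mink_frames \<Longrightarrow> horizontal a b z' (\<lambda>i. d i z')) \<Longrightarrow>
      horizontal a b z (lie c d z)"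
proof -
  let ?N = "frame_bundle D g \<times> mink_frames"
  let ?T = "tangent_space ?N"
  let ?\<sigma> = "singular_system (1::real) g \<kappa> K" and ?\<theta> = "real_embedding_system g \<kappa>"
  from sing[unfolded singular_system_integrable_near_def has_frobenius_subbundle_near_def]
  obtain \<Omega> r and \<alpha> :: "nat \<Rightarrow> (embpt, real) form1"
    where op: "open \<Omega>" "lift z0 \<in> \<Omega>" and r: "2 \<le> r" and sm0: "\<forall>i<r. smooth_form_on \<Omega> (\<alpha> i)"
    and H: "\<forall>z\<in>\<Omega> \<inter> ?N.
        (\<forall>i<r. \<exists>c. \<forall>v\<in>?T z.
           \<alpha> i z v = (\<Sum>j<length ?\<sigma>. c j * (?\<sigma> ! j) z v)) \<and>
        (\<forall>a. (\<forall>v\<in>?T z. (\<Sum>i<r. a i * \<alpha> i z v) = 0) \<longrightarrow> (\<forall>i<r. a i = 0)) \<and>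
        (\<forall>a c. (\<forall>v\<in>?T z. (\<Sum>i<r. a i * \<alpha> i z v) =
               (\<Sum>j<length ?\<theta>. c j * (?\<theta> ! j) z v)) \<longrightarrow>
             (\<forall>v\<in>?T z. (\<Sum>i<r. a i * \<alpha> i z v) = 0)) \<and>
        (\<forall>i<r. \<exists>\<beta>. (\<forall>j<r. linear (\<beta> j)) \<and>
           (\<forall>v\<in>?T z. \<forall>w\<in>?T z.
              ext_d (\<alpha> i) z v w = (\<Sum>j<r. wedge (\<beta> j) (\<alpha> j z) v w)))"
    by (elim exE conjE) (rule that)
  note sm = sm0[rule_format]
  note mem0 = bspec[OF H, THEN conjunct1]
    and ind0 = bspec[OF H, THEN conjunct2, THEN conjunct1, rule_format (no_asm)]
    and int0 = bspec[OF H, THEN conjunct2, THEN conjunct2, THEN conjunct1, rule_format (no_asm)]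
    and frob0 = bspec[OF H, THEN conjunct2, THEN conjunct2, THEN conjunct2]
  define U0 where "U0 = (S \<times> UNIV) \<inter> lift -` \<Omega>"
  have "open U0" unfolding U0_def
    by (rule continuous_open_preimage[OF smooth_on_continuous[OF smooth_lift] open_SU op(1)])
  have z0U: "z0 \<in> U0" using z0 op(2) by (cases z0) (auto simp: U0_def)
  have U0S: "fst z \<in> S" if "z \<in> U0" for z using that by (auto simp: U0_def)
  have sl: "smooth_on U0 lift" by (rule smooth_on_subset[OF smooth_lift]) (auto simp: U0_def)
  have im: "lift ` U0 \<subseteq> \<Omega>" by (auto simp: U0_def)
  have inN: "lift z \<in> \<Omega> \<inter> ?N" if "z \<in> U0" "snd z \<in> mink_frames" for z
    using that sg_frame by (auto simp: U0_def lift_def)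
  define L where "L j l z = \<alpha> j (lift z) (dlift z (frm (unit_coeff l) z))" for j l z
  have Ld: "L j l differentiable (at z)" if "z \<in> U0" "j < r" for j l z
    unfolding L_def[abs_def]
    using ext_d_pullback(2)[OF \<open>open U0\<close> that(1) sl im op(1) sm[OF that(2)]
        frm_has_derivative frm_has_derivative, of "\<lambda>i z. unit_coeff l i" "\<lambda>i z. unit_coeff l i"] U0S[OF that(1)]
    by simp
  have lin\<alpha>: "linear (\<alpha> j (lift z))" if "z \<in> U0" "j < r" for j z
    using sm[OF that(2)] im that(1) by (auto simp: smooth_form_on_def)
  have Lexp: "\<alpha> j (lift z) (dlift z (frm c z)) =
      c 1 * L j 1 z + c 2 * L j 2 z + c 3 * L j 3 z + c 4 * L j 4 z + c 5 * L j 5 z + c 6 * L j 6 z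
      + c 7 * L j 7 z + c 8 * L j 8 z" if "z \<in> U0" "j < r" for j c z
  proof -
    have "linear (dlift z)"
      using has_derivative_linear[OF smooth_on_has_derivative[OF sl that(1)]] .
    from linear_compose[OF this lin\<alpha>[OF that]] have l: "linear (\<lambda>v. \<alpha> j (lift z) (dlift z v))"
      by (simp add: o_def)
    show ?thesis
      by (subst frm_expand) (simp only: linear_add[OF l] linear_cmul[OF l] L_def real_scaleR_def)
  qed
  have mem: "\<alpha> j (lift z) (dlift z (frm c z)) = L j 5 z * c 5 + L j 3 z * (c 3 - c 1) + L j 4 z * (c 4 - c 2)
       + L j 6 z * (c 6 - (c 1 * l1 (fst z) + c 2 * l2 (fst z)))
       + L j 7 z * (c 7 - kk (fst z) * c 2) + L j 8 z * (c 8 + kk (fst z) * c 1)" (is ?e1)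
     and mem8: "\<exists>C. C 4 = L j 7 z \<and> C 5 = L j 8 z \<and> (\<forall>v\<in>?T (lift z).
              \<alpha> j (lift z) v = (\<Sum>j<length ?\<sigma>. C j * (?\<sigma> ! j) (lift z) v))" (is ?e2)
    if z: "z \<in> U0" "snd z \<in> mink_frames" and j: "j < r" for j c z
  proof -
    obtain C where C: "\<forall>v\<in>?T (lift z).
        \<alpha> j (lift z) v = (\<Sum>j<length ?\<sigma>. C j * (?\<sigma> ! j) (lift z) v)"
      using mem0[OF inN[OF z]] j by blast
    have val: "\<alpha> j (lift z) (dlift z (frm c z)) = C 0 * c 5 + C 1 * (c 3 - c 1) + C 2 * (c 4 - c 2)
       + C 3 * (c 6 - (c 1 * l1 (fst z) + c 2 * l2 (fst z)))
       + C 4 * (c 7 - kk (fst z) * c 2) + C 5 * (c 8 + kk (fst z) * c 1)" for c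
      using C[rule_format, OF lift_tangent[OF U0S[OF z(1)] z(2), of c]]
      unfolding singular_system_sum embedding_system_sum
      by (simp add: form_components[OF U0S[OF z(1)] z(2)] kk_def)
    \<comment> \<open>On each of the unit fields 3 to 8 exactly one generator takes the value 1 and
      the others vanish, so the coefficients are values of the form on the slice.\<close>
    have "C 0 = L j 5 z" "C 1 = L j 3 z" "C 2 = L j 4 z" "C 3 = L j 6 z" "C 4 = L j 7 z" "C 5 = L j 8 z"
      by (simp_all add: L_def val)
    note CL = this
    show ?e1
      unfolding val CL ..
    show ?e2
      by (intro exI[of _ C] conjI CL C)
  qed
  have ind: "\<forall>i<r. a i = 0"
    if z: "z \<in> U0" "snd z \<in> mink_frames" and a: "(\<Sum>i<r. a i * L i 7 z) = 0" "(\<Sum>i<r. a i * L i 8 z) = 0" for z a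
  proof -
    define P where "P i C \<longleftrightarrow> C 4 = L i 7 z \<and> C 5 = L i 8 z \<and> (\<forall>v\<in>?T (lift z).
      \<alpha> i (lift z) v = (\<Sum>j<length ?\<sigma>.
         C j * (?\<sigma> ! j) (lift z) v))" for i and C :: "nat \<Rightarrow> real"
    have "\<forall>i\<in>{..<r}. \<exists>C. P i C"
      by (rule ballI, unfold P_def, rule mem8[OF z], simp)
    from bchoice[OF this] obtain C where PC: "\<forall>i\<in>{..<r}. P i (C i)" ..
    have C: "\<And>i. i < r \<Longrightarrow> C i 4 = L i 7 z" "\<And>i. i < r \<Longrightarrow> C i 5 = L i 8 z"
      "\<And>i v. i < r \<Longrightarrow> v\<in>?T (lift z) \<Longrightarrow>
        \<alpha> i (lift z) v = (\<Sum>j<length ?\<sigma>.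
          C i j * (?\<sigma> ! j) (lift z) v)"
      using PC unfolding P_def by simp_all
    have "(\<Sum>i<r. a i * \<alpha> i (lift z) v) = (\<Sum>j<length ?\<theta>.
        (\<Sum>i<r. a i * C i j) * (?\<theta> ! j) (lift z) v)"
      if v: "v \<in> ?T (lift z)" for v
    proof -
      \<comment> \<open>With these two sums zero only the generators of the embedding system remain,
        which is the situation excluded by the intersection condition.\<close>
      have 45: "(\<Sum>i<r. a i * C i 4) = 0" "(\<Sum>i<r. a i * C i 5) = 0" using a C(1,2) by simp_all
      have "(\<Sum>i<r. a i * \<alpha> i (lift z) v) =
         (\<Sum>i<r. a i * (\<Sum>j<length ?\<sigma>. C i j * (?\<sigma> ! j) (lift z) v))"
        using C(3)[OF _ v] by simp
      also have "\<dots> = (\<Sum>j<length ?\<sigma>. (\<Sum>i<r. a i * C i j) * (?\<sigma> ! j) (lift z) v)"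
        unfolding sum_distrib_left sum_distrib_right
        by (subst sum.swap) (simp only: mult.assoc)
      finally show ?thesis unfolding singular_system_sum[of "\<lambda>j. \<Sum>i<r. a i * C i j"] 45 by simp
    qed
    then have "\<forall>v\<in>?T (lift z). (\<Sum>i<r. a i * \<alpha> i (lift z) v) = 0"
      using int0[OF inN[OF z], of a "\<lambda>j. \<Sum>i<r. a i * C i j"] by simp
    then show ?thesis using ind0[OF inN[OF z], of a] by simp
  qed
  have r2: "r = 2"
    by (rule planar_independent(1)[OF r ind[OF z0U z0(2)]])
  define dt where "dt z = L 0 7 z * L 1 8 z - L 1 7 z * L 0 8 z" for z
  have dt0: "dt z \<noteq> 0" if "z \<in> U0" "snd z \<in> mink_frames" for z
    unfolding dt_def by (rule planar_independent(2)[OF r ind[OF that]])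
  \<comment> \<open>Slot \<open>idx i\<close> is dual to \<theta> i: \<theta> 0 is omega^3 in slot
    5, then come slots 3, 4 and 6. The functions a and b solve the equations of \<open>Lab\<close>
    by Cramer's rule.\<close>
  define idx where "idx i = [5, 3, 4, 6::nat] ! i" for i
  define a where "a i z = (L 0 (idx i) z * L 1 8 z - L 1 (idx i) z * L 0 8 z) / dt z" for i z
  define b where "b i z = (L 0 7 z * L 1 (idx i) z - L 1 7 z * L 0 (idx i) z) / dt z" for i z
  have Lab: "L j (idx i) z = L j 7 z * a i z + L j 8 z * b i z"
    if "z \<in> U0" "snd z \<in> mink_frames" "j < 2" for i j z
  proof -
    have "j = 0 \<or> j = 1" using that(3) by auto
    then have "L j 7 z * (L 0 (idx i) z * L 1 8 z - L 1 (idx i) z * L 0 8 z)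
      + L j 8 z * (L 0 7 z * L 1 (idx i) z - L 1 7 z * L 0 (idx i) z) = L j (idx i) z * dt z"
      by (auto simp: dt_def algebra_simps)
    then show ?thesis using dt0[OF that(1,2)]
      by (simp add: a_def b_def add_divide_distrib[symmetric] eq_divide_eq)
  qed
  have form: "\<alpha> j (lift z) (dlift z (frm c z)) =
       L j 7 z * (c 7 - kk (fst z) * c 2 + rho a z c) + L j 8 z * (c 8 + kk (fst z) * c 1 + rho b z c)"
    if z: "z \<in> U0" "snd z \<in> mink_frames" and j: "j < 2" for j c z
    using mem[OF z, of j c] j Lab[OF z j, of 0] Lab[OF z j, of 1] Lab[OF z j, of 2] Lab[OF z j, of 3]
    by (simp add: r2 idx_def rho_def) (simp add: algebra_simps)
  have hor: "horizontal a b z c \<longleftrightarrow> (\<forall>j<2. \<alpha> j (lift z) (dlift z (frm c z)) = 0)"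
    if z: "z \<in> U0" "snd z \<in> mink_frames" for c z
  proof
    show "\<forall>j<2. \<alpha> j (lift z) (dlift z (frm c z)) = 0" if "horizontal a b z c"
      using that form[OF z] by (simp add: horizontal_def)
    define A where "A = c 7 - kk (fst z) * c 2 + rho a z c"
    define B where "B = c 8 + kk (fst z) * c 1 + rho b z c"
    assume "\<forall>j<2. \<alpha> j (lift z) (dlift z (frm c z)) = 0"
    then have "L 0 7 z * A + L 0 8 z * B = 0" "L 1 7 z * A + L 1 8 z * B = 0"
      using form[OF z] by (auto simp: A_def B_def)
    moreover have "dt z * A = L 1 8 z * (L 0 7 z * A + L 0 8 z * B) - L 0 8 z * (L 1 7 z * A + L 1 8 z * B)"
      "dt z * B = L 0 7 z * (L 1 7 z * A + L 1 8 z * B) - L 1 7 z * (L 0 7 z * A + L 0 8 z * B)"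
      by (simp_all add: dt_def algebra_simps)
    ultimately have "dt z * A = 0" "dt z * B = 0" by simp_all
    then show "horizontal a b z c"
      using dt0[OF z] by (simp add: horizontal_def A_def B_def)
  qed
  show ?thesis
  proof (rule that[OF \<open>open U0\<close> z0U])
    show "U0 \<subseteq> S \<times> UNIV" by (auto simp: U0_def)
    show "a i differentiable (at z) \<and> b i differentiable (at z)" if "z \<in> U0" "snd z \<in> mink_frames" for i z
      using Ld[OF that(1)] dt0[OF that] unfolding a_def[abs_def] b_def[abs_def] dt_def[abs_def] r2
      by (auto intro!: differentiable_divide differentiable_diff differentiable_mult)
  next
    fix c d z
    assume z: "z \<in> U0" "snd z \<in> mink_frames"
      and c: "\<And>i. c i differentiable (at z)" and d: "\<And>i. d i differentiable (at z)"
      and hc: "\<And>z'. z' \<in> U0 \<Longrightarrow> snd z' \<in> mink_frames \<Longrightarrow> horizontal a b z' (\<lambda>i. c i z')"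
      and hd: "\<And>z'. z' \<in> U0 \<Longrightarrow> snd z' \<in> mink_frames \<Longrightarrow> horizontal a b z' (\<lambda>i. d i z')"
    let ?c = "\<lambda>z. frm (\<lambda>i. c i z) z" and ?d = "\<lambda>z. frm (\<lambda>i. d i z) z"
    show "horizontal a b z (lie c d z)"
      unfolding hor[OF z]
    proof (intro allI impI)
      fix j :: nat assume j: "j < 2"
      note Dc = frm_has_derivative[where c = c, OF c U0S[OF z(1)]]
        and Dd = frm_has_derivative[where c = d, OF d U0S[OF z(1)]]
      have jr: "j < r" using j r2 by simp
      have dc: "(\<lambda>y. \<alpha> j (lift y) (dlift y (?c y))) differentiable (at z)"
        and dd: "(\<lambda>y. \<alpha> j (lift y) (dlift y (?d y))) differentiable (at z)"
        by (rule ext_d_pullback(2)[OF \<open>open U0\<close> z(1) sl im op(1) sm[OF jr] Dc Dc]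
            ext_d_pullback(2)[OF \<open>open U0\<close> z(1) sl im op(1) sm[OF jr] Dd Dd])+
      have c0: "\<alpha> i (lift z) (dlift z (?c z)) = 0" and d0: "\<alpha> i (lift z) (dlift z (?d z)) = 0" if "i < r" for i
        using hor[OF z] hc[OF z] hd[OF z] that r2 by auto
      \<comment> \<open>In Cartan's formula the derivative terms vanish by tangency, and d\<alpha>
        vanishes on the two fields because each \<alpha> does; what is left is \<alpha> of the
        bracket.\<close>
      have 1: "dd (\<lambda>y. \<alpha> j (lift y) (dlift y (?c y))) z (?d z) = 0"
        by (rule tangential_zero[OF \<open>open U0\<close> z dc]) (use hor hc j in blast)
      have 2: "dd (\<lambda>y. \<alpha> j (lift y) (dlift y (?d y))) z (?c z) = 0"
        by (rule tangential_zero[OF \<open>open U0\<close> z dd]) (use hor hd j in blast)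
      obtain \<beta> where "\<forall>v\<in>?T (lift z). \<forall>w\<in>?T (lift z).
                 ext_d (\<alpha> j) (lift z) v w = (\<Sum>i<r. wedge (\<beta> i) (\<alpha> i (lift z)) v w)"
        using frob0[OF inN[OF z]] jr by blast
      from this[rule_format, OF lift_tangent lift_tangent, OF U0S[OF z(1)] z(2) U0S[OF z(1)] z(2)]
      have "ext_d (\<alpha> j) (lift z) (dlift z (?c z)) (dlift z (?d z)) = 0"
        using c0 d0 by (simp add: wedge_def)
      with ext_d_pullback(1)[OF \<open>open U0\<close> z(1) sl im op(1) sm[OF jr] Dc Dd,
          unfolded 1 2 frm_bracket[OF U0S[OF z(1)]]]
      show "\<alpha> j (lift z) (dlift z (frm (lie c d z) z)) = 0"
        by simp
    qed
  qed
qed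

end

section \<open>Consequences of Darboux integrability\<close>

definition octet :: "(pt \<Rightarrow> real) \<Rightarrow> (pt \<Rightarrow> real) \<Rightarrow> (pt \<Rightarrow> real) \<Rightarrow> (pt \<Rightarrow> real) \<Rightarrow> (pt \<Rightarrow> real) \<Rightarrow>
    (pt \<Rightarrow> real) \<Rightarrow> (pt \<Rightarrow> real) \<Rightarrow> (pt \<Rightarrow> real) \<Rightarrow> nat \<Rightarrow> pt \<Rightarrow> real" where
  "octet c1 c2 c3 c4 c5 c6 c7 c8 i = (if i = 1 then c1 else if i = 2 then c2 else if i = 3 then c3
    else if i = 4 then c4 else if i = 5 then c5 else if i = 6 then c6 else if i = 7 then c7
    else if i = 8 then c8 else (\<lambda>z. 0))"

lemma octet_simps [simp]:
  "octet c1 c2 c3 c4 c5 c6 c7 c8 1 = c1" "octet c1 c2 c3 c4 c5 c6 c7 c8 (Suc 0) = c1"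
  "octet c1 c2 c3 c4 c5 c6 c7 c8 2 = c2"
  "octet c1 c2 c3 c4 c5 c6 c7 c8 3 = c3" "octet c1 c2 c3 c4 c5 c6 c7 c8 4 = c4"
  "octet c1 c2 c3 c4 c5 c6 c7 c8 5 = c5" "octet c1 c2 c3 c4 c5 c6 c7 c8 6 = c6"
  "octet c1 c2 c3 c4 c5 c6 c7 c8 7 = c7" "octet c1 c2 c3 c4 c5 c6 c7 c8 8 = c8"
  by (simp_all add: octet_def)

lemma octet_differentiable:
  assumes "c1 differentiable (at z)" "c2 differentiable (at z)" "c3 differentiable (at z)"
    "c4 differentiable (at z)" "c5 differentiable (at z)" "c6 differentiable (at z)"
    "c7 differentiable (at z)" "c8 differentiable (at z)"
  shows "octet c1 c2 c3 c4 c5 c6 c7 c8 i differentiable (at z)"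
  using assms by (simp add: octet_def)

lemma frechet_uminus:
  "\<phi> differentiable (at z) \<Longrightarrow> dd (\<lambda>z. - \<phi> z) z v = - dd \<phi> z v"
  using frechet_eq[OF has_derivative_minus[OF has_derivative_frechet[of \<phi> z]]] by simp

context killing_surface
begin

lemma base_derivative:
  assumes "smooth_on S F" "fst z \<in> S"
  shows "((\<lambda>z::pt. F (fst z)) has_derivative (\<lambda>v. dd F (fst z) (fst v))) (at z)"
  by (rule has_derivative_compose[OF bounded_linear_imp_has_derivative[OF bounded_linear_fst]
        smooth_on_has_derivative[OF assms]])

lemma kk_w: "x \<in> S \<Longrightarrow> kk x = 1 / (w x)\<^sup>2"
  unfolding kk_def by (rule K_w(2))

lemma smooth_kk: "smooth_on S kk"
proof -
  have "smooth_on S (\<lambda>x. 1 / (w x)\<^sup>2)"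
    by (intro smooth_intros smooth_w open_S) (use w_pos in force)
  then show ?thesis using smooth_on_cong[OF open_S, of kk "\<lambda>x. 1 / (w x)\<^sup>2"] kk_w by blast
qed

lemma kk_pos: "x \<in> S \<Longrightarrow> 0 < kk x"
  using K_neg by (auto simp: kk_def less_le)

lemma kk_E: assumes "x \<in> S"
  shows "dd kk x (E1 x) = 2 * kk x * ff x" "dd kk x (E2 x) = 2 * kk x * hh x"
proof -
  have "dd kk x = dd (\<lambda>x. inverse ((w x)\<^sup>2)) x"
    by (rule dd_cong_open[OF open_S assms]) (simp only: kk_w inverse_eq_divide)
  also have "\<dots> = (\<lambda>v. - (inverse ((w x)\<^sup>2) * (2 * w x * dd w x v) * inverse ((w x)\<^sup>2)))"
    by (rule frechet_eq)
       (use w_pos[OF assms] in \<open>auto intro!: derivative_eq_intros diff_at[OF smooth_w assms] simp: fun_eq_iff\<close>)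
  finally show "dd kk x (E1 x) = 2 * kk x * ff x" "dd kk x (E2 x) = 2 * kk x * hh x"
    using w_pos[OF assms] by (simp_all add: w_E[OF assms] kk_w[OF assms] field_simps power2_eq_square)
qed

lemma hessian_value:
  assumes x0: "x0 \<in> S" "hh x0 \<noteq> 0" and p0: "p0 \<in> mink_frames"
    and sing: "singular_system_integrable_near (1::real) D g \<kappa> K (lift (x0, p0))"
  shows "GG x0 = (kk x0)\<^sup>2"
proof -
  let ?k = "\<lambda>z::pt. kk (fst z)" and ?f = "\<lambda>z::pt. ff (fst z)" and ?h = "\<lambda>z::pt. hh (fst z)"
    and ?l = "\<lambda>z::pt. l1 (fst z)" and ?m = "\<lambda>z::pt. l2 (fst z)"
    and ?o = "\<lambda>z::pt. 0::real" and ?i = "\<lambda>z::pt. 1::real"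
  obtain U a b where U: "open U" "(x0, p0) \<in> U" "U \<subseteq> S \<times> UNIV"
    and ab: "\<And>i z. z \<in> U \<Longrightarrow> snd z \<in> mink_frames \<Longrightarrow> a i differentiable (at z) \<and> b i differentiable (at z)"
    and hor: "\<And>c d z. z \<in> U \<Longrightarrow> snd z \<in> mink_frames \<Longrightarrow>
      (\<And>i. c i differentiable (at z)) \<Longrightarrow> (\<And>i. d i differentiable (at z)) \<Longrightarrow>
      (\<And>z'. z' \<in> U \<Longrightarrow> snd z' \<in> mink_frames \<Longrightarrow> horizontal a b z' (\<lambda>i. c i z')) \<Longrightarrow>
      (\<And>z'. z' \<in> U \<Longrightarrow> snd z' \<in> mink_frames \<Longrightarrow> horizontal a b z' (\<lambda>i. d i z')) \<Longrightarrow>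
      horizontal a b z (lie c d z)"
    using frobenius_normal_form[of "(x0, p0)"] x0(1) p0 sing by auto
  have US: "fst z \<in> S" if "z \<in> U" for z using that U(3) by auto
  have bd: "((\<lambda>z::pt. F (fst z)) differentiable (at z))"
    "dd (\<lambda>z::pt. F (fst z)) z v = dd F (fst z) (fst v)"
    if "z \<in> U" "smooth_on S F" for F z and v :: pt
    using base_derivative[OF that(2) US[OF that(1)]]
      frechet_eq[OF base_derivative[OF that(2) US[OF that(1)]]] by (auto simp: differentiable_def)
  have bm: "dd (\<lambda>z::pt. - F (fst z)) z v = - dd F (fst z) (fst v)"
    if "z \<in> U" "smooth_on S F" for F z and v :: pt
    using frechet_uminus[OF bd(1)[OF that]] bd(2)[OF that] by simp
  have z0: "dd (\<lambda>z. c) z = (\<lambda>v. 0)" for z :: pt and c :: real by simp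
  have l0: "dd F (fst z) 0 = 0" if "z \<in> U" "smooth_on S F" for F :: "real^2 \<Rightarrow> real" and z
    by (rule linear_0[OF has_derivative_linear[OF diff_at[OF that(2) US[OF that(1)]]]])
  note sm = smooth_l smooth_kk smooth_fh
  \<comment> \<open>X1 and X2 project to the framing and annihilate all six generators, so they are
    horizontal whatever a and b are. T0 and T3 are the vertical directions dual to \<theta> 0 and
    \<theta> 3, with slots 7 and 8 adjusted to make them horizontal.\<close>
  define X1 where "X1 = octet ?i ?o ?i ?o ?o (\<lambda>z. ?l z) ?o (\<lambda>z. - ?k z)"
  define X2 where "X2 = octet ?o ?i ?o ?i ?o (\<lambda>z. ?m z) (\<lambda>z. ?k z) ?o"
  define T0 where "T0 = octet ?o ?o ?o ?o ?i ?o (\<lambda>z. - a 0 z) (\<lambda>z. - b 0 z)"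
  define T3 where "T3 = octet ?o ?o ?o ?o ?o ?i (\<lambda>z. - a 3 z) (\<lambda>z. - b 3 z)"
  have dif: "X1 i differentiable (at z)" "X2 i differentiable (at z)" "T0 i differentiable (at z)"
    "T3 i differentiable (at z)" if "z \<in> U" "snd z \<in> mink_frames" for i z
    unfolding X1_def X2_def T0_def T3_def
    using ab[OF that] bd(1)[OF that(1)] sm
    by (auto intro!: octet_differentiable differentiable_minus)
  have ho: "horizontal a b z (\<lambda>i. X1 i z)" "horizontal a b z (\<lambda>i. X2 i z)"
    "horizontal a b z (\<lambda>i. T0 i z)" "horizontal a b z (\<lambda>i. T3 i z)" for z
    by (simp_all add: horizontal_def rho_def X1_def X2_def T0_def T3_def)
  define D1 where "D1 \<phi> z = dd \<phi> z (frm (\<lambda>i. X1 i z) z)" for \<phi> :: "pt \<Rightarrow> real" and z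
  define D2 where "D2 \<phi> z = dd \<phi> z (frm (\<lambda>i. X2 i z) z)" for \<phi> :: "pt \<Rightarrow> real" and z
  have fX: "fst (frm (\<lambda>i. X1 i z) z) = E1 (fst z)" "fst (frm (\<lambda>i. X2 i z) z) = E2 (fst z)"
    "fst (frm (\<lambda>i. T0 i z) z) = 0" "fst (frm (\<lambda>i. T3 i z) z) = 0" for z
    by (simp_all add: frm_def X1_def X2_def T0_def T3_def)
  have DX: "D1 (\<lambda>z. F (fst z)) z = dd F (fst z) (E1 (fst z))" "D2 (\<lambda>z. F (fst z)) z = dd F (fst z) (E2 (fst z))"
    if "z \<in> U" "smooth_on S F" for F z
    using bd(2)[OF that] by (simp_all add: D1_def D2_def fX)
  note ev = horizontal_def rho_def lie_def bracket_at_def bracket_coeff_def fX z0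
  \<comment> \<open>The bracket [X1, X2] has \<theta> 0 component -2 k and, by the curvature
    formula, \<theta> 3 component k^2 - K = 2 k^2, while its \<theta> 1 and \<theta> 2 components
    vanish. The derivatives 2 k f and 2 k h of k balance these.\<close>
  have I: "?f z = a 0 z - ?k z * a 3 z" "?h z = b 0 z - ?k z * b 3 z"
    if z: "z \<in> U" "snd z \<in> mink_frames" for z
  proof -
    have H: "horizontal a b z (lie X1 X2 z)" by (rule hor[OF z dif(1,2)[OF z] ho(1,2)])
    have k2: "?k z * ?k z = - K (fst z)"
      using K_neg[OF US[OF z(1)]] by (simp add: kk_def)
    note H' = H[unfolded ev, unfolded X1_def X2_def octet_simps, folded X1_def X2_def,
        unfolded bd(2)[OF z(1) smooth_l(1)] bd(2)[OF z(1) smooth_l(2)]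
        bd(2)[OF z(1) smooth_kk] bm[OF z(1) smooth_kk] fX z0]
    have cu: "dd l2 (fst z) (E1 (fst z)) = dd l1 (fst z) (E2 (fst z)) + (?l z)\<^sup>2 - (?m z)\<^sup>2 - K (fst z)"
      using curvature[OF US[OF z(1)]] by simp
    have "2 * ?k z * (?f z - (a 0 z - ?k z * a 3 z)) = 0"
      using H'[THEN conjunct1] k2[symmetric]
      by (simp add: kk_E[OF US[OF z(1)]] cu square_simps)
    then show "?f z = a 0 z - ?k z * a 3 z" using kk_pos[OF US[OF z(1)]] by simp
    have "2 * ?k z * (?h z - (b 0 z - ?k z * b 3 z)) = 0"
      using H'[THEN conjunct2] k2[symmetric]
      by (simp add: kk_E[OF US[OF z(1)]] cu square_simps)
    then show "?h z = b 0 z - ?k z * b 3 z" using kk_pos[OF US[OF z(1)]] by simp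
  qed
  have nd: "dd (\<lambda>z. - \<phi> z) z v = - dd \<phi> z v"
    if "\<phi> differentiable (at z)" for \<phi> :: "pt \<Rightarrow> real" and z v
    by (rule frechet_uminus[OF that])
  \<comment> \<open>From the brackets of X1, X2 with T0, T3. The latter are vertical and do not
    differentiate functions of the base, so only derivatives of the a and b along X1 and X2 occur,
    together with algebraic terms.\<close>
  have II: "D1 (a 0) z = ?l z * b 0 z + (a 0 z)\<^sup>2 + ?k z * a 2 z - ?k z * a 0 z * a 3 z" (is ?e1)
      "D1 (b 0) z = ?l z * a 0 z + a 0 z * b 0 z + ?k z * b 2 z - ?k z * a 0 z * b 3 z" (is ?e2)
      "D1 (a 3) z = - ?k z + ?l z * b 3 z + a 0 z * a 3 z - a 2 z - ?k z * (a 3 z)\<^sup>2" (is ?e3)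
      "D1 (b 3) z = ?l z * a 3 z + b 0 z * a 3 z - b 2 z - ?k z * a 3 z * b 3 z" (is ?e4)
      "D2 (a 0) z = ?m z * b 0 z + a 0 z * b 0 z + ?k z * a 1 z - ?k z * a 3 z * b 0 z" (is ?e5)
      "D2 (b 0) z = ?m z * a 0 z + (b 0 z)\<^sup>2 + ?k z * b 1 z - ?k z * b 0 z * b 3 z" (is ?e6)
      "D2 (a 3) z = ?m z * b 3 z + a 0 z * b 3 z - a 1 z - ?k z * a 3 z * b 3 z" (is ?e7)
      "D2 (b 3) z = ?k z + ?m z * a 3 z + b 0 z * b 3 z - b 1 z - ?k z * (b 3 z)\<^sup>2" (is ?e8)
    if z: "z \<in> U" "snd z \<in> mink_frames" for z
  proof -
    note n = nd[OF ab[OF z, THEN conjunct1]] nd[OF ab[OF z, THEN conjunct2]]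
    note u = bd(2)[OF z(1) smooth_l(1)] bd(2)[OF z(1) smooth_l(2)]
        bd(2)[OF z(1) smooth_kk] bm[OF z(1) smooth_kk] fX z0 n l0[OF z(1) smooth_l(1)]
        l0[OF z(1) smooth_l(2)] l0[OF z(1) smooth_kk]
    note H1 = hor[OF z dif(1,3)[OF z] ho(1,3), unfolded ev, unfolded X1_def T0_def octet_simps,
        folded X1_def T0_def, unfolded u, folded D1_def]
    show ?e1
      ?e2
      using H1 by (simp_all add: square_simps)
    note H2 = hor[OF z dif(1,4)[OF z] ho(1,4), unfolded ev, unfolded X1_def T3_def octet_simps,
        folded X1_def T3_def, unfolded u, folded D1_def]
    show ?e3
      ?e4
      using H2 by (simp_all add: square_simps)
    note H3 = hor[OF z dif(2,3)[OF z] ho(2,3), unfolded ev, unfolded X2_def T0_def octet_simps,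
        folded X2_def T0_def, unfolded u, folded D2_def]
    show ?e5
      ?e6
      using H3 by (simp_all add: square_simps)
    note H4 = hor[OF z dif(2,4)[OF z] ho(2,4), unfolded ev, unfolded X2_def T3_def octet_simps,
        folded X2_def T3_def, unfolded u, folded D2_def]
    show ?e7
      ?e8
      using H4 by (simp_all add: square_simps)
  qed
  \<comment> \<open>A relation between a function, the base and k times another function holds only
    over \<open>mink_frames\<close>; it may still be differentiated along
    \<open>frm c\<close>.\<close>
  have diffI: "dd \<phi> z (frm c z) =
      dd F (fst z) (fst (frm c z)) + dd kk (fst z) (fst (frm c z)) * \<psi> z
      + ?k z * dd \<psi> z (frm c z)"
    if z: "z \<in> V" "snd z \<in> mink_frames" and V: "open V" "V \<subseteq> U" and "smooth_on S F" and \<phi>: "\<phi> differentiable (at z)"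
      and \<psi>: "\<psi> differentiable (at z)"
      and eq: "\<And>z. z \<in> V \<Longrightarrow> snd z \<in> mink_frames \<Longrightarrow> \<phi> z = F (fst z) + ?k z * \<psi> z"
    for \<phi> \<psi> F z c V
  proof -
    have zU: "z \<in> U" using z V by auto
    note d = base_derivative[OF \<open>smooth_on S F\<close> US[OF zU]] base_derivative[OF smooth_kk US[OF zU]]
      has_derivative_frechet[OF \<phi>] has_derivative_frechet[OF \<psi>]
    have D: "((\<lambda>z. \<phi> z - (F (fst z) + ?k z * \<psi> z)) has_derivative
      (\<lambda>v. dd \<phi> z v - (dd F (fst z) (fst v) +
        (?k z * dd \<psi> z v + dd kk (fst z) (fst v) * \<psi> z)))) (at z)"
      by (intro has_derivative_diff has_derivative_add has_derivative_mult d)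
    have "dd (\<lambda>z. \<phi> z - (F (fst z) + ?k z * \<psi> z)) z (frm c z) = 0"
      by (rule tangential_zero[OF V(1) z(1,2)]) (use D eq in \<open>auto simp: differentiable_def\<close>)
    then show ?thesis unfolding frechet_eq[OF D] by simp
  qed
  \<comment> \<open>Differentiating \<open>I\<close> along X1 and X2 and inserting \<open>II\<close>
    gives linear equations for a 1, a 2, b 1, b 2, each with coefficient 2 k; these are the parts of
    the solutions free of a 3 and b 3.\<close>
  define P2 where "P2 x = (2 * (ff x)\<^sup>2 + GG x - (kk x)\<^sup>2) / (2 * kk x)" for x
  define P1 where "P1 x = ff x * hh x / kk x" for x
  define R1 where "R1 x = (2 * (hh x)\<^sup>2 - GG x + (kk x)\<^sup>2) / (2 * kk x)" for x
  have sP: "smooth_on S P2" "smooth_on S P1" "smooth_on S R1"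
    unfolding P2_def[abs_def] P1_def[abs_def] R1_def[abs_def]
    by (intro smooth_intros smooth_fh smooth_kk smooth_GG open_S; use kk_pos in force)+
  have III: "a 2 z = ?f z * a 3 z + P2 (fst z)" "a 1 z = ?h z * a 3 z + P1 (fst z)"
      "b 2 z = ?f z * b 3 z + P1 (fst z)" "b 1 z = ?h z * b 3 z + R1 (fst z)"
    if z: "z \<in> U" "snd z \<in> mink_frames" for z
  proof -
    have kp: "?k z > 0" using kk_pos[OF US[OF z(1)]] .
    have da: "a i differentiable (at z)" "b i differentiable (at z)" for i using ab[OF z] by auto
    have A: "a 0 z = ?f z + ?k z * a 3 z" "b 0 z = ?h z + ?k z * b 3 z"
      if "z \<in> U" "snd z \<in> mink_frames" for z
      using I[OF that] by simp_all
    note d = diffI[OF z U(1) order_refl smooth_fh(1) da(1) da(1) A(1)]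
       diffI[OF z U(1) order_refl smooth_fh(2) da(2) da(2) A(2)]
    note dX = d[of "\<lambda>i. X1 i z", unfolded fX, folded D1_def] d[of "\<lambda>i. X2 i z", unfolded fX, folded D2_def]
    note e = dX[unfolded II[OF z] fh_E[OF US[OF z(1)]] kk_E[OF US[OF z(1)]] A[OF z]]
    have "2 * ?k z * (a 2 z - ?f z * a 3 z) = 2 * (?f z)\<^sup>2 + GG (fst z) - (?k z)\<^sup>2"
      using e(1) by (simp add: square_simps)
    then show "a 2 z = ?f z * a 3 z + P2 (fst z)"
      using kp by (simp add: P2_def field_simps)
    have "2 * ?k z * (b 2 z - ?f z * b 3 z) = 2 * ?f z * ?h z"
      using e(2) by (simp add: square_simps)
    then show "b 2 z = ?f z * b 3 z + P1 (fst z)"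
      using kp by (simp add: P1_def field_simps)
    have "2 * ?k z * (a 1 z - ?h z * a 3 z) = 2 * ?f z * ?h z"
      using e(3) by (simp add: square_simps)
    then show "a 1 z = ?h z * a 3 z + P1 (fst z)"
      using kp by (simp add: P1_def field_simps)
    have "2 * ?k z * (b 1 z - ?h z * b 3 z) = 2 * (?h z)\<^sup>2 - GG (fst z) + (?k z)\<^sup>2"
      using e(4) by (simp add: square_simps)
    then show "b 1 z = ?h z * b 3 z + R1 (fst z)"
      using kp by (simp add: R1_def field_simps)
  qed
  \<comment> \<open>The vertical fields dual to \<theta> 0, \<theta> 1, \<theta> 2 with multiples k,
    h, f of T3 subtracted. By \<open>I\<close> and \<open>III\<close> this removes a 3 and b 3 from
    their slots: all slots are functions of the base, constant along the fibres, so their brackets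
    are purely algebraic.\<close>
  define Y0 where "Y0 = octet ?o ?o ?o ?o ?i (\<lambda>z. - ?k z) (\<lambda>z. - ?f z) (\<lambda>z. - ?h z)"
  define Y1 where "Y1 = octet ?o ?o ?i ?o ?o (\<lambda>z. - ?h z) (\<lambda>z. - P1 (fst z)) (\<lambda>z. - R1 (fst z))"
  define Y2 where "Y2 = octet ?o ?o ?o ?i ?o (\<lambda>z. - ?f z) (\<lambda>z. - P2 (fst z)) (\<lambda>z. - P1 (fst z))"
  have fY: "fst (frm (\<lambda>i. Y0 i z) z) = 0" "fst (frm (\<lambda>i. Y1 i z) z) = 0" "fst (frm (\<lambda>i. Y2 i z) z) = 0" for z
    by (simp_all add: frm_def Y0_def Y1_def Y2_def)
  have difY: "Y0 i differentiable (at z)" "Y1 i differentiable (at z)" "Y2 i differentiable (at z)"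
    if "z \<in> U" for i z
    unfolding Y0_def Y1_def Y2_def
    using bd(1)[OF that] sm sP by (auto intro!: octet_differentiable differentiable_minus)
  have hoY: "horizontal a b z (\<lambda>i. Y0 i z)" "horizontal a b z (\<lambda>i. Y1 i z)" "horizontal a b z (\<lambda>i. Y2 i z)"
    if "z \<in> U" "snd z \<in> mink_frames" for z
    using I[OF that] III[OF that]
    by (simp_all add: horizontal_def rho_def Y0_def Y1_def Y2_def) (simp_all add: algebra_simps)
  \<comment> \<open>Slot 7 of the condition on [Y0, Y2] reduces to h (k a 3 + f) = 0 and slot 8 of
    that on [Y0, Y1] to f (k b 3 + h) = 0; f is nonzero because the Killing field is
    spacelike.\<close>
  have IV: "?k z * a 3 z = - ?f z" "?k z * b 3 z = - ?h z"
    if z: "z \<in> U" "snd z \<in> mink_frames" and h: "?h z \<noteq> 0" for z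
  proof -
    have kp: "?k z > 0" using kk_pos[OF US[OF z(1)]] .
    have fn: "?f z \<noteq> 0" using spacelike[OF US[OF z(1)]] by auto
    note u = bm[OF z(1) smooth_kk] bm[OF z(1) smooth_fh(1)] bm[OF z(1) smooth_fh(2)]
      bm[OF z(1) sP(1)] bm[OF z(1) sP(2)] bm[OF z(1) sP(3)] fY z0
      l0[OF z(1) smooth_kk] l0[OF z(1) smooth_fh(1)] l0[OF z(1) smooth_fh(2)]
      l0[OF z(1) sP(1)] l0[OF z(1) sP(2)] l0[OF z(1) sP(3)]
    have A: "a 0 z = ?f z + ?k z * a 3 z" "b 0 z = ?h z + ?k z * b 3 z"
      using I[OF z] by simp_all
    have kP: "?k z * P1 (fst z) = ?f z * ?h z" using kp by (simp add: P1_def)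
    note H1 = hor[OF z difY(1,3)[OF z(1)] hoY(1,3), unfolded ev fY, unfolded Y0_def Y2_def octet_simps,
        folded Y0_def Y2_def, unfolded u A III[OF z], THEN conjunct1]
    have "2 * ?h z * (?k z * a 3 z + ?f z) = 0"
      using H1 kP by (simp add: algebra_simps)
    then show "?k z * a 3 z = - ?f z" using h by simp
    note H2 = hor[OF z difY(1,2)[OF z(1)] hoY(1,2), unfolded ev fY, unfolded Y0_def Y1_def octet_simps,
        folded Y0_def Y1_def, unfolded u A III[OF z], THEN conjunct2]
    have "2 * ?f z * (?k z * b 3 z + ?h z) = 0"
      using H2 kP by (simp add: algebra_simps)
    then show "?k z * b 3 z = - ?h z" using fn by simp
  qed
  \<comment> \<open>The relation k a 3 = -f has to be differentiated along X1, so it is needed on a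
    neighbourhood and not only at the given point. In the form 0 = f + k a 3 it fits
    \<open>diffI\<close> with the zero function on the left.\<close>
  define V where "V = U \<inter> (\<lambda>z. ?h z) -` (- {0})"
  have cont: "continuous_on U (\<lambda>z. ?h z)"
    using bd(1)[OF _ smooth_fh(2)] differentiable_imp_continuous_within
    by (intro continuous_at_imp_continuous_on) blast
  have "open V" unfolding V_def by (rule continuous_open_preimage[OF cont U(1)]) auto
  have zV: "(x0, p0) \<in> V" using U(2) x0(2) by (simp add: V_def)
  let ?z = "(x0, p0)"
  have z: "?z \<in> U" "snd ?z \<in> mink_frames" using U(2) p0 by auto
  have e: "0 = ?f z + ?k z * a 3 z" if "z \<in> V" "snd z \<in> mink_frames" for z
    using IV(1)[of z] that by (auto simp: V_def)
  have V_U: "V \<subseteq> U" by (auto simp: V_def)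
  have "(\<lambda>z::pt. 0::real) differentiable (at ?z)" by simp
  from diffI[OF zV z(2) \<open>open V\<close> V_U smooth_fh(1) this ab[OF z, THEN conjunct1] e, of "\<lambda>i. X1 i ?z",
      unfolded fX z0, folded D1_def]
  have "dd ff x0 (E1 x0) + dd kk x0 (E1 x0) * a 3 ?z + kk x0 * D1 (a 3) ?z = 0" by simp
  then have eq: "3 * (ff x0)\<^sup>2 + l1 x0 * hh x0 + GG x0 + 2 * ff x0 * (kk x0 * a 3 ?z) + kk x0 *
      (- kk x0 + l1 x0 * b 3 ?z + a 0 ?z * a 3 ?z - a 2 ?z - kk x0 * (a 3 ?z)\<^sup>2) = 0"
    unfolding II[OF z] fh_E[OF x0(1)] kk_E[OF x0(1)] by (simp add: mult_ac)
  have kp: "kk x0 > 0" using kk_pos[OF x0(1)] .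
  note iv = IV[OF z, unfolded fst_conv, OF x0(2)]
  have a0: "a 0 ?z = 0" using I(1)[OF z] iv by simp
  have "kk x0 * a 2 ?z = ff x0 * (kk x0 * a 3 ?z) + kk x0 * P2 x0"
    using III(1)[OF z] by (simp add: algebra_simps)
  also have "\<dots> = - (ff x0)\<^sup>2 + (2 * (ff x0)\<^sup>2 + GG x0 - (kk x0)\<^sup>2) / 2"
    unfolding iv using kp by (simp add: P2_def power2_eq_square)
  finally have a2: "kk x0 * a 2 ?z = - (ff x0)\<^sup>2 + (2 * (ff x0)\<^sup>2 + GG x0 - (kk x0)\<^sup>2) / 2" .
  have "3 * (ff x0)\<^sup>2 + l1 x0 * hh x0 + GG x0 + 2 * ff x0 * (kk x0 * a 3 ?z) - (kk x0)\<^sup>2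
     + l1 x0 * (kk x0 * b 3 ?z) - kk x0 * a 2 ?z - (kk x0 * a 3 ?z)\<^sup>2 = 0"
    using eq unfolding a0 by (simp add: square_simps)
  then show ?thesis
    unfolding iv a2 by (simp add: power2_eq_square field_simps)
qed

end

section \<open>Closed 1-forms and local inverses\<close>

lemma blinfun_of_linear:
  fixes f :: "'a::euclidean_space \<Rightarrow> 'b::real_normed_vector"
  shows "linear f \<Longrightarrow> blinfun_apply (Blinfun f) = f"
  by (simp add: bounded_linear_Blinfun_apply linear_conv_bounded_linear)

text \<open>The primitive is the integral over t in [0, 1] of P at x0 + t (x - x0), applied to x -
  x0. Closedness turns the x-derivative of the integrand in direction h into the t-derivative of t
  P(x0 + t (x - x0))(h), so it integrates to P x h.\<close>

lemma poincare_ball: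
  fixes P :: "('a::euclidean_space, real) form1"
  assumes P: "smooth_form_on (ball x0 r) P"
    and closed: "\<And>x a b. x \<in> ball x0 r \<Longrightarrow> ext_d P x a b = 0"
  shows "\<exists>v. \<forall>x\<in>ball x0 r. (v has_derivative P x) (at x)"
proof -
  let ?B = "ball x0 r"
  have lin: "linear (P x)" if "x \<in> ?B" for x using P that by (auto simp: smooth_form_on_def)
  have sP: "smooth_on ?B (\<lambda>z. P z b)" for b using P by (auto simp: smooth_form_on_def)
  define Q where "Q b h z = dd (\<lambda>y. P y b) z h" for b h z
  have QD: "((\<lambda>y. P y b) has_derivative (\<lambda>h. Q b h z)) (at z)" if "z \<in> ?B" for b z
    unfolding Q_def using smooth_on_has_derivative[OF sP that] by simp
  have Qlin: "linear (\<lambda>h. Q b h z)" if "z \<in> ?B" for b z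
    using has_derivative_linear[OF QD[OF that]] .
  have Qsym: "Q b h z = Q h b z" if "z \<in> ?B" for b h z
    using closed[OF that, of h b] by (simp add: ext_d_def Q_def)
  have exp: "P z u = (\<Sum>b\<in>Basis. (u \<bullet> b) * P z b)" if "z \<in> ?B" for z u
    using lin[OF that] by (subst euclidean_representation[symmetric, of u])
      (simp only: linear_sum linear_cmul real_scaleR_def)
  have inB: "x0 + t *\<^sub>R (x - x0) \<in> ?B" if "x \<in> ?B" "t \<in> cbox 0 1" for x and t :: real
  proof -
    have "norm (t *\<^sub>R (x - x0)) \<le> norm (x - x0)"
      using that(2) mult_right_mono[of t 1 "norm (x - x0)"] by simp
    then show ?thesis using that(1) by (simp add: dist_norm norm_minus_commute)
  qed
  define f where "f x t = (\<Sum>b\<in>Basis. ((x - x0) \<bullet> b) * P (x0 + t *\<^sub>R (x - x0)) b)" for x and t :: real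
  define f' where "f' x t h = (\<Sum>b\<in>Basis. ((x - x0) \<bullet> b) * (t * Q b h (x0 + t *\<^sub>R (x - x0)))
      + (h \<bullet> b) * P (x0 + t *\<^sub>R (x - x0)) b)" for x and t :: real and h
  have f'lin: "linear (f' x t)" if "x \<in> ?B" "t \<in> cbox 0 1" for x t
  proof -
    define z where "z = x0 + t *\<^sub>R (x - x0)"
    have z: "z \<in> ?B" unfolding z_def by (rule inB[OF that])
    show ?thesis
      unfolding f'_def z_def[symmetric]
      by (rule linearI)
         (simp_all add: linear_add[OF Qlin[OF z]] linear_cmul[OF Qlin[OF z]]
           sum.distrib[symmetric] sum_distrib_left inner_add_left algebra_simps)
  qed
  have app: "blinfun_apply (Blinfun (f' x t)) = f' x t" if "x \<in> ?B" "t \<in> cbox 0 1" for x t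
    by (rule blinfun_of_linear[OF f'lin[OF that]])
  have fD: "((\<lambda>x. f x t) has_derivative blinfun_apply (Blinfun (f' x t))) (at x within ?B)"
    if "x \<in> ?B" "t \<in> cbox 0 1" for x t
  proof -
    have "((\<lambda>x. x0 + t *\<^sub>R (x - x0)) has_derivative (\<lambda>h. t *\<^sub>R h)) (at x)"
      by (auto intro!: derivative_eq_intros simp: algebra_simps)
    from has_derivative_compose[OF this QD[OF inB[OF that]]]
    have 1: "((\<lambda>x. P (x0 + t *\<^sub>R (x - x0)) b) has_derivative (\<lambda>h. t * Q b h (x0 + t *\<^sub>R (x - x0)))) (at x)" for b
      by (simp add: linear_cmul[OF Qlin[OF inB[OF that]]])
    have "((\<lambda>x. f x t) has_derivative f' x t) (at x)"
      unfolding f_def f'_def by (auto intro!: derivative_eq_intros 1)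
    then show ?thesis unfolding app[OF that] by (rule has_derivative_at_withinI)
  qed
  have cont: "continuous_on (?B \<times> cbox 0 1) (\<lambda>p. F (x0 + snd p *\<^sub>R (fst p - x0)))"
    if "continuous_on ?B F" for F :: "'a \<Rightarrow> real"
    by (rule continuous_on_compose2[OF that]) (use inB in \<open>auto intro!: continuous_intros\<close>)
  have cP: "continuous_on (?B \<times> cbox 0 1) (\<lambda>p. P (x0 + snd p *\<^sub>R (fst p - x0)) b)" for b
    using cont[OF smooth_on_continuous[OF sP]] .
  have cQ: "continuous_on (?B \<times> cbox 0 1) (\<lambda>p. Q b h (x0 + snd p *\<^sub>R (fst p - x0)))" for b h
    unfolding Q_def using cont[OF smooth_on_continuous[OF smooth_on_frechet[OF sP]]] .
  have cf': "continuous_on (?B \<times> cbox 0 1) (\<lambda>p. f' (fst p) (snd p) h)" for h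
    unfolding f'_def by (intro continuous_intros cP cQ)
  have cBf': "continuous_on (?B \<times> cbox 0 1) (\<lambda>(x, t). Blinfun (f' x t))"
  proof (rule continuous_on_blinfun_componentwise)
    fix i :: 'a
    have "continuous_on (?B \<times> cbox 0 1) (\<lambda>p. blinfun_apply (case p of (x, t) \<Rightarrow> Blinfun (f' x t)) i) \<longleftrightarrow>
      continuous_on (?B \<times> cbox 0 1) (\<lambda>p. f' (fst p) (snd p) i)"
      by (rule continuous_on_cong) (auto simp: app)
    then show "continuous_on (?B \<times> cbox 0 1) (\<lambda>p. blinfun_apply (case p of (x, t) \<Rightarrow> Blinfun (f' x t)) i)"
      using cf' by simp
  qed
  have slice: "continuous_on (cbox 0 1) (\<lambda>t. F (x, t))"
    if "continuous_on (?B \<times> cbox 0 1) F" "x \<in> ?B" for F :: "'a \<times> real \<Rightarrow> 'b::topological_space" and x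
    by (rule continuous_on_compose2[OF that(1)]) (use that(2) in \<open>auto intro!: continuous_intros\<close>)
  have int: "f x integrable_on cbox 0 1" if "x \<in> ?B" for x
  proof (rule integrable_continuous)
    show "continuous_on (cbox 0 1) (f x)"
      unfolding f_def using slice[OF cP that] by (auto intro!: continuous_intros)
  qed
  show ?thesis
  proof (intro exI ballI)
    fix x assume x: "x \<in> ?B"
    have "((\<lambda>x. integral (cbox 0 1) (f x)) has_derivative
        blinfun_apply (integral (cbox 0 1) (\<lambda>t. Blinfun (f' x t)))) (at x within ?B)"
      by (rule leibniz_rule[OF fD int cBf' x convex_ball])
    then have D: "((\<lambda>x. integral (cbox 0 1) (f x)) has_derivative
        blinfun_apply (integral (cbox 0 1) (\<lambda>t. Blinfun (f' x t)))) (at x)"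
      using x by (simp add: at_within_open[OF x open_ball])
    have "blinfun_apply (integral (cbox 0 1) (\<lambda>t. Blinfun (f' x t))) h = P x h" for h
    proof -
      have "(\<lambda>t. Blinfun (f' x t)) integrable_on cbox 0 1"
        by (rule integrable_continuous) (use slice[OF cBf' x] in simp)
      then have "blinfun_apply (integral (cbox 0 1) (\<lambda>t. Blinfun (f' x t))) h
          = integral (cbox 0 1) (\<lambda>t. blinfun_apply (Blinfun (f' x t)) h)"
        using integral_linear[of "\<lambda>t. Blinfun (f' x t)" "cbox 0 1" "\<lambda>F. blinfun_apply F h"]
        by (simp add: o_def blinfun.bounded_linear_left)
      also have "\<dots> = integral (cbox 0 1) (\<lambda>t. f' x t h)"
        by (rule integral_cong) (simp add: app[OF x])
      also have "\<dots> = P x h"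
      proof (rule integral_unique)
        have "((\<lambda>t. t * P (x0 + t *\<^sub>R (x - x0)) h) has_vector_derivative f' x t h) (at t within {0..1})"
          if t: "t \<in> {0..1}" for t
        proof -
          have tc: "t \<in> cbox 0 1" using t by simp
          note z = inB[OF x tc]
          have "((\<lambda>t. x0 + t *\<^sub>R (x - x0)) has_vector_derivative (x - x0)) (at t)"
            by (auto intro!: derivative_eq_intros)
          from has_vector_derivative_compose[OF this QD[OF z]]
          have "((\<lambda>t. P (x0 + t *\<^sub>R (x - x0)) h) has_real_derivative
              Q h (x - x0) (x0 + t *\<^sub>R (x - x0))) (at t)"
            by (simp add: has_real_derivative_iff_has_vector_derivative)
          then have "((\<lambda>t. t * P (x0 + t *\<^sub>R (x - x0)) h) has_real_derivative
              t * Q h (x - x0) (x0 + t *\<^sub>R (x - x0)) + P (x0 + t *\<^sub>R (x - x0)) h) (at t)"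
            by (auto intro!: derivative_eq_intros)
          moreover have "Q h (x - x0) (x0 + t *\<^sub>R (x - x0)) =
              (\<Sum>b\<in>Basis. ((x - x0) \<bullet> b) * Q h b (x0 + t *\<^sub>R (x - x0)))"
            by (subst euclidean_representation[symmetric, of "x - x0"])
               (simp only: linear_sum[OF Qlin[OF z]] linear_cmul[OF Qlin[OF z]] real_scaleR_def)
          moreover have "\<dots> = (\<Sum>b\<in>Basis. ((x - x0) \<bullet> b) * Q b h (x0 + t *\<^sub>R (x - x0)))"
            by (intro sum.cong refl arg_cong2[where f = "(*)"] Qsym[OF z])
          ultimately show ?thesis
            using exp[OF z, of h]
            by (simp add: f'_def sum.distrib sum_distrib_left mult_ac
                has_real_derivative_iff_has_vector_derivative has_vector_derivative_at_within)
        qed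
        from fundamental_theorem_of_calculus[OF _ this]
        show "((\<lambda>t. f' x t h) has_integral P x h) (cbox 0 1)" by simp
      qed
      finally show ?thesis .
    qed
    then have "blinfun_apply (integral (cbox 0 1) (\<lambda>t. Blinfun (f' x t))) = P x" by blast
    with D show "((\<lambda>x. integral (cbox 0 1) (f x)) has_derivative P x) (at x)" by simp
  qed
qed

text \<open>The explicit inverse J of the derivative gives the local inverse G the derivative J o G.
  If G has n orders of differentiability, so has this derivative, and smoothness follows by
  induction from continuity.\<close>

lemma smooth_local_inverse:
  fixes \<psi> :: "'a::euclidean_space \<Rightarrow> 'a"
  assumes U: "open U" "x0 \<in> U" and \<psi>: "smooth_on U \<psi>"
    and lin: "\<And>x. x \<in> U \<Longrightarrow> linear (J x)"
    and J1: "\<And>x h. x \<in> U \<Longrightarrow> dd \<psi> x (J x h) = h"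
    and J2: "\<And>x h. x \<in> U \<Longrightarrow> J x (dd \<psi> x h) = h"
    and Js: "\<And>h. smooth_on U (\<lambda>x. J x h)"
  obtains U' V G where "open U'" "U' \<subseteq> U" "x0 \<in> U'" "open V" "homeomorphism U' V \<psi> G" "smooth_on V G"
proof -
  let ?D = "\<lambda>x. dd \<psi> x"
  have D: "(\<psi> has_derivative ?D x) (at x)" if "x \<in> U" for x
    by (rule smooth_on_has_derivative[OF \<psi> that])
  define \<psi>' where "\<psi>' x = Blinfun (?D x)" for x
  have app: "blinfun_apply (\<psi>' x) = ?D x" if "x \<in> U" for x
    unfolding \<psi>'_def by (rule blinfun_of_linear[OF has_derivative_linear[OF D[OF that]]])
  have Jb: "blinfun_apply (Blinfun (J x0)) = J x0"
    by (rule blinfun_of_linear[OF lin[OF U(2)]])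
  have c: "continuous_on U \<psi>'"
  proof (rule continuous_on_blinfun_componentwise)
    fix i :: 'a
    have "continuous_on U (\<lambda>x. blinfun_apply (\<psi>' x) i) \<longleftrightarrow> continuous_on U (\<lambda>x. ?D x i)"
      by (rule continuous_on_cong) (auto simp: app)
    then show "continuous_on U (\<lambda>x. blinfun_apply (\<psi>' x) i)"
      using smooth_on_continuous[OF smooth_on_frechet[OF \<psi>]] by simp
  qed
  have i: "Blinfun (J x0) o\<^sub>L \<psi>' x0 = id_blinfun"
    by (rule blinfun_eqI) (simp add: app[OF U(2)] Jb J2[OF U(2)])
  have d: "(\<psi> has_derivative blinfun_apply (\<psi>' x)) (at x)" if "x \<in> U" for x
    using D[OF that] app[OF that] by simp
  obtain U' V G g' where G: "open U'" "U' \<subseteq> U" "x0 \<in> U'" "open V" "homeomorphism U' V \<psi> G"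
    "\<And>y. y \<in> V \<Longrightarrow> (G has_derivative g' y) (at y)"
    "\<And>y. y \<in> V \<Longrightarrow> g' y = inv (blinfun_apply (\<psi>' (G y)))"
    using inverse_function_theorem[OF U(1) d c U(2) i] by metis
  have GU: "G y \<in> U" if "y \<in> V" for y using G(2,5) that by (auto simp: homeomorphism_def)
  have g': "g' y = J (G y)" if "y \<in> V" for y
    unfolding G(7)[OF that] app[OF GU[OF that]]
    by (rule inv_equality) (use J1 J2 GU[OF that] in auto)
  have "times_diff_on n V G" for n
  proof (induction n)
    case 0
    then show ?case using G(5) by (simp add: homeomorphism_def)
  next
    case (Suc n)
    show ?case
    proof (rule times_diff_on_SucI[OF G(4)])
      show "(G has_derivative J (G y)) (at y)" if "y \<in> V" for y
        using G(6)[OF that] g'[OF that] by simp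
      show "times_diff_on n V (\<lambda>y. J (G y) v)" for v
        by (rule times_diff_on_compose[OF G(4) U(1) _ _ Suc, where f = "\<lambda>x. J x v"])
           (use GU Js[of v] in \<open>auto simp: smooth_on_def\<close>)
    qed
  qed
  then have "smooth_on V G" by (simp add: smooth_on_def)
  with G(1-5) show ?thesis by (rule that)
qed

section \<open>Normal coordinates\<close>

text \<open>The bounds on the first coordinate keep its sine and cosine nonzero, so
  \<open>normal_metric\<close> is nondegenerate on V.\<close>

definition normal_chart ::
  "real \<Rightarrow> metric \<Rightarrow> (real^2) set \<Rightarrow> (real^2) set \<Rightarrow> (real^2 \<Rightarrow> real^2) \<Rightarrow> (real^2 \<Rightarrow> real^2) \<Rightarrow> bool" where
  "normal_chart r g U V \<psi> H \<longleftrightarrow> open U \<and> open V \<and> homeomorphism U V \<psi> H \<and> smooth_on U \<psi> \<and> smooth_on V H \<and>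
     (\<forall>y\<in>V. 0 < y $ 1 \<and> y $ 1 < pi / 2) \<and>
     (\<forall>x\<in>U. \<forall>a b. r * g x a b = normal_metric (\<psi> x) (dd \<psi> x a) (dd \<psi> x b))"

text \<open>The derivative of w^2 + w^6 N along a frame vector, with f standing for
  \<open>ff\<close> or \<open>hh\<close> alike: -w f is the derivative of w and the last bracket
  that of N.\<close>

lemma first_integral_identity:
  fixes w :: real
  assumes "w \<noteq> 0"
  shows "2 * w * (- w * f) + (6 * w ^ 5 * (- w * f) * N + w ^ 6 * (6 * f * N + 2 * f / w ^ 4)) = 0"
proof -
  have "X * Y * (Z / X) = Z * Y" if "X \<noteq> 0" for X Y Z :: real using that by simp
  from this[of "w ^ 4" "w\<^sup>2" "2 * f"] assms
  have "w ^ 4 * w\<^sup>2 * (2 * f / w ^ 4) = 2 * f * w\<^sup>2" by (metis power_not_zero)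
  moreover have "w ^ 6 = w ^ 4 * w\<^sup>2" by algebra
  ultimately have "w ^ 6 * (2 * f / w ^ 4) = 2 * f * w\<^sup>2" by metis
  then show ?thesis unfolding distrib_left by algebra
qed

text \<open>In the same way, the derivative of c w^3 N, the denominator of dv, along a frame
  vector.\<close>

lemma dual_factor_identity:
  fixes w :: real
  assumes "w \<noteq> 0"
  shows "c * (3 * w\<^sup>2 * (- w * f) * N + w ^ 3 * (6 * f * N + 2 * f / w ^ 4)) =
     3 * (c * (w ^ 3 * N)) * f + 2 * c * f / w"
proof -
  have "w ^ 4 = w ^ 3 * w" by algebra
  then have "w ^ 3 * (2 * f / w ^ 4) = 2 * f / w" using assms by simp
  then have "c * (w ^ 3 * (2 * f / w ^ 4)) = 2 * c * f / w" by simp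
  then show ?thesis unfolding distrib_left by algebra
qed

section \<open>The first integral and the coordinate functions u, v\<close>

context killing_surface
begin

definition NN :: "real^2 \<Rightarrow> real" where "NN x = (ff x)\<^sup>2 - (hh x)\<^sup>2"

lemma NN_pos: "x \<in> S \<Longrightarrow> 0 < NN x"
  using spacelike by (simp add: NN_def)

lemma smooth_NN: "smooth_on S NN"
  unfolding NN_def[abs_def] by (intro smooth_intros smooth_fh open_S)

lemma expand_linear: assumes "x \<in> S" "linear L"
  shows "L v = g x v (E1 x) * L (E1 x) - g x v (E2 x) * (L (E2 x) :: real)"
  using expand[OF assms(1), of v] linear_diff[OF assms(2)] linear_cmul[OF assms(2)]
  by (metis real_scaleR_def)

lemma dd_linear: "smooth_on S F \<Longrightarrow> x \<in> S \<Longrightarrow> linear (dd F x)"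
  using has_derivative_linear[OF diff_at] .

lemma NN_E: assumes "x \<in> S" and G: "GG x = (kk x)\<^sup>2"
  shows "dd NN x (E1 x) = 6 * ff x * NN x + 2 * ff x / w x ^ 4" (is ?t1)
    "dd NN x (E2 x) = 6 * hh x * NN x + 2 * hh x / w x ^ 4" (is ?t2)
proof -
  have D: "dd NN x = (\<lambda>v. 2 * ff x * dd ff x v - 2 * hh x * dd hh x v)"
    unfolding NN_def[abs_def]
    by (rule frechet_eq)
       (auto intro!: derivative_eq_intros diff_at[OF smooth_fh(1) assms(1)] diff_at[OF smooth_fh(2) assms(1)]
         simp: fun_eq_iff)
  have kk: "GG x = 1 / w x ^ 4" using G kk_w[OF assms(1)] by (simp add: power_divide)
  show ?t1
    ?t2
    unfolding D fh_E[OF assms(1)] kk NN_def by (simp_all add: square_simps)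
qed

lemma first_integral:
  assumes S: "S = ball x0 \<rho>" and G: "\<And>x. x \<in> S \<Longrightarrow> GG x = (kk x)\<^sup>2" and x: "x \<in> S" "y \<in> S"
  shows "(w x)\<^sup>2 + w x ^ 6 * NN x = (w y)\<^sup>2 + w y ^ 6 * NN y"
proof -
  let ?C = "\<lambda>x. (w x)\<^sup>2 + w x ^ 6 * NN x"
  have "(?C has_derivative (\<lambda>v. 0)) (at x within S)" if xS: "x \<in> S" for x
  proof -
    let ?D = "\<lambda>v. 2 * w x * dd w x v + (6 * w x ^ 5 * dd w x v * NN x + w x ^ 6 * dd NN x v)"
    have d: "(?C has_derivative ?D) (at x)"
      by (auto intro!: derivative_eq_intros diff_at[OF smooth_w xS] diff_at[OF smooth_NN xS]
          simp: fun_eq_iff algebra_simps)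
    have z: "?D (E1 x) = 0" "?D (E2 x) = 0"
      unfolding w_E[OF xS] NN_E[OF xS G[OF xS]] using w_pos[OF xS]
      by (intro first_integral_identity, simp)+
    have "?D v = 0" for v
      using expand_linear[OF xS has_derivative_linear[OF d], of v] unfolding z by simp
    then have "?D = (\<lambda>v. 0)" by (rule ext)
    with d show ?thesis by (simp add: has_derivative_at_withinI)
  qed
  then have "\<exists>c. \<forall>x\<in>S. ?C x = c"
    using has_derivative_zero_constant[of S ?C] by (simp add: S)
  then obtain c where "\<forall>x\<in>S. ?C x = c" ..
  from bspec[OF this x(1)] bspec[OF this x(2)] show ?thesis by (rule trans[OF _ sym])
qed

text \<open>With \<open>w = c cos u\<close> the first integral \<open>w\<^sup>2 + w\<^sup>6 N = c\<^sup>2\<close> gives \<open>c sin u = w\<^sup>3 \<surd>N\<close>, and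
  \<open>dv\<close> is a multiple of the Hodge dual of \<open>dw\<close>.\<close>

lemma normal_coordinates:
  assumes S: "S = ball x0 \<rho>" "0 < \<rho>" and G: "\<And>x. x \<in> S \<Longrightarrow> GG x = (kk x)\<^sup>2"
  shows "\<exists>r>0. \<exists>U V \<psi> H. normal_chart r g U V \<psi> H \<and> U \<subseteq> S \<and> x0 \<in> U"
proof -
  have x0S: "x0 \<in> S" using S by simp
  define c where "c = sqrt ((w x0)\<^sup>2 + w x0 ^ 6 * NN x0)"
  have pos: "0 < (w x0)\<^sup>2 + w x0 ^ 6 * NN x0"
    using w_pos[OF x0S] NN_pos[OF x0S] by (intro add_pos_pos) auto
  have c: "0 < c" using pos by (simp add: c_def)
  have c2: "c\<^sup>2 = (w x)\<^sup>2 + w x ^ 6 * NN x" if "x \<in> S" for x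
    using first_integral[OF S(1) G that x0S] pos by (simp add: c_def)
  have wc: "w x < c" if "x \<in> S" for x
  proof -
    have "(w x)\<^sup>2 < c\<^sup>2" using c2[OF that] w_pos[OF that] NN_pos[OF that] by simp
    then show ?thesis using c power_less_imp_less_base[of "w x" 2 c] by simp
  qed
  define n where "n x = sqrt (NN x)" for x
  have n: "0 < n x" "n x * n x = NN x" if "x \<in> S" for x using NN_pos[OF that] by (simp_all add: n_def)
  have sn: "smooth_on S n" unfolding n_def[abs_def]
    by (rule smooth_on_sqrt[OF open_S smooth_NN NN_pos])
  define u where "u x = arccos (w x / c)" for x
  have q: "- 1 < w x / c" "w x / c < 1" "0 < w x / c" if "x \<in> S" for x
    using w_pos[OF that] wc[OF that] c by (auto simp: field_simps intro: less_trans[of _ 0])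
  have cosu: "cos (u x) = w x / c" if "x \<in> S" for x
    unfolding u_def by (rule cos_arccos) (use q[OF that] in auto)
  have ub: "0 < u x" "u x < pi / 2" if "x \<in> S" for x
  proof -
    show "0 < u x" unfolding u_def using arccos_lt_bounded[of "w x / c"] q[OF that] by auto
    have "arccos (w x / c) < arccos 0" by (rule arccos_less_mono[THEN iffD2]) (use q[OF that] in auto)
    then show "u x < pi / 2" by (simp add: u_def)
  qed
  have sq: "1 - (w x / c)\<^sup>2 = (w x ^ 3 * n x / c)\<^sup>2" if "x \<in> S" for x
  proof -
    have "c\<^sup>2 - (w x)\<^sup>2 = (w x ^ 3 * n x)\<^sup>2"
      using c2[OF that] n[OF that] by (simp add: power_mult_distrib power2_eq_square eval_nat_numeral)
    moreover have "1 - (w x / c)\<^sup>2 = (c\<^sup>2 - (w x)\<^sup>2) / c\<^sup>2"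
      using c by (simp add: power_divide diff_divide_distrib)
    ultimately show ?thesis by (simp add: power_divide)
  qed
  have rt: "sqrt (1 - (w x / c)\<^sup>2) = w x ^ 3 * n x / c" if "x \<in> S" for x
    unfolding sq[OF that] using w_pos[OF that] n[OF that] c by simp
  have sinu: "sin (u x) = w x ^ 3 * n x / c" if "x \<in> S" for x
    unfolding u_def using sin_arccos[of "w x / c"] q[OF that] rt[OF that] by simp
  have uD: "(u has_derivative (\<lambda>v. (- 1 / (w x ^ 3 * n x)) * dd w x v)) (at x)" if "x \<in> S" for x
  proof -
    have "(arccos has_derivative (\<lambda>h. inverse (- sqrt (1 - (w x / c)\<^sup>2)) * h)) (at (w x / c))"
      using DERIV_arccos[OF q(1,2)[OF that]] by (simp only: has_field_derivative_def)
    moreover have "((\<lambda>x. w x / c) has_derivative (\<lambda>v. dd w x v / c)) (at x)"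
      using c by (auto intro!: derivative_eq_intros diff_at[OF smooth_w that])
    ultimately have "(u has_derivative (\<lambda>v. inverse (- sqrt (1 - (w x / c)\<^sup>2)) * (dd w x v / c))) (at x)"
      unfolding u_def[abs_def] using has_derivative_compose by blast
    then show ?thesis unfolding rt[OF that]
      using c by (simp add: field_simps)
  qed
  have su: "smooth_on S u"
    by (rule smooth_onI[OF open_S uD], assumption)
       (intro smooth_intros smooth_on_frechet smooth_w sn open_S; use w_pos n in force)
  \<comment> \<open>From dw = -w (f eta^1 + h eta^2) and c sin u = w^3 n one gets du = (f eta^1 + h
    eta^2) / A. The denominator of dv = (h eta^1 + f eta^2) / B contains c so that cos^4 u / A^2 and
    sin^2 u / B^2 both equal 1 / (c^4 N).\<close>
  define A where "A x = (w x)\<^sup>2 * n x" for x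
  define B where "B x = c * (w x ^ 3 * NN x)" for x
  have AB: "0 < A x" "0 < B x" if "x \<in> S" for x
    using w_pos[OF that] n[OF that] NN_pos[OF that] c by (simp_all add: A_def B_def)
  have sAB: "smooth_on S A" "smooth_on S B"
    unfolding A_def[abs_def] B_def[abs_def] by (intro smooth_intros smooth_w sn smooth_NN open_S)+
  have u_E: "dd u x (E1 x) = ff x / A x" "dd u x (E2 x) = hh x / A x" if "x \<in> S" for x
    unfolding frechet_eq[OF uD[OF that]] w_E[OF that] A_def
    using w_pos[OF that] by (simp_all add: field_simps eval_nat_numeral)
  define P where "P x v = g x v (E1 x) * (hh x / B x) - g x v (E2 x) * (ff x / B x)" for x v
  have P_E: "P x (E1 x) = hh x / B x" "P x (E2 x) = ff x / B x" if "x \<in> S" for x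
    using g_E[OF that] by (simp_all add: P_def)
  have Plin: "linear (P x)" if "x \<in> S" for x
    unfolding P_def[abs_def]
    by (rule linearI)
       (simp_all add: bilinear_ladd[OF bil[OF that]] bilinear_lmul[OF bil[OF that]]
         add_divide_distrib algebra_simps)
  have sP: "smooth_form_on S P"
    unfolding smooth_form_on_def
  proof (intro conjI ballI allI)
    show "linear (P x)" if "x \<in> S" for x by (rule Plin[OF that])
    have lg: "smooth_on S (\<lambda>x. g x v (E x))" if "smooth_on S E" for v E
      by (rule smooth_on_metric[OF open_S _ open_D lor smooth_on_id smooth_on_const that]) (use S_D in auto)
    show "smooth_on S (\<lambda>x. P x v)" for v
      unfolding P_def by (intro smooth_intros lg smooth_E smooth_fh sAB open_S; use AB in force)
  qed
  \<comment> \<open>By bilinearity the pair (E1, E2) suffices. The derivative of 1 / B cancels the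
    terms 3 N + 2 \<open>GG\<close> of E1 f - E2 h, and the remaining terms in \<open>l1\<close>,
    \<open>l2\<close> cancel against the bracket of the framing.\<close>
  have closed: "ext_d P x a b = 0" if xS: "x \<in> S" for x a b
  proof -
    have BE: "dd B x (E1 x) = 3 * B x * ff x + 2 * c * ff x / w x"
      "dd B x (E2 x) = 3 * B x * hh x + 2 * c * hh x / w x"
    proof -
      have D: "dd B x = (\<lambda>v. c * (3 * (w x)\<^sup>2 * dd w x v * NN x + w x ^ 3 * dd NN x v))"
        unfolding B_def[abs_def]
        by (rule frechet_eq)
           (auto intro!: derivative_eq_intros diff_at[OF smooth_w xS] diff_at[OF smooth_NN xS]
             simp: fun_eq_iff algebra_simps)
      show "dd B x (E1 x) = 3 * B x * ff x + 2 * c * ff x / w x"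
        "dd B x (E2 x) = 3 * B x * hh x + 2 * c * hh x / w x"
        unfolding D w_E[OF xS] NN_E[OF xS G[OF xS]] B_def
        using w_pos[OF xS] by (intro dual_factor_identity, simp)+
    qed
    have quot: "dd (\<lambda>x. F x / B x) x = (\<lambda>v. (dd F x v * B x - F x * dd B x v) / (B x * B x))"
      if "smooth_on S F" for F
      by (rule frechet_eq)
         (use AB(2)[OF xS] in \<open>auto intro!: derivative_eq_intros diff_at[OF that xS] diff_at[OF sAB(2) xS]
            simp: fun_eq_iff field_simps\<close>)
    have kk: "GG x = 1 / w x ^ 4" using G[OF xS] kk_w[OF xS] by (simp add: power_divide)
    have id: "dd (\<lambda>x. x) y = (\<lambda>v. v)" for y :: "real^2"
      by (rule frechet_eq) simp
    have c1: "dd (\<lambda>y. P y (E1 y)) x = dd (\<lambda>x. hh x / B x) x" "dd (\<lambda>y. P y (E2 y)) x = dd (\<lambda>x. ff x / B x) x"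
      by (rule dd_cong_open[OF open_S xS P_E(1)] dd_cong_open[OF open_S xS P_E(2)];
          assumption)+
    have "ext_d P x (E1 x) (E2 x) = dd (\<lambda>x. ff x / B x) x (E1 x) - dd (\<lambda>x. hh x / B x) x (E2 x)
       - P x (l1 x *\<^sub>R E1 x - l2 x *\<^sub>R E2 x)"
      using ext_d_pullback(1)[OF open_S xS smooth_on_id _ open_S sP E_diff[OF xS]]
      by (simp add: id bracket[OF xS] c1)
    also have "P x (l1 x *\<^sub>R E1 x - l2 x *\<^sub>R E2 x) = l1 x * (hh x / B x) - l2 x * (ff x / B x)"
      by (simp add: linear_diff[OF Plin[OF xS]] linear_cmul[OF Plin[OF xS]] P_E[OF xS])
    also have "dd (\<lambda>x. ff x / B x) x (E1 x) - dd (\<lambda>x. hh x / B x) x (E2 x)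
        - (l1 x * (hh x / B x) - l2 x * (ff x / B x)) = 0"
    proof -
      have "dd (\<lambda>x. ff x / B x) x (E1 x) - dd (\<lambda>x. hh x / B x) x (E2 x) =
         ((l1 x * hh x - l2 x * ff x + 2 / w x ^ 4) * B x - 2 * c * NN x / w x) / (B x * B x)"
        unfolding quot[OF smooth_fh(1)] quot[OF smooth_fh(2)] BE fh_E[OF xS] kk
        unfolding diff_divide_distrib[symmetric]
        by (rule arg_cong[where f = "\<lambda>t. t / (B x * B x)"])
           (simp add: NN_def square_simps add_divide_distrib diff_divide_distrib)
      also have "2 * c * NN x / w x = 2 / w x ^ 4 * B x"
        using w_pos[OF xS] by (simp add: B_def field_simps eval_nat_numeral)
      also have "((l1 x * hh x - l2 x * ff x + 2 / w x ^ 4) * B x - 2 / w x ^ 4 * B x) / (B x * B x)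
          = (l1 x * hh x - l2 x * ff x) / B x"
        using AB(2)[OF xS] by (simp add: field_simps)
      finally show ?thesis by (simp add: diff_divide_distrib)
    qed
    finally have E12: "ext_d P x (E1 x) (E2 x) = 0" .
    note lr = ext_d_linear_right[OF open_S xS sP]
    have E12': "ext_d P x (E2 x) (E1 x) = 0" using E12 ext_d_antisym[of P x "E2 x" "E1 x"] by simp
    have diag: "ext_d P x e e = 0" for e by (simp add: ext_d_def)
    have e1: "ext_d P x (E1 x) b = 0" and e2: "ext_d P x (E2 x) b = 0" for b
      using lr[of _ "g x b (E1 x)" "E1 x" "- g x b (E2 x)" "E2 x"] expand[OF xS, of b] E12 E12' diag
      by simp_all
    have "ext_d P x b a = 0"
      using lr[of b "g x a (E1 x)" "E1 x" "- g x a (E2 x)" "E2 x"] expand[OF xS, of a] e1[of b] e2[of b]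
        ext_d_antisym[of P x b "E1 x"] ext_d_antisym[of P x b "E2 x"] by simp
    then show ?thesis using ext_d_antisym[of P x a b] by simp
  qed
  obtain v where vD: "\<And>x. x \<in> S \<Longrightarrow> (v has_derivative P x) (at x)"
    using poincare_ball[of x0 \<rho> P] sP closed unfolding S(1) by blast
  have sv: "smooth_on S v"
    by (rule smooth_onI[OF open_S vD], assumption) (use sP in \<open>auto simp: smooth_form_on_def\<close>)
  define \<psi> :: "real^2 \<Rightarrow> real^2" where "\<psi> x = u x *\<^sub>R axis 1 1 + v x *\<^sub>R axis 2 1" for x
  have s\<psi>: "smooth_on S \<psi>" unfolding \<psi>_def[abs_def] by (intro smooth_intros su sv open_S)
  have D\<psi>: "dd \<psi> x = (\<lambda>h. dd u x h *\<^sub>R axis 1 1 + P x h *\<^sub>R axis 2 1)" if "x \<in> S" for x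
    unfolding \<psi>_def[abs_def]
    by (rule frechet_eq) (auto intro!: derivative_eq_intros diff_at[OF su that] vD[OF that])
  have nth: "(s *\<^sub>R axis 1 1 + t *\<^sub>R axis 2 1 :: real^2) $ 1 = s" "(s *\<^sub>R axis 1 1 + t *\<^sub>R axis 2 1 :: real^2) $ 2 = t"
    for s t by (simp_all add: axis_def)
  have du: "dd u x h = (g x h (E1 x) * ff x - g x h (E2 x) * hh x) / A x" if "x \<in> S" for x h
    using expand_linear[OF that dd_linear[OF su that], of h] u_E[OF that]
    by (simp add: diff_divide_distrib)
  have dv: "P x h = (g x h (E1 x) * hh x - g x h (E2 x) * ff x) / B x" for x h
    by (simp add: P_def diff_divide_distrib)
  \<comment> \<open>Cramer's rule for f s + h t = A du, h s + f t = B dv, whose determinant is f^2 -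
    h^2 = N.\<close>
  define J where "J x h = ((ff x * (A x * h $ 1) - hh x * (B x * h $ 2)) / NN x) *\<^sub>R E1 x
      + ((ff x * (B x * h $ 2) - hh x * (A x * h $ 1)) / NN x) *\<^sub>R E2 x" for x and h :: "real^2"
  have gJ: "g x (J x h) (E1 x) = (ff x * (A x * h $ 1) - hh x * (B x * h $ 2)) / NN x"
    "g x (J x h) (E2 x) = - ((ff x * (B x * h $ 2) - hh x * (A x * h $ 1)) / NN x)" if "x \<in> S" for x h
    using g_E[OF that]
    by (simp_all add: J_def bilinear_ladd[OF bil[OF that]] bilinear_lmul[OF bil[OF that]])
  obtain U V H where UV: "open U" "U \<subseteq> S" "x0 \<in> U" "open V" "homeomorphism U V \<psi> H" "smooth_on V H"
  proof (rule smooth_local_inverse[OF open_S x0S s\<psi>, of J])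
    show "linear (J x)" if "x \<in> S" for x
      unfolding J_def by (rule linearI) (simp_all add: algebra_simps add_divide_distrib diff_divide_distrib)
    show "smooth_on S (\<lambda>x. J x h)" for h
      unfolding J_def by (intro smooth_intros smooth_fh sAB smooth_NN smooth_E open_S; use NN_pos in force)
    show "dd \<psi> x (J x h) = h" if xS: "x \<in> S" for x h
    proof -
      have "dd u x (J x h) = h $ 1" "P x (J x h) = h $ 2"
        unfolding du[OF xS] dv gJ[OF xS]
        using AB[OF xS] NN_pos[OF xS] by (simp_all add: field_simps) (simp_all add: NN_def square_simps)
      then show ?thesis unfolding D\<psi>[OF xS] by (simp add: vec_eq_iff forall_2 axis_def)
    qed
    show "J x (dd \<psi> x h) = h" if xS: "x \<in> S" for x h
    proof -
      have AP: "A x * dd u x h = g x h (E1 x) * ff x - g x h (E2 x) * hh x"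
        "B x * P x h = g x h (E1 x) * hh x - g x h (E2 x) * ff x"
        unfolding du[OF xS] dv using AB[OF xS] by simp_all
      have co: "ff x * (A x * dd u x h) - hh x * (B x * P x h) = g x h (E1 x) * NN x"
        "ff x * (B x * P x h) - hh x * (A x * dd u x h) = (- g x h (E2 x)) * NN x"
        unfolding AP by (simp_all add: NN_def square_simps)
      have "J x (dd \<psi> x h) = g x h (E1 x) *\<^sub>R E1 x - g x h (E2 x) *\<^sub>R E2 x"
        unfolding J_def D\<psi>[OF xS] nth co using NN_pos[OF xS] by simp
      then show ?thesis using expand[OF xS, of h] by simp
    qed
  qed
  \<comment> \<open>After extracting the common factor 1 / (c^4 N), the identity (f s + h t)^2 - (h
    s + f t)^2 = N (s^2 - t^2), polarised, recovers the metric.\<close>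
  have met: "(1 / c ^ 4) * g x a b = normal_metric (\<psi> x) (dd \<psi> x a) (dd \<psi> x b)"
    if xS: "x \<in> S" for x a b
  proof -
    note b = bil[OF xS]
    define a1 a2 b1 b2 where "a1 = g x a (E1 x)" "a2 = g x a (E2 x)" "b1 = g x b (E1 x)" "b2 = g x b (E2 x)"
    have "g x a b = g x (a1 *\<^sub>R E1 x - a2 *\<^sub>R E2 x) (b1 *\<^sub>R E1 x - b2 *\<^sub>R E2 x)"
      using expand[OF xS, of a] expand[OF xS, of b] unfolding a1_a2_b1_b2_def by simp
    also have "\<dots> = a1 * b1 - a2 * b2"
      by (simp add: bilinear_lsub[OF b] bilinear_rsub[OF b] bilinear_lmul[OF b] bilinear_rmul[OF b] g_E[OF xS])
    finally have gab: "g x a b = a1 * b1 - a2 * b2" .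
    have \<psi>1: "\<psi> x $ 1 = u x" by (simp add: \<psi>_def axis_def)
    have "normal_metric (\<psi> x) (dd \<psi> x a) (dd \<psi> x b) =
       (w x / c) ^ 4 * ((a1 * ff x - a2 * hh x) / A x * ((b1 * ff x - b2 * hh x) / A x)) -
       (w x ^ 3 * n x / c)\<^sup>2 * ((a1 * hh x - a2 * ff x) / B x * ((b1 * hh x - b2 * ff x) / B x))"
      unfolding normal_metric_def \<psi>1 cosu[OF xS] sinu[OF xS] D\<psi>[OF xS] nth du[OF xS] dv a1_a2_b1_b2_def ..
    also have "\<dots> = (w x / c) ^ 4 / (A x)\<^sup>2 * ((a1 * ff x - a2 * hh x) * (b1 * ff x - b2 * hh x)) -
       (w x ^ 3 * n x / c)\<^sup>2 / (B x)\<^sup>2 * ((a1 * hh x - a2 * ff x) * (b1 * hh x - b2 * ff x))"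
      by (simp add: power2_eq_square)
    also have "(w x / c) ^ 4 / (A x)\<^sup>2 = 1 / (c ^ 4 * NN x)"
      using w_pos[OF xS] n[OF xS] c
      by (simp add: A_def power_mult_distrib power_divide n(2)[symmetric] power2_eq_square eval_nat_numeral)
    also have "(w x ^ 3 * n x / c)\<^sup>2 / (B x)\<^sup>2 = 1 / (c ^ 4 * NN x)"
      using w_pos[OF xS] n[OF xS] c
      by (simp add: B_def power_mult_distrib power_divide n(2)[symmetric] power2_eq_square eval_nat_numeral)
    also have "1 / (c ^ 4 * NN x) * ((a1 * ff x - a2 * hh x) * (b1 * ff x - b2 * hh x)) -
        1 / (c ^ 4 * NN x) * ((a1 * hh x - a2 * ff x) * (b1 * hh x - b2 * ff x)) =
        1 / (c ^ 4 * NN x) * (NN x * (a1 * b1 - a2 * b2))"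
      unfolding right_diff_distrib[symmetric] by (simp add: NN_def square_simps)
    also have "\<dots> = (1 / c ^ 4) * (a1 * b1 - a2 * b2)"
      using NN_pos[OF xS] by simp
    finally show ?thesis unfolding gab by simp
  qed
  have "0 < y $ 1 \<and> y $ 1 < pi / 2" if y: "y \<in> V" for y
  proof -
    obtain x where "x \<in> U" "y = \<psi> x" using UV(5) y by (auto simp: homeomorphism_def)
    then show ?thesis using ub UV(2) by (auto simp: \<psi>_def axis_def)
  qed
  then have "normal_chart (1 / c ^ 4) g U V \<psi> H"
    unfolding normal_chart_def using UV met smooth_on_subset[OF s\<psi> UV(2)] by blast
  then show ?thesis
    using c UV(2,3) by (intro exI[of _ "1 / c ^ 4"]) (auto simp del: of_nat_power)
qed

end

section \<open>Curvature of the normal form\<close>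

lemma tangent_space_const:
  fixes \<phi> :: "'a::real_normed_vector \<Rightarrow> real"
  assumes "(\<phi> has_derivative \<phi>') (at z)" "\<And>y. y \<in> N \<Longrightarrow> \<phi> y = c" "v \<in> tangent_space N z"
  shows "\<phi>' v = 0"
proof -
  obtain \<gamma> :: "real \<Rightarrow> 'a" where \<gamma>: "\<gamma> 0 = z" "\<And>t. \<gamma> t \<in> N" "(\<gamma> has_vector_derivative v) (at 0)"
    using assms(3) unfolding tangent_space_def by blast
  have "((\<lambda>t. \<phi> (\<gamma> t)) has_vector_derivative \<phi>' v) (at 0)"
    by (rule has_vector_derivative_compose[OF \<gamma>(3)]) (simp add: \<gamma>(1) assms(1))
  then have "((\<lambda>t::real. c) has_vector_derivative \<phi>' v) (at 0)"
    using assms(2)[OF \<gamma>(2)] by simp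
  from vector_derivative_unique_at[OF this has_vector_derivative_const] show ?thesis .
qed

text \<open>In the orthonormal coframe \<open>cos\<^sup>2 u du\<close>, \<open>sin u dv\<close> a frame is a Lorentz matrix
  with rows \<open>(X, Y)\<close>, \<open>(Z, W)\<close>.\<close>

lemma lorentz_matrix:
  fixes X Y Z W :: real
  assumes "X * X - Y * Y = 1" "Z * Z - W * W = -1" "X * Z = Y * W"
  defines "e \<equiv> X * W - Y * Z"
  shows "Z = e * Y" "W = e * X" "e * e = 1"
proof -
  show Z: "Z = e * Y" using assms by algebra
  show W: "W = e * X" using assms by algebra
  show "e * e = 1" using assms(1,2) unfolding Z W by algebra
qed

text \<open>The tangent spaces of the Lorentz group O(1,1) are lines: a variation of the frame is a
  boost with rate t. The sign e is the determinant and covers frames of either orientation.\<close>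

lemma lorentz_matrix_tangent:
  fixes X Y Z W :: real
  assumes "X * X - Y * Y = 1" "Z = e * Y" "W = e * X" "e * e = 1"
    and d: "X * dX = Y * dY" "Z * dZ = W * dW" "dX * Z + X * dZ = dY * W + Y * dW"
  defines "t \<equiv> X * dY - Y * dX"
  shows "dX = t * Y" "dY = t * X" "dZ = e * t * X" "dW = e * t * Y"
proof -
  show 1: "dX = t * Y" "dY = t * X" using assms(1) d(1) unfolding t_def by algebra+
  have yz: "Y * dZ = X * dW" using d(2) assms(2-4) by algebra
  have "X * dZ - Y * dW = e * t" using d(3) assms(1-3) unfolding 1 by algebra
  then show "dZ = e * t * X" "dW = e * t * Y" using yz assms(1) by algebra+
qed

text \<open>The three structure equations written out in coordinates, with C = cos u, S = sin u,
  frame components a, b and c, d, and tangent vectors v, w. In the Lorentz matrix picture only the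
  boost rates t and s survive, and the connection form becomes the boost rate times e plus (e / cos
  u) dv.\<close>

lemma normal_structure_identities:
  fixes C S a b c d va vb vc vd v1 v2 wa wb wc wd w1 w2 :: real
  assumes CS: "C \<noteq> 0" "S \<noteq> 0"
    and o: "C ^ 4 * (a * a) - S\<^sup>2 * (b * b) = 1" "C ^ 4 * (c * c) - S\<^sup>2 * (d * d) = -1"
      "C ^ 4 * (a * c) - S\<^sup>2 * (b * d) = 0"
    and v: "C ^ 4 * (2 * a * va) - 4 * C ^ 3 * S * v1 * (a * a) - S\<^sup>2 * (2 * b * vb) - 2 * S * C * v1 * (b * b) = 0"
      "C ^ 4 * (2 * c * vc) - 4 * C ^ 3 * S * v1 * (c * c) - S\<^sup>2 * (2 * d * vd) - 2 * S * C * v1 * (d * d) = 0"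
      "C ^ 4 * (a * vc + va * c) - 4 * C ^ 3 * S * v1 * (a * c) - S\<^sup>2 * (b * vd + vb * d) - 2 * S * C * v1 * (b * d) = 0"
    and w: "C ^ 4 * (2 * a * wa) - 4 * C ^ 3 * S * w1 * (a * a) - S\<^sup>2 * (2 * b * wb) - 2 * S * C * w1 * (b * b) = 0"
      "C ^ 4 * (2 * c * wc) - 4 * C ^ 3 * S * w1 * (c * c) - S\<^sup>2 * (2 * d * wd) - 2 * S * C * w1 * (d * d) = 0"
      "C ^ 4 * (a * wc + wa * c) - 4 * C ^ 3 * S * w1 * (a * c) - S\<^sup>2 * (b * wd + wb * d) - 2 * S * C * w1 * (b * d) = 0"
  defines "\<kappa>v \<equiv> C ^ 4 * a * vc - 2 * S * C ^ 3 * a * c * v1 - S\<^sup>2 * b * vd - S * C * b * d * v1 + S * C * (a * d - b * c) * v2"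
    and "\<kappa>w \<equiv> C ^ 4 * a * wc - 2 * S * C ^ 3 * a * c * w1 - S\<^sup>2 * b * wd - S * C * b * d * w1 + S * C * (a * d - b * c) * w2"
  shows "C ^ 4 * (w1 * va - v1 * wa) - S\<^sup>2 * (w2 * vb - v2 * wb) - 2 * S * C * b * (v1 * w2 - w1 * v2) =
      \<kappa>v * (C ^ 4 * (w1 * c) - S\<^sup>2 * (w2 * d)) - \<kappa>w * (C ^ 4 * (v1 * c) - S\<^sup>2 * (v2 * d))" (is ?t1)
    "C ^ 4 * (w1 * vc - v1 * wc) - S\<^sup>2 * (w2 * vd - v2 * wd) - 2 * S * C * d * (v1 * w2 - w1 * v2) =
      \<kappa>v * (C ^ 4 * (w1 * a) - S\<^sup>2 * (w2 * b)) - \<kappa>w * (C ^ 4 * (v1 * a) - S\<^sup>2 * (v2 * b))" (is ?t2)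
    "C ^ 4 * (va * wc - wa * vc) - S\<^sup>2 * (vb * wd - wb * vd) - 4 * C ^ 3 * S * a * (v1 * wc - w1 * vc)
      - 2 * S * C ^ 3 * ((va * c + a * vc) * w1 - (wa * c + a * wc) * v1) - 2 * S * C * b * (v1 * wd - w1 * vd)
      - S * C * ((vb * d + b * vd) * w1 - (wb * d + b * wd) * v1)
      + (C\<^sup>2 - S\<^sup>2) * (a * d - b * c) * (v1 * w2 - w1 * v2)
      + S * C * ((va * d + a * vd - vb * c - b * vc) * w2 - (wa * d + a * wd - wb * c - b * wc) * v2)
      = S\<^sup>2 * (a * d - b * c) * (v1 * w2 - w1 * v2)" (is ?t3)
proof -
  define X Y Z W where "X = C\<^sup>2 * a" "Y = S * b" "Z = C\<^sup>2 * c" "W = S * d"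
  note XYZW = this
  define e where "e = X * W - Y * Z"
  have o': "X * X - Y * Y = 1" "Z * Z - W * W = -1" "X * Z = Y * W"
    using o unfolding XYZW by algebra+
  note lm = lorentz_matrix[OF o', folded e_def]
  define dXv dYv dZv dWv where "dXv = C\<^sup>2 * va - 2 * S * C * v1 * a" "dYv = S * vb + C * v1 * b"
    "dZv = C\<^sup>2 * vc - 2 * S * C * v1 * c" "dWv = S * vd + C * v1 * d"
  note dv = this
  define dXw dYw dZw dWw where "dXw = C\<^sup>2 * wa - 2 * S * C * w1 * a" "dYw = S * wb + C * w1 * b"
    "dZw = C\<^sup>2 * wc - 2 * S * C * w1 * c" "dWw = S * wd + C * w1 * d"
  note dw = this
  have "X * dXv = Y * dYv" "Z * dZv = W * dWv" "dXv * Z + X * dZv = dYv * W + Y * dWv"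
    using v unfolding XYZW dv by algebra+
  from lorentz_matrix_tangent[OF o'(1) lm this]
  obtain t where t: "dXv = t * Y" "dYv = t * X" "dZv = e * t * X" "dWv = e * t * Y" by blast
  have "X * dXw = Y * dYw" "Z * dZw = W * dWw" "dXw * Z + X * dZw = dYw * W + Y * dWw"
    using w unfolding XYZW dw by algebra+
  from lorentz_matrix_tangent[OF o'(1) lm this]
  obtain s where s: "dXw = s * Y" "dYw = s * X" "dZw = e * s * X" "dWw = e * s * Y" by blast
  \<comment> \<open>This is e / C, the coefficient of dv in the connection form, written without
    division so that the identities stay polynomial.\<close>
  define h where "h = S * C * (a * d - b * c)"
  have Ch: "C * h = e" unfolding h_def e_def XYZW by algebra
  have "\<kappa>v = X * dZv - Y * dWv + h * v2" "\<kappa>w = X * dZw - Y * dWw + h * w2"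
    unfolding \<kappa>v_def \<kappa>w_def h_def XYZW dv dw by algebra+
  then have \<kappa>: "\<kappa>v = e * t + h * v2" "\<kappa>w = e * s + h * w2"
    unfolding t s using o'(1) by algebra+
  have "C ^ 4 * (w1 * va - v1 * wa) - S\<^sup>2 * (w2 * vb - v2 * wb) - 2 * S * C * b * (v1 * w2 - w1 * v2)
    = C\<^sup>2 * (w1 * dXv - v1 * dXw) - S * (w2 * dYv - v2 * dYw) - C * Y * (v1 * w2 - w1 * v2)"
    unfolding XYZW dv dw by algebra
  also have "\<dots> = \<kappa>v * (C\<^sup>2 * w1 * Z - S * w2 * W) - \<kappa>w * (C\<^sup>2 * v1 * Z - S * v2 * W)"
    unfolding \<kappa> t s lm(1,2) using lm(3) Ch by algebra
  also have "\<dots> = \<kappa>v * (C ^ 4 * (w1 * c) - S\<^sup>2 * (w2 * d)) - \<kappa>w * (C ^ 4 * (v1 * c) - S\<^sup>2 * (v2 * d))"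
    unfolding XYZW by algebra
  finally show ?t1 .
  have "C ^ 4 * (w1 * vc - v1 * wc) - S\<^sup>2 * (w2 * vd - v2 * wd) - 2 * S * C * d * (v1 * w2 - w1 * v2)
    = C\<^sup>2 * (w1 * dZv - v1 * dZw) - S * (w2 * dWv - v2 * dWw) - C * W * (v1 * w2 - w1 * v2)"
    unfolding XYZW dv dw by algebra
  also have "\<dots> = \<kappa>v * (C\<^sup>2 * w1 * X - S * w2 * Y) - \<kappa>w * (C\<^sup>2 * v1 * X - S * v2 * Y)"
    unfolding \<kappa> t s lm(2) using lm(3) Ch by algebra
  also have "\<dots> = \<kappa>v * (C ^ 4 * (w1 * a) - S\<^sup>2 * (w2 * b)) - \<kappa>w * (C ^ 4 * (v1 * a) - S\<^sup>2 * (v2 * b))"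
    unfolding XYZW by algebra
  finally show ?t2 .
  \<comment> \<open>The determinant X W - Y Z is locally constant along the frames; this is its
    vanishing derivative, divided by C.\<close>
  have ev: "S * C * (va * d + a * vd - vb * c - b * vc) = (2 * S\<^sup>2 - C\<^sup>2) * v1 * (a * d - b * c)"
  proof -
    have "dXv * W + X * dWv - dYv * Z - Y * dZv = 0"
      unfolding t lm(1,2) by algebra
    then have "C * (S * C * (va * d + a * vd - vb * c - b * vc)) = C * ((2 * S\<^sup>2 - C\<^sup>2) * v1 * (a * d - b * c))"
      unfolding XYZW dv by algebra
    then show ?thesis using CS(1) by simp
  qed
  have ew: "S * C * (wa * d + a * wd - wb * c - b * wc) = (2 * S\<^sup>2 - C\<^sup>2) * w1 * (a * d - b * c)"
  proof -
    have "dXw * W + X * dWw - dYw * Z - Y * dZw = 0"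
      unfolding s lm(1,2) by algebra
    then have "C * (S * C * (wa * d + a * wd - wb * c - b * wc)) = C * ((2 * S\<^sup>2 - C\<^sup>2) * w1 * (a * d - b * c))"
      unfolding XYZW dw by algebra
    then show ?thesis using CS(1) by simp
  qed
  have q: "dXv * dZw - dXw * dZv - (dYv * dWw - dYw * dWv) = 0"
    unfolding t s by algebra
  then show ?t3
    using ev ew unfolding dv dw by algebra
qed

text \<open>This is <e_1, D e_2> for the Levi-Civita connection D of \<open>normal_metric\<close>,
  whose nonzero Christoffel symbols are -2 tan u (1; 11), sin u / cos^3 u (1; 22) and cot u (2;
  12).\<close>

fun normal_connection :: "(frame2, real) form1" where
  "normal_connection (x, e1, e2) (dx, de1, de2) =
     cos (x $ 1) ^ 4 * e1 $ 1 * de2 $ 1 - 2 * sin (x $ 1) * cos (x $ 1) ^ 3 * e1 $ 1 * e2 $ 1 * dx $ 1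
     - (sin (x $ 1))\<^sup>2 * e1 $ 2 * de2 $ 2 - sin (x $ 1) * cos (x $ 1) * e1 $ 2 * e2 $ 2 * dx $ 1
     + sin (x $ 1) * cos (x $ 1) * (e1 $ 1 * e2 $ 2 - e1 $ 2 * e2 $ 1) * dx $ 2"

lemma normal_connection_eq:
  "normal_connection z v =
     cos (fst z $ 1) ^ 4 * fst (snd z) $ 1 * snd (snd v) $ 1
     - 2 * sin (fst z $ 1) * cos (fst z $ 1) ^ 3 * fst (snd z) $ 1 * snd (snd z) $ 1 * fst v $ 1
     - (sin (fst z $ 1))\<^sup>2 * fst (snd z) $ 2 * snd (snd v) $ 2
     - sin (fst z $ 1) * cos (fst z $ 1) * fst (snd z) $ 2 * snd (snd z) $ 2 * fst v $ 1
     + sin (fst z $ 1) * cos (fst z $ 1) * (fst (snd z) $ 1 * snd (snd z) $ 2 - fst (snd z) $ 2 * snd (snd z) $ 1) * fst v $ 2"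
  by (cases z; cases v) simp

lemma coordinate_derivatives:
  "((\<lambda>y::frame2. fst y $ i) has_derivative (\<lambda>v. fst v $ i)) F"
  "((\<lambda>y::frame2. fst (snd y) $ i) has_derivative (\<lambda>v. fst (snd v) $ i)) F"
  "((\<lambda>y::frame2. snd (snd y) $ i) has_derivative (\<lambda>v. snd (snd v) $ i)) F"
  by (intro bounded_linear_imp_has_derivative bounded_linear_compose[OF bounded_linear_vec_nth]
      bounded_linear_compose[OF bounded_linear_fst] bounded_linear_compose[OF bounded_linear_snd]
      bounded_linear_fst bounded_linear_snd)+

lemma normal_metric_curvature:
  assumes V: "open V" and rng: "\<And>y. y \<in> V \<Longrightarrow> 0 < y $ 1 \<and> y $ 1 < pi / 2"
  shows "has_gauss_curvature V normal_metric (\<lambda>x. - ((1 / cos (x $ 1)) ^ 4))"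
  unfolding has_gauss_curvature_def structure_equations_def
proof (intro exI[of _ normal_connection] conjI ballI)
  have o: "open (V \<times> (UNIV :: ((real^2) \<times> (real^2)) set))" using V by (simp add: open_Times)
  show "smooth_form_on (V \<times> UNIV) normal_connection"
    unfolding smooth_form_on_def
  proof (intro conjI ballI allI)
    show "linear (normal_connection z)" for z
      by (rule linearI) (simp_all add: normal_connection_eq algebra_simps)
    show "smooth_on (V \<times> UNIV) (\<lambda>z. normal_connection z v)" for v
      unfolding normal_connection_eq by (intro smooth_intros o)
  qed
  fix z v w
  assume z: "z \<in> frame_bundle V normal_metric"
    and v: "v \<in> tangent_space (frame_bundle V normal_metric) z"
    and w: "w \<in> tangent_space (frame_bundle V normal_metric) z"
  define C S where "C = cos (fst z $ 1)" and "S = sin (fst z $ 1)"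
  define a b where "a = fst (snd z) $ 1" and "b = fst (snd z) $ 2"
  define c d where "c = snd (snd z) $ 1" and "d = snd (snd z) $ 2"
  have r: "0 < fst z $ 1" "fst z $ 1 < pi / 2" using rng z by (auto simp: frame_bundle_def)
  have "fst z $ 1 < pi" using r(2) pi_gt_zero by linarith
  then have CS: "C \<noteq> 0" "S \<noteq> 0"
    using cos_gt_zero[OF r] sin_gt_zero[OF r(1)] by (auto simp: C_def S_def)
  have ons: "normal_metric (fst y) (fst (snd y)) (fst (snd y)) = 1"
     "normal_metric (fst y) (snd (snd y)) (snd (snd y)) = -1"
     "normal_metric (fst y) (fst (snd y)) (snd (snd y)) = 0"
    if "y \<in> frame_bundle V normal_metric" for y
    using that by (auto simp: frame_bundle_def orthonormal2_def)
  have on: "C ^ 4 * (a * a) - S\<^sup>2 * (b * b) = 1" "C ^ 4 * (c * c) - S\<^sup>2 * (d * d) = -1"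
      "C ^ 4 * (a * c) - S\<^sup>2 * (b * d) = 0"
    using ons[OF z] by (simp_all add: normal_metric_def C_def S_def a_def b_def c_def d_def)
  note cd = coordinate_derivatives
  \<comment> \<open>Tangent vectors of the frame bundle are used only through the differentiated
    orthonormality relations.\<close>
  have tan: "C ^ 4 * (2 * a * fst (snd v) $ 1) - 4 * C ^ 3 * S * fst v $ 1 * (a * a)
        - S\<^sup>2 * (2 * b * fst (snd v) $ 2) - 2 * S * C * fst v $ 1 * (b * b) = 0" (is ?e1)
      "C ^ 4 * (2 * c * snd (snd v) $ 1) - 4 * C ^ 3 * S * fst v $ 1 * (c * c)
        - S\<^sup>2 * (2 * d * snd (snd v) $ 2) - 2 * S * C * fst v $ 1 * (d * d) = 0" (is ?e2)
      "C ^ 4 * (a * snd (snd v) $ 1 + fst (snd v) $ 1 * c) - 4 * C ^ 3 * S * fst v $ 1 * (a * c)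
        - S\<^sup>2 * (b * snd (snd v) $ 2 + fst (snd v) $ 2 * d) - 2 * S * C * fst v $ 1 * (b * d) = 0" (is ?e3)
    if v: "v \<in> tangent_space (frame_bundle V normal_metric) z" for v
  proof -
    have "((\<lambda>y::frame2. normal_metric (fst y) (fst (snd y)) (fst (snd y))) has_derivative
        (\<lambda>v. C ^ 4 * (2 * a * fst (snd v) $ 1) - 4 * C ^ 3 * S * fst v $ 1 * (a * a)
        - S\<^sup>2 * (2 * b * fst (snd v) $ 2) - 2 * S * C * fst v $ 1 * (b * b))) (at z)"
      unfolding normal_metric_def
      by (auto intro!: derivative_eq_intros cd simp: fun_eq_iff C_def S_def a_def b_def algebra_simps)
    from tangent_space_const[OF this ons(1) v]
    show ?e1 .
    have "((\<lambda>y::frame2. normal_metric (fst y) (snd (snd y)) (snd (snd y))) has_derivative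
        (\<lambda>v. C ^ 4 * (2 * c * snd (snd v) $ 1) - 4 * C ^ 3 * S * fst v $ 1 * (c * c)
        - S\<^sup>2 * (2 * d * snd (snd v) $ 2) - 2 * S * C * fst v $ 1 * (d * d))) (at z)"
      unfolding normal_metric_def
      by (auto intro!: derivative_eq_intros cd simp: fun_eq_iff C_def S_def c_def d_def algebra_simps)
    from tangent_space_const[OF this ons(2) v]
    show ?e2 .
    have "((\<lambda>y::frame2. normal_metric (fst y) (fst (snd y)) (snd (snd y))) has_derivative
        (\<lambda>v. C ^ 4 * (a * snd (snd v) $ 1 + fst (snd v) $ 1 * c) - 4 * C ^ 3 * S * fst v $ 1 * (a * c)
        - S\<^sup>2 * (b * snd (snd v) $ 2 + fst (snd v) $ 2 * d) - 2 * S * C * fst v $ 1 * (b * d))) (at z)"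
      unfolding normal_metric_def
      by (auto intro!: derivative_eq_intros cd
          simp: fun_eq_iff C_def S_def a_def b_def c_def d_def algebra_simps)
    from tangent_space_const[OF this ons(3) v]
    show ?e3 .
  qed
  note id = normal_structure_identities[OF CS on tan[OF v] tan[OF w], where ?v2.0 = "fst v $ 2" and ?w2.0 = "fst w $ 2"]
  have \<kappa>: "normal_connection z u = C ^ 4 * a * snd (snd u) $ 1 - 2 * S * C ^ 3 * a * c * fst u $ 1
     - S\<^sup>2 * b * snd (snd u) $ 2 - S * C * b * d * fst u $ 1 + S * C * (a * d - b * c) * fst u $ 2" for u
    by (simp add: normal_connection_eq C_def S_def a_def b_def c_def d_def)
  have \<eta>: "eta1 normal_metric z u = C ^ 4 * (fst u $ 1 * a) - S\<^sup>2 * (fst u $ 2 * b)"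
    "eta2 normal_metric z u = - (C ^ 4 * (fst u $ 1 * c) - S\<^sup>2 * (fst u $ 2 * d))" for u
    by (simp_all add: eta_simps normal_metric_def C_def S_def a_def b_def c_def d_def)
  have D1: "dd (\<lambda>y. eta1 normal_metric y u) z =
     (\<lambda>v. C ^ 4 * (fst u $ 1 * fst (snd v) $ 1) - 4 * C ^ 3 * S * fst v $ 1 * (fst u $ 1 * a)
        - S\<^sup>2 * (fst u $ 2 * fst (snd v) $ 2) - 2 * S * C * fst v $ 1 * (fst u $ 2 * b))" for u
    unfolding eta_simps normal_metric_def
    by (rule frechet_eq)
       (auto intro!: derivative_eq_intros cd simp: fun_eq_iff C_def S_def a_def b_def algebra_simps)
  show "ext_d (eta1 normal_metric) z v w = - wedge (normal_connection z) (eta2 normal_metric z) v w"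
    using id(1)[folded \<kappa>[of v] \<kappa>[of w]] unfolding ext_d_def wedge_def D1 \<eta> by algebra
  have D2: "dd (\<lambda>y. eta2 normal_metric y u) z =
     (\<lambda>v. - (C ^ 4 * (fst u $ 1 * snd (snd v) $ 1) - 4 * C ^ 3 * S * fst v $ 1 * (fst u $ 1 * c)
        - S\<^sup>2 * (fst u $ 2 * snd (snd v) $ 2) - 2 * S * C * fst v $ 1 * (fst u $ 2 * d)))" for u
    unfolding eta_simps normal_metric_def
    by (rule frechet_eq)
       (auto intro!: derivative_eq_intros cd simp: fun_eq_iff C_def S_def c_def d_def algebra_simps)
  show "ext_d (eta2 normal_metric) z v w = - wedge (normal_connection z) (eta1 normal_metric z) v w"
    using id(2)[folded \<kappa>[of v] \<kappa>[of w]] unfolding ext_d_def wedge_def D2 \<eta> by algebra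
  have D3: "dd (\<lambda>y. normal_connection y u) z =
     (\<lambda>v. C ^ 4 * fst (snd v) $ 1 * snd (snd u) $ 1 - 4 * C ^ 3 * S * fst v $ 1 * a * snd (snd u) $ 1
       - 2 * (C ^ 4 - 3 * S\<^sup>2 * C\<^sup>2) * fst v $ 1 * a * c * fst u $ 1
       - 2 * S * C ^ 3 * (fst (snd v) $ 1 * c + a * snd (snd v) $ 1) * fst u $ 1
       - 2 * S * C * fst v $ 1 * b * snd (snd u) $ 2 - S\<^sup>2 * fst (snd v) $ 2 * snd (snd u) $ 2
       - (C\<^sup>2 - S\<^sup>2) * fst v $ 1 * b * d * fst u $ 1
       - S * C * (fst (snd v) $ 2 * d + b * snd (snd v) $ 2) * fst u $ 1
       + (C\<^sup>2 - S\<^sup>2) * fst v $ 1 * (a * d - b * c) * fst u $ 2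
       + S * C * (fst (snd v) $ 1 * d + a * snd (snd v) $ 2 - fst (snd v) $ 2 * c - b * snd (snd v) $ 1) * fst u $ 2)" for u
    unfolding normal_connection_eq
    by (rule frechet_eq)
       (auto intro!: derivative_eq_intros cd
         simp: fun_eq_iff C_def S_def a_def b_def c_def d_def algebra_simps eval_nat_numeral)
  have "ext_d normal_connection z v w = S\<^sup>2 * (a * d - b * c) * (fst v $ 1 * fst w $ 2 - fst w $ 1 * fst v $ 2)"
    unfolding id(3)[symmetric] ext_d_def D3 by algebra
  also have "\<dots> = (1 / C) ^ 4 * wedge (eta1 normal_metric z) (eta2 normal_metric z) v w"
  proof -
    have "wedge (eta1 normal_metric z) (eta2 normal_metric z) v w =
       C ^ 4 * (S\<^sup>2 * (a * d - b * c) * (fst v $ 1 * fst w $ 2 - fst w $ 1 * fst v $ 2))"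
      unfolding wedge_def \<eta> by algebra
    then show ?thesis using CS by (simp add: power_divide)
  qed
  finally show "ext_d normal_connection z v w = - (- ((1 / cos (fst z $ 1)) ^ 4)) *
      wedge (eta1 normal_metric z) (eta2 normal_metric z) v w"
    by (simp add: C_def)
qed

section \<open>Local framings and charts\<close>

lemma open_positive:
  assumes "open S" "smooth_on S f"
  shows "open {x \<in> S. (0::real) < f x}"
proof -
  have "open (S \<inter> f -` {0<..})"
    by (rule continuous_open_preimage[OF smooth_on_continuous[OF assms(2)] assms(1)]) auto
  moreover have "S \<inter> f -` {0<..} = {x \<in> S. 0 < f x}" by auto
  ultimately show ?thesis by simp
qed

text \<open>Gram-Schmidt, started from a frame at x0 extended by constant vectors, on the open set
  where the timelike and the spacelike norm keep their signs.\<close>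

lemma local_orthonormal_framing:
  assumes "open D" "lorentzian_metric_on D g" "x0 \<in> D"
  obtains S E1 E2 where "open S" "S \<subseteq> D" "x0 \<in> S" "orthonormal_framing_on S g E1 E2"
proof -
  have bil: "bilinear (g x)" and sym: "g x v w = g x w v" if "x \<in> D" for x v w
    using assms(2) that by (auto simp: lorentzian_metric_on_def)
  obtain e1 e2 where e: "orthonormal2 g x0 e1 e2"
    using assms(2,3) by (auto simp: lorentzian_metric_on_def)
  define n1 where "n1 x = g x e1 e1" for x
  have sm: "smooth_on S (\<lambda>x. g x (X x) (Y x))" if "open S" "S \<subseteq> D" "smooth_on S X" "smooth_on S Y" for S X Y
    by (rule smooth_on_metric[OF that(1) _ assms(1,2) smooth_on_id that(3,4)]) (use that(2) in auto)
  define S1 where "S1 = {x \<in> D. 0 < n1 x}"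
  have S1: "open S1" "S1 \<subseteq> D"
    unfolding S1_def n1_def using open_positive[OF assms(1) sm[OF assms(1)]] by (auto intro: smooth_on_const)
  have sn1: "smooth_on S1 n1" unfolding n1_def[abs_def] by (intro sm S1 smooth_on_const)
  define E1 where "E1 x = (1 / sqrt (n1 x)) *\<^sub>R e1" for x
  have sE1: "smooth_on S1 E1"
    unfolding E1_def[abs_def] by (intro smooth_intros smooth_on_sqrt sn1 S1) (auto simp: S1_def)
  define f2 where "f2 x = e2 - g x e2 (E1 x) *\<^sub>R E1 x" for x
  have sf2: "smooth_on S1 f2" unfolding f2_def[abs_def] by (intro smooth_intros sm sE1 S1)
  define n2 where "n2 x = - g x (f2 x) (f2 x)" for x
  have sn2: "smooth_on S1 n2" unfolding n2_def[abs_def] by (intro smooth_intros sm sf2 S1)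
  define S where "S = {x \<in> S1. 0 < n2 x}"
  have S: "open S" "S \<subseteq> S1" unfolding S_def using open_positive[OF S1(1) sn2] by auto
  define E2 where "E2 x = (1 / sqrt (n2 x)) *\<^sub>R f2 x" for x
  have sE2: "smooth_on S E2" unfolding E2_def[abs_def]
    by (intro smooth_intros smooth_on_sqrt smooth_on_subset[OF sn2] smooth_on_subset[OF sf2] S)
       (auto simp: S_def)
  have "E1 x0 = e1" using e by (simp add: E1_def n1_def orthonormal2_def)
  then have "f2 x0 = e2" using e sym[OF assms(3), of e1 e2] by (simp add: f2_def orthonormal2_def)
  then have "x0 \<in> S" using e assms(3) by (simp add: S_def S1_def n1_def n2_def orthonormal2_def)
  moreover have "orthonormal2 g x (E1 x) (E2 x)" if "x \<in> S" for x
  proof -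
    have xD: "x \<in> D" and n1: "0 < n1 x" and n2: "0 < n2 x" using that by (auto simp: S_def S1_def)
    note b = bil[OF xD]
    have 1: "g x (E1 x) (E1 x) = 1"
      using n1 by (simp add: E1_def bilinear_lmul[OF b] bilinear_rmul[OF b] n1_def[symmetric] mult.assoc[symmetric])
    have "g x (E1 x) (f2 x) = 0"
      using 1 sym[OF xD, of "E1 x" e2] by (simp add: f2_def bilinear_rsub[OF b] bilinear_rmul[OF b])
    then have 2: "g x (E1 x) (E2 x) = 0" by (simp add: E2_def bilinear_rmul[OF b])
    have "g x (E2 x) (E2 x) = (1 / sqrt (n2 x)) * (1 / sqrt (n2 x)) * (- n2 x)"
      by (simp add: E2_def bilinear_lmul[OF b] bilinear_rmul[OF b] n2_def)
    then have "g x (E2 x) (E2 x) = -1" using n2 by simp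
    with 1 2 show ?thesis by (simp add: orthonormal2_def)
  qed
  ultimately show ?thesis
    using S S1(2) sE2 smooth_on_subset[OF sE1 S(2)]
    by (intro that[of S E1 E2]) (auto simp: orthonormal_framing_on_def)
qed

lemma standard_mink_frame: "(0, axis 1 1, axis 2 1, axis 3 1) \<in> mink_frames"
  by (simp add: mink_frames_def mink_def axis_def)

lemma orthonormal_framing_subset:
  "orthonormal_framing_on S g E1 E2 \<Longrightarrow> T \<subseteq> S \<Longrightarrow> orthonormal_framing_on T g E1 E2"
  by (auto simp: orthonormal_framing_on_def intro: smooth_on_subset)

lemma local_normal_form:
  assumes D: "open D" "x0 \<in> D" and lor: "lorentzian_metric_on D g"
    and str: "structure_equations D g \<kappa> K" and neg: "\<And>x. x \<in> D \<Longrightarrow> K x < 0"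
    and di: "darboux_integrable_on D g \<kappa> K" and kil: "spacelike_killing_on D g K"
  shows "\<exists>r>0. \<exists>U V \<psi> H. normal_chart r g U V \<psi> H \<and> U \<subseteq> D \<and> x0 \<in> U"
proof -
  have ks: "killing_surface D S g \<kappa> K E1 E2"
    if "open S" "S \<subseteq> D" "orthonormal_framing_on S g E1 E2" for S E1 E2
  proof
    show "killing_field_on S g (V_field K E1 E2)" "spacelike_on S g (V_field K E1 E2)"
      using kil that by (auto simp: spacelike_killing_on_def)
  qed (use D lor str neg that in auto)
  obtain S0 F1 F2 where S0: "open S0" "S0 \<subseteq> D" "x0 \<in> S0" "orthonormal_framing_on S0 g F1 F2"
    using local_orthonormal_framing[OF D(1) lor D(2)] .
  text \<open>A boost makes the second component of \<open>dq\<close> nonzero; the first one is nonzero since the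
    Killing field is spacelike.\<close>
  have "\<exists>E1 E2. orthonormal_framing_on S0 g E1 E2 \<and> framed_surface.hh K E2 x0 \<noteq> 0"
  proof (cases "framed_surface.hh K F2 x0 = 0")
    case False
    then show ?thesis using S0(4) by blast
  next
    case True
    interpret k: killing_surface D S0 g \<kappa> K F1 F2 by (rule ks[OF S0(1,2,4)])
    \<comment> \<open>The coefficients are a hyperbolic cosine and sine with rational values:
      (5/4)^2 - (3/4)^2 = 1.\<close>
    define E1 where "E1 x = (5/4) *\<^sub>R F1 x + (3/4) *\<^sub>R F2 x" for x
    define E2 where "E2 x = (3/4) *\<^sub>R F1 x + (5/4) *\<^sub>R F2 x" for x
    have "smooth_on S0 E1" "smooth_on S0 E2"
      unfolding E1_def[abs_def] E2_def[abs_def] by (intro smooth_intros k.smooth_E S0(1))+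
    moreover have "orthonormal2 g x (E1 x) (E2 x)" if "x \<in> S0" for x
      using k.g_E[OF that] k.bil[OF that]
      by (simp add: orthonormal2_def E1_def E2_def bilinear_ladd bilinear_radd bilinear_lmul bilinear_rmul)
    ultimately have fr: "orthonormal_framing_on S0 g E1 E2" by (simp add: orthonormal_framing_on_def)
    interpret k': killing_surface D S0 g \<kappa> K E1 E2 by (rule ks[OF S0(1,2) fr])
    note l = k.dd_linear[OF k.smooth_w S0(3)]
    have "k'.hh x0 = 3/4 * k.ff x0 + 5/4 * k.hh x0"
      by (simp add: k'.hh_def k.ff_def k.hh_def E2_def linear_add[OF l] linear_cmul[OF l]
          add_divide_distrib diff_divide_distrib)
    moreover have "k.ff x0 \<noteq> 0" using k.spacelike[OF S0(3)] by auto
    ultimately have "k'.hh x0 \<noteq> 0" using True by simp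
    with fr show ?thesis by blast
  qed
  then obtain E1 E2 where fr: "orthonormal_framing_on S0 g E1 E2" and h: "framed_surface.hh K E2 x0 \<noteq> 0"
    by blast
  interpret k0: killing_surface D S0 g \<kappa> K E1 E2 by (rule ks[OF S0(1,2) fr])
  have xx: "x0 \<in> S0 \<inter> k0.hh -` (- {0})" using h S0(3) by simp
  have oo: "open (S0 \<inter> k0.hh -` (- {0}))"
    by (rule continuous_open_preimage[OF smooth_on_continuous[OF k0.smooth_fh(2)] S0(1)]) auto
  \<comment> \<open>On the ball h vanishes nowhere, so the Hessian identity holds at all of its
    points, and convexity is what the first integral and the primitive of the closed form rely
    on.\<close>
  obtain \<rho> where \<rho>: "0 < \<rho>" "ball x0 \<rho> \<subseteq> S0 \<inter> k0.hh -` (- {0})"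
    by (rule openE[OF oo xx])
  have sub: "ball x0 \<rho> \<subseteq> S0" "ball x0 \<rho> \<subseteq> D" using \<rho>(2) S0(2) by auto
  interpret k: killing_surface D "ball x0 \<rho>" g \<kappa> K E1 E2
    by (rule ks[OF open_ball sub(2) orthonormal_framing_subset[OF fr sub(1)]])
  have GG: "k.GG x = (k.kk x)\<^sup>2" if x: "x \<in> ball x0 \<rho>" for x
  proof (rule k.hessian_value[OF x _ standard_mink_frame])
    show "k.hh x \<noteq> 0" using \<rho>(2) x by auto
    let ?z = "k.lift (x, 0, axis 1 1, axis 2 1, axis 3 1)"
    have "?z \<in> frame_bundle D g \<times> mink_frames"
      using k.sg_frame[OF x] standard_mink_frame by (simp add: k.lift_def)
    note dz = bspec[OF di[unfolded darboux_integrable_on_def] this]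
    \<comment> \<open>Negative curvature rules out the elliptic alternative of Darboux integrability
      and leaves the real singular systems.\<close>
    have "\<not> 0 < K (fst (fst ?z))"
      using k.K_neg[OF x] by (simp add: k.lift_def k.sg_def)
    with dz show "singular_system_integrable_near (1::real) D g \<kappa> K ?z"
      by (elim disjE conjE) (assumption, rule notE)
  qed
  from k.normal_coordinates[OF refl \<rho>(1) GG] show ?thesis
    using sub(2) by - (drule meta_mp, assumption, elim exE conjE, intro exI conjI; blast)
qed

section \<open>Passing from coordinate domains to charts of the surface\<close>

lemma chart_facts:
  assumes "is_chart c"
  shows "open (fst c)" "open (chart_image c)" "continuous_on (fst c) (snd c)"
    "continuous_on (chart_image c) (chart_inv c)" (is ?t1)
    "\<And>p. p \<in> fst c \<Longrightarrow> snd c p \<in> chart_image c" "\<And>p. p \<in> fst c \<Longrightarrow> chart_inv c (snd c p) = p"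
    "\<And>x. x \<in> chart_image c \<Longrightarrow> chart_inv c x \<in> fst c"
    "\<And>x. x \<in> chart_image c \<Longrightarrow> snd c (chart_inv c x) = x"
proof -
  have h: "homeomorphism (fst c) (chart_image c) (snd c) (chart_inv c)" "open (fst c)" "open (chart_image c)"
    using assms by (auto simp: is_chart_def)
  show "open (fst c)" "open (chart_image c)" by (fact h)+
  show "continuous_on (fst c) (snd c)" ?t1
    using h(1) by (auto simp: homeomorphism_def)
  show "snd c p \<in> chart_image c" if "p \<in> fst c" for p using that by (auto simp: chart_image_def)
  show "chart_inv c (snd c p) = p" if "p \<in> fst c" for p by (rule homeomorphism_apply1[OF h(1) that])
  show "snd c (chart_inv c x) = x" if "x \<in> chart_image c" for x by (rule homeomorphism_apply2[OF h(1) that])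
  show "chart_inv c x \<in> fst c" if "x \<in> chart_image c" for x using h(1) that by (auto simp: homeomorphism_def)
qed

lemma chart_open_image:
  assumes "is_chart c" "open O'" "O' \<subseteq> fst c"
  shows "open (snd c ` O')"
proof -
  note cf = chart_facts[OF assms(1)]
  have "snd c ` O' = chart_image c \<inter> chart_inv c -` O'"
  proof (intro equalityI subsetI)
    fix x assume "x \<in> snd c ` O'"
    then show "x \<in> chart_image c \<inter> chart_inv c -` O'" using assms(3) cf(5,6) by auto
  next
    fix x assume "x \<in> chart_image c \<inter> chart_inv c -` O'"
    then show "x \<in> snd c ` O'" using cf(8)[of x] by (metis IntD1 IntD2 image_eqI vimageD)
  qed
  then show ?thesis using continuous_open_preimage[OF cf(4,2) assms(2)] by simp
qed

text \<open>All transition maps to and from the new chart factor through c, so smoothness of \<psi>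
  and H gives compatibility with the whole atlas. The chain rule in the last part lets a metric
  identity proved in c be read in any other chart.\<close>

lemma chart_of_coordinate_change:
  assumes A: "smooth_surface A" and c: "c \<in> A"
    and U: "open U" "U \<subseteq> chart_image c" and V: "open V"
    and h: "homeomorphism U V \<psi> H" and s: "smooth_on U \<psi>" "smooth_on V H"
  defines "d \<equiv> (chart_inv c ` U, \<psi> \<circ> snd c)"
  shows "is_chart_of A d" "chart_image d = V"
    and "\<And>c' p. c' \<in> A \<Longrightarrow> p \<in> fst c' \<inter> fst d \<Longrightarrow>
      dd (transition c' d) (snd c' p) v =
      dd \<psi> (snd c p) (dd (transition c' c) (snd c' p) v)"
proof -
  have ch: "is_chart c'" if "c' \<in> A" for c' using A that by (auto simp: smooth_surface_def)
  note cf = chart_facts[OF ch[OF c]]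
  have hp: "\<psi> ` U = V" "\<And>x. x \<in> U \<Longrightarrow> H (\<psi> x) = x" "\<And>y. y \<in> V \<Longrightarrow> \<psi> (H y) = y"
    "\<And>y. y \<in> V \<Longrightarrow> H y \<in> U" "continuous_on U \<psi>" "continuous_on V H"
    using h by (auto simp: homeomorphism_def)
  have fd: "fst d = fst c \<inter> snd c -` U"
  proof (intro equalityI subsetI)
    fix p assume "p \<in> fst d" then show "p \<in> fst c \<inter> snd c -` U"
      using U(2) cf(7,8) by (auto simp: d_def subset_iff)
  next
    fix p assume "p \<in> fst c \<inter> snd c -` U"
    then show "p \<in> fst d" using cf(6)[of p] by (auto simp: d_def image_iff intro!: bexI[of _ "snd c p"])
  qed
  have od: "open (fst d)" unfolding fd by (rule continuous_open_preimage[OF cf(3,1) U(1)])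
  have sd: "snd d = (\<lambda>p. \<psi> (snd c p))" by (auto simp: d_def)
  have "snd c ` fst d = U" unfolding fd using U(2) cf(7,8) by (force simp: image_iff)
  then show im: "chart_image d = V"
    unfolding chart_image_def sd using hp(1) by (metis image_image)
  have inj: "inj_on (snd d) (fst d)"
    unfolding sd fd by (rule inj_onI) (metis IntD1 IntD2 cf(6) hp(2) vimageD)
  have inv: "chart_inv d y = chart_inv c (H y)" if "y \<in> V" for y
  proof -
    have "H y \<in> chart_image c" using hp(4)[OF that] U(2) by auto
    then have "chart_inv c (H y) \<in> fst d" "snd d (chart_inv c (H y)) = y"
      using hp(3,4)[OF that] cf(7,8) by (auto simp: fd sd)
    then show ?thesis unfolding chart_inv_def[of d] using inv_into_f_eq[OF inj] by blast
  qed
  have isd: "is_chart d"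
    unfolding is_chart_def im
  proof (intro conjI od V homeomorphismI)
    show "continuous_on (fst d) (snd d)"
      unfolding sd by (rule continuous_on_compose2[OF hp(5) continuous_on_subset[OF cf(3)]]) (auto simp: fd)
    have "continuous_on V (\<lambda>y. chart_inv c (H y))"
      by (rule continuous_on_compose2[OF cf(4) hp(6)]) (use hp(4) U(2) in auto)
    then show "continuous_on V (chart_inv d)" using inv by (simp cong: continuous_on_cong)
    show "snd d ` fst d \<subseteq> V" using im by (simp add: chart_image_def)
    show "chart_inv d ` V \<subseteq> fst d" using inv hp(4) by (auto simp: d_def)
    show "chart_inv d (snd d p) = p" if "p \<in> fst d" for p
      unfolding chart_inv_def by (rule inv_into_f_f[OF inj that])
    show "snd d (chart_inv d y) = y" if "y \<in> V" for y
      unfolding chart_inv_def using that im by (intro f_inv_into_f) (simp add: chart_image_def)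
  qed
  have comp: "smooth_on (snd c' ` (fst c' \<inter> fst c'')) (transition c' c'')" if "c' \<in> A" "c'' \<in> A" for c' c''
    using A that by (auto simp: smooth_surface_def compatible_def)
  have trans1: "transition c' d x = \<psi> (transition c' c x)" for c' x
    by (simp add: transition_def sd)
  have oimg: "open (snd c' ` (fst c' \<inter> fst c''))" if "c' \<in> A" "open (fst c'')" for c' c''
    by (rule chart_open_image[OF ch[OF that(1)]]) (use chart_facts(1)[OF ch[OF that(1)]] that(2) in auto)
  have dc: "fst d \<subseteq> fst c" by (auto simp: fd)
  have tr: "transition c' c (snd c' p) = snd c p" if "c' \<in> A" "p \<in> fst c'" for c' p
    using chart_facts(6)[OF ch[OF that(1)] that(2)] by (simp add: transition_def)
  have cmp: "compatible d c'" if c': "c' \<in> A" for c'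
    unfolding compatible_def
  proof
    let ?W = "snd d ` (fst d \<inter> fst c')"
    have o: "open ?W"
      by (rule chart_open_image[OF isd]) (use od chart_facts(1)[OF ch[OF c']] in auto)
    have WV: "?W \<subseteq> V" using im by (auto simp: chart_image_def)
    have HW: "H ` ?W \<subseteq> snd c ` (fst c \<inter> fst c')"
      using hp(2) by (auto simp: sd fd)
    have sm: "smooth_on ?W (\<lambda>y. transition c c' (H y))"
      by (rule smooth_on_compose[OF o oimg[OF c chart_facts(1)[OF ch[OF c']]] HW comp[OF c c']
            smooth_on_subset[OF s(2) WV]])
    have eq: "transition d c' y = transition c c' (H y)" if "y \<in> ?W" for y
      using inv WV that by (auto simp: transition_def)
    show "smooth_on (snd d ` (fst d \<inter> fst c')) (transition d c')"
      by (rule smooth_on_cong[OF o eq, THEN iffD2, OF _ sm])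
  next
    let ?W = "snd c' ` (fst c' \<inter> fst d)"
    have o: "open ?W" by (rule oimg[OF c' od])
    have sub: "?W \<subseteq> snd c' ` (fst c' \<inter> fst c)" using dc by auto
    have im: "transition c' c ` ?W \<subseteq> U"
      using tr[OF c'] by (auto simp: fd)
    have "smooth_on ?W (\<lambda>y. \<psi> (transition c' c y))"
      by (rule smooth_on_compose[OF o U(1) im s(1) smooth_on_subset[OF comp[OF c' c] sub]])
    then show "smooth_on (snd c' ` (fst d \<inter> fst c')) (transition c' d)"
      by (simp add: trans1[abs_def] Int_commute)
  qed
  show "is_chart_of A d"
    using cmp isd dc c by (auto simp: is_chart_of_def carrier_of_def)
  fix c' p assume c': "c' \<in> A" and p: "p \<in> fst c' \<inter> fst d"
  have "(transition c' c has_derivative dd (transition c' c) (snd c' p)) (at (snd c' p))"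
    by (rule smooth_on_has_derivative[OF comp[OF c' c]]) (use p dc in auto)
  moreover have "(\<psi> has_derivative dd \<psi> (snd c p)) (at (transition c' c (snd c' p)))"
    unfolding tr[OF c', of p, OF IntD1[OF p]]
    by (rule smooth_on_has_derivative[OF s(1)]) (use p in \<open>auto simp: fd\<close>)
  ultimately have "((\<lambda>x. \<psi> (transition c' c x)) has_derivative
     (\<lambda>v. dd \<psi> (snd c p) (dd (transition c' c) (snd c' p) v)))
     (at (snd c' p))"
    by (rule has_derivative_compose)
  then show "dd (transition c' d) (snd c' p) v =
      dd \<psi> (snd c p) (dd (transition c' c) (snd c' p) v)"
    unfolding trans1[abs_def] by (simp add: frechet_eq)
qed

theorem theorem13:
  fixes A :: "('m::{t2_space, second_countable_topology}) chart set"
    and g :: "'m chart \<Rightarrow> metric"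
    and \<kappa> :: "'m chart \<Rightarrow> (frame2, real) form1"
    and K :: "'m \<Rightarrow> real"
  assumes "lorentzian_surface A g"
    and "connection_and_curvature A g \<kappa> K"
    and "hyperbolic A K"
    and "darboux_integrable A g \<kappa> K"
    and "has_spacelike_killing_field A g K"
  shows "\<forall>p\<in>carrier_of A. \<exists>r>0. \<exists>d. is_chart_of A d \<and> p \<in> fst d \<and>
           (\<forall>c\<in>A. same_metric c (scale_metric r (g c)) d normal_metric) \<and>
           has_gauss_curvature (chart_image d) normal_metric (\<lambda>x. - ((1 / cos (x $ 1)) ^ 4))"
proof
  fix p assume "p \<in> carrier_of A"
  then obtain c where c: "c \<in> A" "p \<in> fst c" by (auto simp: carrier_of_def)
  have sur: "smooth_surface A" and lor: "lorentzian_metric_on (chart_image c) (g c)"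
    and same: "\<And>c'. c' \<in> A \<Longrightarrow> same_metric c' (g c') c (g c)"
    using assms(1) c(1) by (auto simp: lorentzian_surface_def)
  have "is_chart c" using sur c(1) by (auto simp: smooth_surface_def)
  note cf = chart_facts[OF this]
  have neg: "(K \<circ> chart_inv c) x < 0" if "x \<in> chart_image c" for x
    using assms(3) cf(7)[OF that] c(1) by (auto simp: hyperbolic_def carrier_of_def)
  have str: "structure_equations (chart_image c) (g c) (\<kappa> c) (K \<circ> chart_inv c)"
    and di: "darboux_integrable_on (chart_image c) (g c) (\<kappa> c) (K \<circ> chart_inv c)"
    and kil: "spacelike_killing_on (chart_image c) (g c) (K \<circ> chart_inv c)"
    using assms(2,4,5) c(1)
    by (auto simp: connection_and_curvature_def darboux_integrable_def has_spacelike_killing_field_def)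
  obtain r U V \<psi> H where r: "0 < r" and N: "normal_chart r (g c) U V \<psi> H"
      and U: "U \<subseteq> chart_image c" "snd c p \<in> U"
    using local_normal_form[OF cf(2) cf(5)[OF c(2)] lor str neg di kil] by blast
  have V: "open V" and h: "homeomorphism U V \<psi> H" and s: "open U" "smooth_on U \<psi>" "smooth_on V H"
    and rng: "\<And>y. y \<in> V \<Longrightarrow> 0 < y $ 1 \<and> y $ 1 < pi / 2"
    and met: "\<And>x a b. x \<in> U \<Longrightarrow> r * g c x a b = normal_metric (\<psi> x) (dd \<psi> x a) (dd \<psi> x b)"
    using N by (auto simp: normal_chart_def)
  define d where "d = (chart_inv c ` U, \<psi> \<circ> snd c)"
  note D = chart_of_coordinate_change[OF sur c(1) s(1) U(1) V h s(2,3), folded d_def]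
  have pd: "p \<in> fst d" using U(2) cf(6)[OF c(2)] by (auto simp: d_def image_iff intro!: bexI[of _ "snd c p"])
  have "same_metric c' (scale_metric r (g c')) d normal_metric" if c': "c' \<in> A" for c'
    unfolding same_metric_def scale_metric_def
  proof (intro ballI allI)
    fix q v w assume q: "q \<in> fst c' \<inter> fst d"
    then have qU: "snd c q \<in> U" and qc: "q \<in> fst c" using U(1) cf(7,8) by (auto simp: d_def subset_iff)
    \<comment> \<open>First the metric is transported from c' to c, where the normal form is known;
      then the chain rule identifies the result with the pullback from d.\<close>
    have "g c' (snd c' q) v w = g c (snd c q) (dd (transition c' c) (snd c' q) v)
        (dd (transition c' c) (snd c' q) w)"
      using same[OF c'] q qc by (auto simp: same_metric_def)
    then show "r * g c' (snd c' q) v w = normal_metric (snd d q)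
        (dd (transition c' d) (snd c' q) v)
        (dd (transition c' d) (snd c' q) w)"
      unfolding D(3)[OF c' q] by (simp add: met[OF qU] d_def)
  qed
  moreover have "has_gauss_curvature (chart_image d) normal_metric (\<lambda>x. - ((1 / cos (x $ 1)) ^ 4))"
    unfolding D(2) by (rule normal_metric_curvature[OF V rng])
  ultimately show "\<exists>r>0. \<exists>d. is_chart_of A d \<and> p \<in> fst d \<and>
           (\<forall>c\<in>A. same_metric c (scale_metric r (g c)) d normal_metric) \<and>
           has_gauss_curvature (chart_image d) normal_metric (\<lambda>x. - ((1 / cos (x $ 1)) ^ 4))"
    using r D(1) pd by blast
qed

end
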